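(* Let $\ell_1=\ell_2$. Then the projection $x(t)$ to $\mathbb{R}^2$ of any geodesic in ${\mathcal C}$ is an elastic curve.
   Context: 2-linkage: a triple of points $x,m_1,m_2\in\mathbb{R}^2$ with $|xm_1|=\ell_1>0$, $|xm_2|=\ell_2>0$ fixed. Coordinates: $x=(x_1,x_2)$ and the directions $\alpha_1,\alpha_2\in\mathbb{R}/2\pi\mathbb{Z}$ of the oriented segments $m_1x$, $m_2x$, so $m_i=x-\ell_i(\cos\alpha_i,\sin\alpha_i)$. The configuration space ${\mathcal C}$ is $\mathbb{R}^2\times T^2$ with the locus $m_1=m_2$ removed (for $\ell_1=\ell_2$: the set $\alpha_1=\alpha_2$ is removed). A curve in ${\mathcal C}$ is horizontal (tangent to the distribution ${\mathcal D}$) if the velocity of $m_i$ is parallel to the segment $m_ix$ for $i=1,2$. The length of a horizontal curve is the Euclidean length of its projection $x(t)$. A geodesic is a horizontal curve, parameterized by arc length, that locally minimizes length among horizontal curves with the same endpoints. By sub-Riemannian theory, the non-singular geodesics are the projections to ${\mathcal C}$ of the trajectories on the level $H=\frac12$ of the Hamiltonian system on $T^*{\mathcal C}$ with coordinates $(x_1,x_2,\alpha_1,\alpha_2,p_1,p_2,\eta_1,\eta_2)$ (standard symplectic form) and $H=\frac12(L_1^2+L_2^2)$, $L_1=p_1-\frac{\eta_1\sin\alpha_1}{\ell_1}-\frac{\eta_2\sin\alpha_2}{\ell_2}$, $L_2=p_2+\frac{\eta_1\cos\alpha_1}{\ell_1}+\frac{\eta_2\cos\alpha_2}{\ell_2}$.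 An elastic curve (elastica) is a planar curve whose curvature $\kappa$, as a function of arc length, satisfies $\ddot\kappa+\frac12\kappa^3+A\kappa=0$ for some constant $A$ (straight lines are included). *)

theory Defs
  imports "HOL-Analysis.Analysis"
begin

text \<open>
  A 2-linkage is a triple \<open>(x, m\<^sub>1, m\<^sub>2)\<close> of points in the plane. In terms of the angles
  \<open>\<alpha>\<^sub>i\<close> with \<open>m\<^sub>i = x - l\<^sub>i (cos \<alpha>\<^sub>i, sin \<alpha>\<^sub>i)\<close>, the set below is the part of the product of
  the plane and the 2-torus where \<open>m\<^sub>1 \<noteq> m\<^sub>2\<close>.
\<close>

type_synonym linkage = "(real ^ 2) \<times> (real ^ 2) \<times> (real ^ 2)"

abbreviation tip :: "linkage \<Rightarrow> real ^ 2" where "tip \<equiv> fst"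
abbreviation foot1 :: "linkage \<Rightarrow> real ^ 2" where "foot1 \<equiv> fst \<circ> snd"
abbreviation foot2 :: "linkage \<Rightarrow> real ^ 2" where "foot2 \<equiv> snd \<circ> snd"

definition config_space :: "real \<Rightarrow> real \<Rightarrow> linkage set" where
  "config_space l1 l2 =
     {q. dist (tip q) (foot1 q) = l1 \<and> dist (tip q) (foot2 q) = l2 \<and> foot1 q \<noteq> foot2 q}"

text \<open>
  Horizontal curves are taken piecewise continuously differentiable. The velocity of a foot may
  vanish, which is why parallelism is membership in the span of the (nonzero) segment.
\<close>

definition horizontal_on :: "real \<Rightarrow> real \<Rightarrow> real \<Rightarrow> real \<Rightarrow> (real \<Rightarrow> linkage) \<Rightarrow> bool" where
  "horizontal_on l1 l2 a b \<gamma> \<longleftrightarrow>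
     \<gamma> piecewise_C1_differentiable_on {a..b} \<and>
     \<gamma> ` {a..b} \<subseteq> config_space l1 l2 \<and>
     (\<forall>t\<in>{a<..<b}. \<gamma> differentiable (at t) \<longrightarrow>
        vector_derivative (foot1 \<circ> \<gamma>) (at t) \<in> span {tip (\<gamma> t) - foot1 (\<gamma> t)} \<and>
        vector_derivative (foot2 \<circ> \<gamma>) (at t) \<in> span {tip (\<gamma> t) - foot2 (\<gamma> t)})"

text \<open>
  The library's piecewise \<open>C\<^sup>1\<close> curves may have unbounded speed near the finitely many exceptional
  parameters, so a curve can have infinite length; an \<open>ennreal\<close>-valued integral keeps such a curve
  from being assigned length 0.
\<close>

definition curve_length :: "real \<Rightarrow> real \<Rightarrow> (real \<Rightarrow> linkage) \<Rightarrow> ennreal" where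
  "curve_length a b \<gamma> =
     (\<integral>\<^sup>+ t\<in>{a..b}. ennreal (norm (vector_derivative (tip \<circ> \<gamma>) (at t))) \<partial>lborel)"

definition length_minimizing_on ::
    "real \<Rightarrow> real \<Rightarrow> real \<Rightarrow> real \<Rightarrow> (real \<Rightarrow> linkage) \<Rightarrow> bool" where
  "length_minimizing_on l1 l2 a b \<gamma> \<longleftrightarrow>
     (\<forall>c d \<sigma>. c \<le> d \<and> horizontal_on l1 l2 c d \<sigma> \<and> \<sigma> c = \<gamma> a \<and> \<sigma> d = \<gamma> b
        \<longrightarrow> curve_length a b \<gamma> \<le> curve_length c d \<sigma>)"

definition geodesic_on :: "real \<Rightarrow> real \<Rightarrow> real set \<Rightarrow> (real \<Rightarrow> linkage) \<Rightarrow> bool" where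
  "geodesic_on l1 l2 I \<gamma> \<longleftrightarrow>
     is_interval I \<and>
     (\<forall>a\<in>I. \<forall>b\<in>I. a \<le> b \<longrightarrow>
        horizontal_on l1 l2 a b \<gamma> \<and> curve_length a b \<gamma> = ennreal (b - a)) \<and>
     (\<forall>t\<in>I. \<exists>e>0. \<forall>a\<in>I. \<forall>b\<in>I. t - e < a \<and> a \<le> b \<and> b < t + e
        \<longrightarrow> length_minimizing_on l1 l2 a b \<gamma>)"

definition rot90 :: "real ^ 2 \<Rightarrow> real ^ 2" where
  "rot90 v = vector [- v $ 2, v $ 1]"

text \<open>
  The witnesses are the unit tangent \<open>T\<close>, the signed curvature \<open>\<kappa>\<close> (Frenet equation
  \<open>T' = \<kappa> rot90 T\<close>), and the first two derivatives of \<open>\<kappa>\<close>; derivatives are one-sided at the end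
  points of the interval.
\<close>

definition elastic_curve_on :: "real set \<Rightarrow> (real \<Rightarrow> real ^ 2) \<Rightarrow> bool" where
  "elastic_curve_on I x \<longleftrightarrow>
     (\<exists>T \<kappa> \<kappa>' \<kappa>'' A. \<forall>t\<in>I.
        norm (T t) = 1 \<and>
        (x has_vector_derivative T t) (at t within I) \<and>
        (T has_vector_derivative \<kappa> t *\<^sub>R rot90 (T t)) (at t within I) \<and>
        (\<kappa> has_real_derivative \<kappa>' t) (at t within I) \<and>
        (\<kappa>' has_real_derivative \<kappa>'' t) (at t within I) \<and>
        \<kappa>'' t + (1 / 2) * \<kappa> t ^ 3 + A * \<kappa> t = 0)"

end

theory Submission
  imports Defs
begin

text \<open>
  Let \<open>u = (cos \<alpha>, sin \<alpha>)\<close> be the direction of the first segment, \<open>n = rot90 u\<close>, and write the velocity of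
  the tip as \<open>p u + q n\<close>. Horizontality means that a segment of length \<open>l\<close> turns with the angular
  speed given by the normal component of this velocity divided by \<open>l\<close>; so \<open>\<alpha>' = q / l\<close>, and similarly
  for the second segment. When both segments have the same length, the cotangent \<open>y\<close> of half the
  angle between them satisfies the linear equation \<open>y' = (p y + q) / l\<close>. Hence the functions \<open>p\<close> and \<open>q\<close>
  can be prescribed freely, and the horizontal curve that they steer is given by explicit
  quadratures. This makes the dependence of the end point on the controls accessible to elementary
  calculus, although the controls of a geodesic are only known to be bounded and continuous off a
  finite set.

  A short arc of a geodesic has unit speed and minimizes length, hence also energy, among horizontal
  curves with the same end points over the same interval. Consider the map from the controls to energy and end point, on
  the five-parameter family of variations in the directions of the gradients of its five components.
  Its derivative is the Gram matrix of these gradients. If that were invertible, the map would be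
  open, and the energy could be lowered with the end point kept. So the gradients satisfy a
  nontrivial linear relation (\<open>multiplier_rule\<close>).

  If the energy takes part in this relation, the controls are smooth functions of the state, and
  differentiating them shows that the curvature of the path of the tip is an affine function of
  its position (\<open>normal_imp_elastic\<close>). Such curves are elastic (\<open>affine_curvature_imp_elastic\<close>). If the
  energy does not take part, the tip moves on a straight line, on which the configuration is a
  function of the position of the tip; turning back would revisit a configuration, so the tip moves
  in one direction (\<open>abnormal_imp_elastic\<close>).

  Geodesics minimize only locally, and the constant in the elastica equation could a priori change
  from arc to arc. It does not, because the equation determines the constant unless the curvature
  vanishes identically (\<open>elastic_curve_on_glue\<close>).
\<close>

section \<open>Piecewise continuous functions and their integrals\<close>

text \<open>
  The regularity of the velocity of a piecewise \<open>C\<^sup>1\<close> curve of unit speed: at the exceptional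
  parameters it may oscillate without one-sided limits, so that only boundedness survives. The end
  points \<open>a\<close> and \<open>b\<close> are left out because derivatives are two-sided.
\<close>

definition pw_continuous :: "real \<Rightarrow> real \<Rightarrow> real set \<Rightarrow> (real \<Rightarrow> 'a::real_normed_vector) \<Rightarrow> bool" where
  "pw_continuous a b S g \<longleftrightarrow>
     finite S \<and> continuous_on ({a<..<b} - S) g \<and> bounded (g ` ({a<..<b} - S))"

lemma pw_continuousI:
  assumes "finite S" "continuous_on {a..b} g"
  shows "pw_continuous a b S g"
proof -
  have "bounded (g ` {a..b})"
    by (intro compact_imp_bounded compact_continuous_image assms compact_Icc)
  then have "bounded (g ` ({a<..<b} - S))" by (rule bounded_subset) auto
  moreover have "continuous_on ({a<..<b} - S) g"
    by (rule continuous_on_subset[OF assms(2)]) auto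
  ultimately show ?thesis using assms(1) by (simp add: pw_continuous_def)
qed

lemma pw_continuous_bilinear:
  assumes "bounded_bilinear m" "pw_continuous a b S f" "pw_continuous a b S g"
  shows "pw_continuous a b S (\<lambda>t. m (f t) (g t))"
proof -
  interpret m: bounded_bilinear m by fact
  obtain B where B: "\<And>t. t \<in> {a<..<b} - S \<Longrightarrow> norm (f t) \<le> B"
    using assms(2) unfolding pw_continuous_def bounded_iff by blast
  obtain C where C: "\<And>t. t \<in> {a<..<b} - S \<Longrightarrow> norm (g t) \<le> C"
    using assms(3) unfolding pw_continuous_def bounded_iff by blast
  obtain K where K: "K \<ge> 0" "\<And>x y. norm (m x y) \<le> norm x * norm y * K"
    using m.nonneg_bounded by blast
  have "norm (m (f t) (g t)) \<le> B * C * K" if "t \<in> {a<..<b} - S" for t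
  proof -
    have "norm (f t) * norm (g t) \<le> B * C"
      using B[OF that] C[OF that] by (intro mult_mono) (auto intro: order_trans[OF norm_ge_zero])
    then show ?thesis using K by (meson mult_right_mono order_trans)
  qed
  then have "bounded ((\<lambda>t. m (f t) (g t)) ` ({a<..<b} - S))"
    unfolding bounded_iff by blast
  with assms(2,3) show ?thesis
    unfolding pw_continuous_def by (auto intro: m.continuous_on)
qed

lemma pw_continuous_add:
  assumes "pw_continuous a b S f" "pw_continuous a b S g"
  shows "pw_continuous a b S (\<lambda>t. f t + g t)"
  using assms unfolding pw_continuous_def
  by (auto intro!: continuous_intros bounded_plus_comp)

lemma pw_continuous_minus:
  assumes "pw_continuous a b S f"
  shows "pw_continuous a b S (\<lambda>t. - f t)"
  using assms unfolding pw_continuous_def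
  by (auto intro!: continuous_intros simp: bounded_iff)

lemma pw_continuous_diff:
  assumes "pw_continuous a b S f" "pw_continuous a b S g"
  shows "pw_continuous a b S (\<lambda>t. f t - g t)"
  using pw_continuous_add[OF assms(1) pw_continuous_minus[OF assms(2)]] by simp

lemma pw_continuous_Pair:
  assumes "pw_continuous a b S f" "pw_continuous a b S g"
  shows "pw_continuous a b S (\<lambda>t. (f t, g t))"
proof -
  obtain B where B: "\<And>t. t \<in> {a<..<b} - S \<Longrightarrow> norm (f t) \<le> B"
    using assms(1) unfolding pw_continuous_def bounded_iff by blast
  obtain C where C: "\<And>t. t \<in> {a<..<b} - S \<Longrightarrow> norm (g t) \<le> C"
    using assms(2) unfolding pw_continuous_def bounded_iff by blast
  have "norm (f t, g t) \<le> B + C" if "t \<in> {a<..<b} - S" for t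
    using norm_Pair_le[of "f t" "g t"] B[OF that] C[OF that] by linarith
  then have "bounded ((\<lambda>t. (f t, g t)) ` ({a<..<b} - S))"
    unfolding bounded_iff by blast
  with assms show ?thesis
    unfolding pw_continuous_def by (auto intro: continuous_intros)
qed

lemmas pw_continuous_intros =
  pw_continuous_add pw_continuous_minus pw_continuous_diff pw_continuous_Pair
  pw_continuous_bilinear[OF bounded_bilinear_mult]
  pw_continuous_bilinear[OF bounded_bilinear_inner]
  pw_continuous_bilinear[OF bounded_bilinear_scaleR]

lemma pw_continuous_integrable:
  fixes g :: "real \<Rightarrow> 'a::euclidean_space"
  assumes "pw_continuous a b S g"
  shows "g integrable_on {a..b}"
proof -
  let ?D = "{a<..<b} - S"
  have fin: "finite S" and cont: "continuous_on ?D g"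
    using assms by (auto simp: pw_continuous_def)
  obtain B where B: "\<And>t. t \<in> ?D \<Longrightarrow> norm (g t) \<le> B"
    using assms unfolding pw_continuous_def bounded_iff by blast
  have opn: "open ?D" using fin by (simp add: finite_imp_closed open_Diff)
  then have D: "?D \<in> sets lebesgue" by (simp add: lmeasurable_open fmeasurableD borel_open)
  have "?D \<in> lmeasurable"
    by (rule bounded_set_imp_lmeasurable[OF bounded_subset[of "{a..b}"] D]) auto
  then have "(\<lambda>x. B) integrable_on ?D" by (rule integrable_on_const)
  then have "g integrable_on ?D"
    using measurable_bounded_by_integrable_imp_integrable
      [OF continuous_imp_measurable_on_sets_lebesgue[OF cont D] _ B D] by blast
  moreover have nS: "negligible (insert a (insert b S))" using fin by (simp add: negligible_finite)
  have "negligible {x \<in> ?D - {a..b}. g x \<noteq> 0}" by (rule negligible_subset[OF negligible_empty]) auto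
  moreover have "negligible {x \<in> {a..b} - ?D. g x \<noteq> 0}" by (rule negligible_subset[OF nS]) auto
  ultimately show ?thesis using integrable_spike_set by blast
qed

lemma pw_continuous_antiderivative:
  fixes g :: "real \<Rightarrow> 'a::euclidean_space"
  assumes "pw_continuous a b S g"
  defines "F \<equiv> (\<lambda>t. integral {a..t} g)"
  shows "continuous_on {a..b} F"
    and "\<And>t. t \<in> {a<..<b} - S \<Longrightarrow> (F has_vector_derivative g t) (at t)"
proof -
  note int = pw_continuous_integrable[OF assms(1)]
  show "continuous_on {a..b} F"
    unfolding F_def by (rule indefinite_integral_continuous_1[OF int])
  fix t assume t: "t \<in> {a<..<b} - S"
  have fin: "finite S" and cont: "continuous_on ({a<..<b} - S) g"
    using assms by (auto simp: pw_continuous_def)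
  have opn: "open ({a<..<b} - S)" using fin by (simp add: finite_imp_closed open_Diff)
  have "isCont g t" using cont opn t by (simp add: continuous_on_eq_continuous_at)
  then have "continuous (at t within ({a..b} - S)) g"
    by (rule continuous_at_imp_continuous_at_within)
  then have "(F has_vector_derivative g t) (at t within ({a..b} - S))"
    unfolding F_def using t fin int
    by (intro integral_has_vector_derivative_continuous_at) auto
  then have "(F has_vector_derivative g t) (at t within ({a<..<b} - S))"
    by (rule has_vector_derivative_within_subset) auto
  then show "(F has_vector_derivative g t) (at t)"
    using at_within_open[OF t opn] by simp
qed

lemma derivative_zero_imp_constant:
  fixes f :: "real \<Rightarrow> 'a::banach"
  assumes "finite S" "continuous_on {a..b} f"
    and "\<And>t. t \<in> {a<..<b} - S \<Longrightarrow> (f has_vector_derivative 0) (at t)"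
    and "t \<in> {a..b}"
  shows "f t = f a"
proof (rule has_derivative_zero_unique_strong_interval[of "S \<union> {a,b}" a b f])
  show "(f has_derivative (\<lambda>h. 0)) (at x within {a..b})" if "x \<in> {a..b} - (S \<union> {a,b})" for x
    using assms(3)[of x] that by (auto simp: has_vector_derivative_def intro: has_derivative_at_withinI)
qed (use assms in auto)

text \<open>
  Subtracting the affine function with slope \<open>l\<close> reduces the claim to an increment whose derivative
  is small near \<open>t\<close>; finitely many exceptional points do not affect the integral of that
  derivative. The lemma serves twice: to recover the direction of a foot's velocity at an
  exceptional parameter, and to show that extremals have no corners.
\<close>

lemma has_vector_derivative_limit:
  fixes f :: "real \<Rightarrow> 'a::euclidean_space"
  assumes S: "finite S" and cont: "continuous_on {a..b} f" and t: "t \<in> {a..b}"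
    and der: "\<And>s. s \<in> {a<..<b} - S \<Longrightarrow> (f has_vector_derivative D s) (at s)"
    and lim: "(D \<longlongrightarrow> l) (at t within {a<..<b} - S)"
  shows "(f has_vector_derivative l) (at t within {a..b})"
proof -
  show ?thesis
    unfolding has_vector_derivative_def has_derivative_within_alt
  proof (intro conjI allI impI)
    show "bounded_linear (\<lambda>x. x *\<^sub>R l)" by (rule bounded_linear_scaleR_left)
    fix e :: real assume "e > 0"
    obtain d where d: "d > 0" "\<And>s. s \<in> {a<..<b} - S \<Longrightarrow> s \<noteq> t \<Longrightarrow> dist s t < d \<Longrightarrow> dist (D s) l < e"
      using lim \<open>e > 0\<close> unfolding Lim_within by (metis dist_pos_lt)
    show "\<exists>d>0. \<forall>y\<in>{a..b}. norm (y - t) < d \<longrightarrow> norm (f y - f t - (y - t) *\<^sub>R l) \<le> e * norm (y - t)"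
    proof (intro exI[of _ d] conjI ballI impI \<open>d > 0\<close>)
      fix y assume y: "y \<in> {a..b}" "norm (y - t) < d"
      define u v where "u = min t y" and "v = max t y"
      have uv: "u \<le> v" "{u..v} \<subseteq> {a..b}" using t y by (auto simp: u_def v_def)
      have I: "((\<lambda>s. D s - l) has_integral ((f v - v *\<^sub>R l) - (f u - u *\<^sub>R l))) {u..v}"
      proof (rule fundamental_theorem_of_calculus_interior_strong[OF S uv(1)])
        show "continuous_on {u..v} (\<lambda>s. f s - s *\<^sub>R l)"
          by (intro continuous_intros continuous_on_subset[OF cont uv(2)])
        fix x assume "x \<in> {u<..<v} - S"
        then have "x \<in> {a<..<b} - S" using uv by (auto simp: u_def v_def)
        from der[OF this] show "((\<lambda>s. f s - s *\<^sub>R l) has_vector_derivative D x - l) (at x)"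
          by (auto intro!: derivative_eq_intros)
      qed
      have "norm ((f v - v *\<^sub>R l) - (f u - u *\<^sub>R l)) \<le> e * measure lborel (cbox u v)"
      proof (rule has_integral_bound_spike_finite[of e "S \<union> {u,v}"])
        show "((\<lambda>s. D s - l) has_integral ((f v - v *\<^sub>R l) - (f u - u *\<^sub>R l))) (cbox u v)"
          using I by simp
        fix x assume x: "x \<in> cbox u v - (S \<union> {u, v})"
        then have "x \<in> {a<..<b} - S" using uv by (auto simp: u_def v_def)
        moreover have "dist x t < d" "x \<noteq> t" using x y by (auto simp: u_def v_def dist_real_def)
        ultimately show "norm (D x - l) \<le> e" using d(2)[of x] by (simp add: dist_norm less_imp_le)
      qed (use S \<open>e > 0\<close> in auto)
      moreover have "norm ((f v - v *\<^sub>R l) - (f u - u *\<^sub>R l)) = norm (f y - f t - (y - t) *\<^sub>R l)"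
        by (cases "t \<le> y") (auto simp: u_def v_def algebra_simps norm_minus_commute min_def max_def)
      moreover have "measure lborel (cbox u v) = norm (y - t)"
        by (auto simp: u_def v_def)
      ultimately show "norm (f y - f t - (y - t) *\<^sub>R l) \<le> e * norm (y - t)" by simp
    qed
  qed
qed

section \<open>Differentiating integrals with respect to parameters\<close>

text \<open>
  The Leibniz rule in a form that tolerates integrands discontinuous in \<open>t\<close>: a remainder that is
  quadratic in the parameter, uniformly in \<open>t\<close>, integrates to a quadratic remainder.
\<close>

lemma has_derivative_integral_quadratic:
  fixes f :: "'v::euclidean_space \<Rightarrow> real \<Rightarrow> real"
  assumes ab: "a \<le> b" and S: "finite S"
    and int: "\<And>s. f s integrable_on {a..b}" and d: "d integrable_on {a..b}"
    and le: "\<And>s t. t \<in> {a<..<b} - S \<Longrightarrow> norm (s - s0) \<le> 1 \<Longrightarrow>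
          \<bar>f s t - f s0 t - (s - s0) \<bullet> d t\<bar> \<le> C * (norm (s - s0))\<^sup>2"
  shows "((\<lambda>s. integral {a..b} (f s)) has_derivative (\<lambda>r. r \<bullet> integral {a..b} d)) (at s0)"
proof -
  define K where "K = \<bar>C\<bar> * (b - a) + 1"
  have K: "K > 0" "\<bar>C\<bar> * (b - a) \<le> K" using ab by (auto simp: K_def add_nonneg_pos)
  have bound: "norm (integral {a..b} (f s) - integral {a..b} (f s0) - (s - s0) \<bullet> integral {a..b} d)
      \<le> K * (norm (s - s0))\<^sup>2" if "norm (s - s0) \<le> 1" for s
  proof -
    have "((\<lambda>t. f s t - f s0 t - (s - s0) \<bullet> d t) has_integral
        (integral {a..b} (f s) - integral {a..b} (f s0) - (s - s0) \<bullet> integral {a..b} d)) (cbox a b)"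
      using int d by (auto intro!: has_integral_diff has_integral_linear[OF _ bounded_linear_inner_right, unfolded o_def])
    moreover have "norm (f s t - f s0 t - (s - s0) \<bullet> d t) \<le> \<bar>C\<bar> * (norm (s - s0))\<^sup>2"
      if "t \<in> cbox a b - (S \<union> {a,b})" for t
    proof -
      have "C * (norm (s - s0))\<^sup>2 \<le> \<bar>C\<bar> * (norm (s - s0))\<^sup>2" by (simp add: mult_right_mono)
      moreover have "t \<in> {a<..<b} - S" using that by auto
      ultimately show ?thesis using le[of t s] \<open>norm (s - s0) \<le> 1\<close> by simp
    qed
    ultimately have "norm (integral {a..b} (f s) - integral {a..b} (f s0) - (s - s0) \<bullet> integral {a..b} d)
        \<le> \<bar>C\<bar> * (norm (s - s0))\<^sup>2 * measure lborel (cbox a b)"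
      using S by (intro has_integral_bound_spike_finite[of _ "S \<union> {a,b}"]) auto
    also have "\<dots> = (\<bar>C\<bar> * (b - a)) * (norm (s - s0))\<^sup>2" using ab by simp
    also have "\<dots> \<le> K * (norm (s - s0))\<^sup>2" using K by (intro mult_right_mono) auto
    finally show ?thesis .
  qed
  show ?thesis
    unfolding has_derivative_within_alt
  proof (intro conjI allI impI)
    show "bounded_linear (\<lambda>r. r \<bullet> integral {a..b} d)" by (rule bounded_linear_inner_left)
    fix e :: real assume "e > 0"
    show "\<exists>\<delta>>0. \<forall>y\<in>UNIV. norm (y - s0) < \<delta> \<longrightarrow>
      norm (integral {a..b} (f y) - integral {a..b} (f s0) - (y - s0) \<bullet> integral {a..b} d) \<le> e * norm (y - s0)"
    proof (intro exI[of _ "min 1 (e / K)"] conjI ballI impI)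
      fix y assume y: "norm (y - s0) < min 1 (e / K)"
      then have "K * norm (y - s0) \<le> e" using K by (simp add: field_simps)
      then have "K * (norm (y - s0))\<^sup>2 \<le> e * norm (y - s0)"
        by (simp add: power2_eq_square mult_right_mono flip: mult.assoc)
      with bound[of y] y show "norm (integral {a..b} (f y) - integral {a..b} (f s0) - (y - s0) \<bullet> integral {a..b} d) \<le> e * norm (y - s0)"
        by simp
    qed (use K \<open>e > 0\<close> in auto)
  qed
qed

text \<open>
  Two applications of the mean value theorem, the second one to \<open>\<phi> z - \<phi>' x * z\<close>.
\<close>

lemma second_order_bound:
  fixes \<phi> :: "real \<Rightarrow> real"
  assumes "\<And>x. (\<phi> has_real_derivative \<phi>' x) (at x)" "\<And>x. (\<phi>' has_real_derivative \<phi>'' x) (at x)"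
    and "\<And>x. \<bar>x\<bar> \<le> R \<Longrightarrow> \<bar>\<phi>' x\<bar> \<le> M" "\<And>x. \<bar>x\<bar> \<le> R \<Longrightarrow> \<bar>\<phi>'' x\<bar> \<le> M"
    and "\<bar>x\<bar> \<le> R" "\<bar>x + k\<bar> \<le> R"
  shows "\<bar>\<phi> (x + k) - \<phi> x\<bar> \<le> M * \<bar>k\<bar>" and "\<bar>\<phi> (x + k) - \<phi> x - \<phi>' x * k\<bar> \<le> M * k\<^sup>2"
proof -
  have mem: "\<bar>z\<bar> \<le> R" if "z \<in> closed_segment x (x + k)" for z
    using that assms(5,6) by (auto simp: closed_segment_eq_real_ivl split: if_splits)
  have lip: "norm (g (x + k') - g x) \<le> M * norm (x + k' - x)"
    if "\<And>z. (g has_real_derivative g' z) (at z)" "\<And>z. \<bar>z\<bar> \<le> R \<Longrightarrow> \<bar>g' z\<bar> \<le> M"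
      and k': "x + k' \<in> closed_segment x (x + k)" for g g' k'
    by (rule field_differentiable_bound[of "closed_segment x (x+k)" g g'])
       (use that mem in \<open>auto intro: has_field_derivative_at_within\<close>)
  show "\<bar>\<phi> (x + k) - \<phi> x\<bar> \<le> M * \<bar>k\<bar>"
    using lip[OF assms(1,3), of k] by simp
  have "norm ((\<phi> (x + k) - \<phi>' x * (x + k)) - (\<phi> x - \<phi>' x * x)) \<le> M * \<bar>k\<bar> * norm (x + k - x)"
  proof (rule field_differentiable_bound[of "closed_segment x (x+k)" "\<lambda>z. \<phi> z - \<phi>' x * z" "\<lambda>z. \<phi>' z - \<phi>' x"])
    show "((\<lambda>z. \<phi> z - \<phi>' x * z) has_field_derivative \<phi>' z - \<phi>' x) (at z within closed_segment x (x+k))" for z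
      by (auto intro!: derivative_eq_intros has_field_derivative_at_within[OF assms(1)])
    fix z assume z: "z \<in> closed_segment x (x+k)"
    have "norm (\<phi>' z - \<phi>' x) \<le> M * norm (z - x)"
      using lip[OF assms(2,4), of "z - x"] z by simp
    also have "\<dots> \<le> M * \<bar>k\<bar>"
      using z assms(4)[OF assms(5)] 
      by (intro mult_left_mono) (auto simp: closed_segment_eq_real_ivl split: if_splits)
    finally show "norm (\<phi>' z - \<phi>' x) \<le> M * \<bar>k\<bar>" .
  qed auto
  then show "\<bar>\<phi> (x + k) - \<phi> x - \<phi>' x * k\<bar> \<le> M * k\<^sup>2"
    by (simp add: power2_eq_square algebra_simps flip: abs_mult)
qed

text \<open>
  All quadratures for a steered linkage have this shape: the controls enter linearly through the
  factor \<open>g + s \<bullet> P\<close>, and their continuous antiderivatives enter through \<open>\<alpha> + s \<bullet> A\<close> inside a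
  sine, cosine or exponential \<open>\<phi>\<close>. The remainder of the product splits into the remainder of \<open>\<phi>\<close>
  and a product of two first-order differences.
\<close>

lemma has_derivative_integral_parameter:
  fixes P A :: "real \<Rightarrow> 'v::euclidean_space" and g \<alpha> \<phi> :: "real \<Rightarrow> real"
  assumes ab: "a \<le> b"
    and g: "pw_continuous a b S g" and P: "pw_continuous a b S P"
    and \<alpha>: "continuous_on {a..b} \<alpha>" and A: "continuous_on {a..b} A"
    and d\<phi>: "\<And>x. (\<phi> has_real_derivative \<phi>' x) (at x)"
    and d\<phi>': "\<And>x. (\<phi>' has_real_derivative \<phi>'' x) (at x)"
    and c\<phi>'': "continuous_on UNIV \<phi>''"
  shows "((\<lambda>s. integral {a..b} (\<lambda>t. (g t + s \<bullet> P t) * \<phi> (\<alpha> t + s \<bullet> A t))) has_derivative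
          (\<lambda>r. r \<bullet> integral {a..b} (\<lambda>t. \<phi> (\<alpha> t + s0 \<bullet> A t) *\<^sub>R P t
                   + ((g t + s0 \<bullet> P t) * \<phi>' (\<alpha> t + s0 \<bullet> A t)) *\<^sub>R A t))) (at s0)"
proof -
  have S: "finite S" using g by (simp add: pw_continuous_def)
  have c\<phi>: "continuous_on UNIV \<phi>" "continuous_on UNIV \<phi>'"
    using d\<phi> d\<phi>' by (auto intro!: DERIV_continuous_on)
  have pw: "pw_continuous a b S (\<lambda>t. s \<bullet> P t)" for s
    by (intro pw_continuous_intros P pw_continuousI S continuous_intros)
  have pw\<phi>: "pw_continuous a b S (\<lambda>t. \<psi> (\<alpha> t + s \<bullet> A t))" if "continuous_on UNIV \<psi>" for s and \<psi> :: "real \<Rightarrow> real"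
    by (intro pw_continuousI S continuous_on_compose2[OF that] continuous_intros \<alpha> A) auto
  obtain B where B: "\<And>t. t \<in> {a<..<b} - S \<Longrightarrow> \<bar>g t + s0 \<bullet> P t\<bar> \<le> B"
    using pw_continuous_add[OF g pw[of s0]] unfolding pw_continuous_def bounded_iff by force
  obtain BP where BP: "\<And>t. t \<in> {a<..<b} - S \<Longrightarrow> norm (P t) \<le> BP"
    using P unfolding pw_continuous_def bounded_iff by blast
  have cb: "\<exists>R. \<forall>t\<in>{a..b}. norm (h t) \<le> R" if "continuous_on {a..b} h" for h :: "real \<Rightarrow> 'w::real_normed_vector"
    using compact_imp_bounded[OF compact_continuous_image[OF that compact_Icc]]
    unfolding bounded_iff by blast
  obtain BA where BA: "\<And>t. t \<in> {a..b} \<Longrightarrow> norm (A t) \<le> BA"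
    using cb[OF A] by blast
  obtain B\<beta> where B\<beta>: "\<And>t. t \<in> {a..b} \<Longrightarrow> \<bar>\<alpha> t + s0 \<bullet> A t\<bar> \<le> B\<beta>"
    using cb[of "\<lambda>t. \<alpha> t + s0 \<bullet> A t"] \<alpha> A by (force intro!: continuous_intros)
  \<comment> \<open>The arguments of \<open>\<phi>\<close> stay in \<open>[-R, R]\<close> as long as \<open>norm (s - s0) \<le> 1\<close>.\<close>
  define R where "R = B\<beta> + BA"
  have bR: "\<exists>M. \<forall>x. \<bar>x\<bar> \<le> R \<longrightarrow> \<bar>\<psi> x\<bar> \<le> M" if "continuous_on UNIV \<psi>" for \<psi> :: "real \<Rightarrow> real"
  proof -
    have "bounded (\<psi> ` {-R..R})"
      by (intro compact_imp_bounded compact_continuous_image compact_Icc continuous_on_subset[OF that]) auto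
    then obtain M where "\<forall>x\<in>{-R..R}. \<bar>\<psi> x\<bar> \<le> M" unfolding bounded_iff by auto
    then show ?thesis by (intro exI[of _ M]) (auto simp: abs_le_iff)
  qed
  obtain M1 where M1: "\<And>x. \<bar>x\<bar> \<le> R \<Longrightarrow> \<bar>\<phi>' x\<bar> \<le> M1" using bR[OF c\<phi>(2)] by blast
  obtain M2 where M2: "\<And>x. \<bar>x\<bar> \<le> R \<Longrightarrow> \<bar>\<phi>'' x\<bar> \<le> M2" using bR[OF c\<phi>''] by blast
  define M where "M = max 0 (max M1 M2)"
  define C where "C = BP * (M * BA) + B * (M * BA\<^sup>2)"
  show ?thesis
  proof (rule has_derivative_integral_quadratic[OF ab S, where C = C])
    show "(\<lambda>t. (g t + s \<bullet> P t) * \<phi> (\<alpha> t + s \<bullet> A t)) integrable_on {a..b}" for s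
      by (intro pw_continuous_integrable[of _ _ S] pw_continuous_intros g pw pw\<phi> c\<phi>)
    show "(\<lambda>t. \<phi> (\<alpha> t + s0 \<bullet> A t) *\<^sub>R P t + ((g t + s0 \<bullet> P t) * \<phi>' (\<alpha> t + s0 \<bullet> A t)) *\<^sub>R A t)
            integrable_on {a..b}"
      by (intro pw_continuous_integrable[of _ _ S] pw_continuous_add
           pw_continuous_bilinear[OF bounded_bilinear_scaleR]
           pw_continuous_bilinear[OF bounded_bilinear_mult] g P pw pw\<phi> c\<phi> pw_continuousI[OF S A])
    fix s t assume t: "t \<in> {a<..<b} - S" and s: "norm (s - s0) \<le> 1"
    define r where "r = s - s0"
    define k where "k = r \<bullet> A t"
    define x where "x = \<alpha> t + s0 \<bullet> A t"
    define G where "G = g t + s0 \<bullet> P t"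
    have tab: "t \<in> {a..b}" using t by auto
    have r1: "norm r \<le> 1" using s by (simp add: r_def)
    have kb: "\<bar>k\<bar> \<le> BA * norm r"
    proof -
      have "\<bar>k\<bar> \<le> norm r * norm (A t)" unfolding k_def by (rule Cauchy_Schwarz_ineq2)
      also have "\<dots> \<le> norm r * BA" by (rule mult_left_mono[OF BA[OF tab]]) simp
      finally show ?thesis by (simp add: mult.commute)
    qed
    have BA0: "BA \<ge> 0" using BA[OF tab] norm_ge_zero order_trans by blast
    have "\<bar>k\<bar> \<le> BA" using kb r1 BA0 by (meson mult_left_le order_trans)
    then have xR: "\<bar>x\<bar> \<le> R" "\<bar>x + k\<bar> \<le> R"
      using B\<beta>[OF tab] BA0 by (auto simp: R_def x_def)
    note so = second_order_bound[of \<phi> \<phi>' \<phi>'' R M, OF d\<phi> d\<phi>' _ _ xR]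
    have so1: "\<bar>\<phi> (x + k) - \<phi> x\<bar> \<le> M * \<bar>k\<bar>" and so2: "\<bar>\<phi> (x + k) - \<phi> x - \<phi>' x * k\<bar> \<le> M * k\<^sup>2"
      using so M1 M2 by (force simp: M_def le_max_iff_disj)+
    have M0: "M \<ge> 0" by (simp add: M_def)
    have "k\<^sup>2 \<le> (BA * norm r)\<^sup>2" using kb by (metis abs_le_square_iff abs_of_nonneg BA0 mult_nonneg_nonneg norm_ge_zero)
    then have k2: "M * k\<^sup>2 \<le> M * BA\<^sup>2 * (norm r)\<^sup>2" using M0 by (simp add: power_mult_distrib mult_left_mono mult.assoc)
    have k1: "M * \<bar>k\<bar> \<le> M * BA * norm r" using kb M0 by (simp add: mult_left_mono mult.assoc)
    have rP: "\<bar>r \<bullet> P t\<bar> \<le> BP * norm r"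
    proof -
      have "\<bar>r \<bullet> P t\<bar> \<le> norm r * norm (P t)" by (rule Cauchy_Schwarz_ineq2)
      also have "\<dots> \<le> norm r * BP" by (rule mult_left_mono[OF BP[OF t]]) simp
      finally show ?thesis by (simp add: mult.commute)
    qed
    have B0: "B \<ge> 0" using B[OF t] by linarith
    have BP0: "BP \<ge> 0" using BP[OF t] norm_ge_zero order_trans by blast
    have "\<bar>(r \<bullet> P t) * (\<phi> (x + k) - \<phi> x)\<bar> \<le> (BP * norm r) * (M * BA * norm r)"
      unfolding abs_mult using so1 k1 rP BP0 by (intro mult_mono) auto
    moreover have "\<bar>G * (\<phi> (x + k) - \<phi> x - \<phi>' x * k)\<bar> \<le> B * (M * BA\<^sup>2 * (norm r)\<^sup>2)"
      unfolding abs_mult using so2 k2 B[OF t] B0 by (intro mult_mono) (auto simp: G_def)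
    ultimately have "\<bar>(r \<bullet> P t) * (\<phi> (x + k) - \<phi> x) + G * (\<phi> (x + k) - \<phi> x - \<phi>' x * k)\<bar>
        \<le> (BP * norm r) * (M * BA * norm r) + B * (M * BA\<^sup>2 * (norm r)\<^sup>2)" by linarith
    also have "\<dots> = C * (norm r)\<^sup>2" by (simp add: C_def algebra_simps power2_eq_square)
    finally have main: "\<bar>(r \<bullet> P t) * (\<phi> (x + k) - \<phi> x) + G * (\<phi> (x + k) - \<phi> x - \<phi>' x * k)\<bar> \<le> C * (norm r)\<^sup>2" .
    have e: "g t + s \<bullet> P t = G + r \<bullet> P t" "\<alpha> t + s \<bullet> A t = x + k"
      by (simp_all add: G_def r_def x_def k_def algebra_simps)
    have "(g t + s \<bullet> P t) * \<phi> (\<alpha> t + s \<bullet> A t) - (g t + s0 \<bullet> P t) * \<phi> (\<alpha> t + s0 \<bullet> A t) -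
        (s - s0) \<bullet> (\<phi> (\<alpha> t + s0 \<bullet> A t) *\<^sub>R P t + ((g t + s0 \<bullet> P t) * \<phi>' (\<alpha> t + s0 \<bullet> A t)) *\<^sub>R A t)
      = (r \<bullet> P t) * (\<phi> (x + k) - \<phi> x) + G * (\<phi> (x + k) - \<phi> x - \<phi>' x * k)"
      unfolding e x_def[symmetric] G_def[symmetric] r_def[symmetric]
      by (simp add: inner_right_distrib k_def algebra_simps)
    with main show "\<bar>(g t + s \<bullet> P t) * \<phi> (\<alpha> t + s \<bullet> A t) - (g t + s0 \<bullet> P t) * \<phi> (\<alpha> t + s0 \<bullet> A t) -
        (s - s0) \<bullet> (\<phi> (\<alpha> t + s0 \<bullet> A t) *\<^sub>R P t + ((g t + s0 \<bullet> P t) * \<phi>' (\<alpha> t + s0 \<bullet> A t)) *\<^sub>R A t)\<bar>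
        \<le> C * (norm (s - s0))\<^sup>2"
      by (simp add: r_def)
  qed
qed

section \<open>Half-angle coordinates for linkages with equal segments\<close>

definition vec2 :: "real \<Rightarrow> real \<Rightarrow> real ^ 2" where
  "vec2 r s = r *\<^sub>R axis 1 1 + s *\<^sub>R axis 2 1"

lemma vec2_nth [simp]: "vec2 r s $ 1 = r" "vec2 r s $ 2 = s"
  by (simp_all add: vec2_def axis_def)

lemma vec2_eq_iff: "v = vec2 r s \<longleftrightarrow> v $ 1 = r \<and> v $ 2 = s"
  by (auto simp: vec_eq_iff forall_2)

lemma vec2_inject [simp]: "vec2 r s = vec2 r' s' \<longleftrightarrow> r = r' \<and> s = s'"
  by (auto simp: vec2_eq_iff)

lemma vec2_arith:
  "vec2 r s + vec2 r' s' = vec2 (r + r') (s + s')"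
  "vec2 r s - vec2 r' s' = vec2 (r - r') (s - s')"
  "c *\<^sub>R vec2 r s = vec2 (c * r) (c * s)"
  "- vec2 r s = vec2 (- r) (- s)"
  by (simp_all add: vec2_def algebra_simps)

lemma rot90_vec2 [simp]: "rot90 (vec2 r s) = vec2 (- s) r"
  by (simp add: rot90_def vec2_eq_iff)

lemma inner_vec2: "vec2 r s \<bullet> vec2 r' s' = r * r' + s * s'"
  by (simp add: inner_vec_def sum_2)

lemma norm_vec2: "norm (vec2 r s) = sqrt (r\<^sup>2 + s\<^sup>2)"
  by (simp add: norm_eq_sqrt_inner inner_vec2 power2_eq_square)

lemma continuous_on_vec2 [continuous_intros]:
  "continuous_on X f \<Longrightarrow> continuous_on X g \<Longrightarrow> continuous_on X (\<lambda>t. vec2 (f t) (g t))"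
  unfolding vec2_def by (intro continuous_intros)

lemma has_vector_derivative_vec2:
  assumes "(f has_real_derivative f') (at t within X)" "(g has_real_derivative g') (at t within X)"
  shows "((\<lambda>t. vec2 (f t) (g t)) has_vector_derivative vec2 f' g') (at t within X)"
proof -
  have "((\<lambda>t. f t *\<^sub>R axis 1 1 + g t *\<^sub>R axis 2 1 :: real ^ 2) has_vector_derivative
          ((f t *\<^sub>R 0 + f' *\<^sub>R axis 1 1) + (g t *\<^sub>R 0 + g' *\<^sub>R axis 2 1))) (at t within X)"
    by (intro has_vector_derivative_add has_vector_derivative_scaleR has_vector_derivative_const assms)
  then show ?thesis by (simp add: vec2_def)
qed

lemma has_vector_derivative_nth:
  fixes f :: "real \<Rightarrow> real ^ 'n"
  assumes "(f has_vector_derivative v) F"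
  shows "((\<lambda>t. f t $ i) has_real_derivative (v $ i)) F"
  using bounded_linear.has_vector_derivative[OF bounded_linear_vec_nth assms]
  by (simp add: has_real_derivative_iff_has_vector_derivative)

text \<open>
  If \<open>y\<close> is the cotangent of half the angle from the first segment to the second one, the double
  angle formulas make \<open>((y\<^sup>2 - 1) / (y\<^sup>2 + 1), 2 * y / (y\<^sup>2 + 1))\<close> the components of the second
  direction in the frame of the first one. The coordinate \<open>y\<close> runs over all reals precisely because
  the two feet are different, and it is chosen because it turns the equation of motion of the second
  segment into a linear one.
\<close>

definition second_dir :: "real \<Rightarrow> real \<Rightarrow> real ^ 2" where
  "second_dir \<alpha> y = vec2 (((y\<^sup>2 - 1) * cos \<alpha> - 2 * y * sin \<alpha>) / (y\<^sup>2 + 1))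
                          (((y\<^sup>2 - 1) * sin \<alpha> + 2 * y * cos \<alpha>) / (y\<^sup>2 + 1))"

definition chart :: "real \<Rightarrow> real \<Rightarrow> real \<Rightarrow> real \<Rightarrow> real \<Rightarrow> linkage" where
  "chart l r s \<alpha> y =
     (vec2 r s, vec2 r s - l *\<^sub>R vec2 (cos \<alpha>) (sin \<alpha>), vec2 r s - l *\<^sub>R second_dir \<alpha> y)"

lemma y2_pos: "(y::real)\<^sup>2 + 1 > 0" "(y::real)\<^sup>2 + 1 \<noteq> 0"
  by (auto simp: add_nonneg_pos add_nonneg_eq_0_iff)

lemma norm_second_dir: "norm (second_dir \<alpha> y) = 1"
proof -
  have "((y\<^sup>2 - 1) * cos \<alpha> - 2 * y * sin \<alpha>)\<^sup>2 + ((y\<^sup>2 - 1) * sin \<alpha> + 2 * y * cos \<alpha>)\<^sup>2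
      = ((y\<^sup>2 - 1)\<^sup>2 + (2 * y)\<^sup>2) * ((sin \<alpha>)\<^sup>2 + (cos \<alpha>)\<^sup>2)"
    by algebra
  also have "\<dots> = (y\<^sup>2 + 1)\<^sup>2" unfolding sin_cos_squared_add by algebra
  finally show ?thesis
    unfolding second_dir_def norm_vec2 power_divide add_divide_distrib[symmetric]
    using y2_pos[of y] by simp
qed

lemma second_dir_inner: "vec2 (cos \<alpha>) (sin \<alpha>) \<bullet> second_dir \<alpha> y = (y\<^sup>2 - 1) / (y\<^sup>2 + 1)"
proof -
  have "cos \<alpha> * ((y\<^sup>2 - 1) * cos \<alpha> - 2 * y * sin \<alpha>) + sin \<alpha> * ((y\<^sup>2 - 1) * sin \<alpha> + 2 * y * cos \<alpha>)
      = (y\<^sup>2 - 1) * ((sin \<alpha>)\<^sup>2 + (cos \<alpha>)\<^sup>2)"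
    by algebra
  then show ?thesis
    unfolding second_dir_def inner_vec2 times_divide_eq_right add_divide_distrib[symmetric]
    by simp
qed

lemma second_dir_neq: "second_dir \<alpha> y \<noteq> vec2 (cos \<alpha>) (sin \<alpha>)"
proof
  assume "second_dir \<alpha> y = vec2 (cos \<alpha>) (sin \<alpha>)"
  then have "(y\<^sup>2 - 1) / (y\<^sup>2 + 1) = 1"
    by (metis second_dir_inner inner_vec2 power2_eq_square sin_cos_squared_add2)
  then show False using y2_pos[of y] by (simp add: field_simps)
qed

lemma chart_in_config_space:
  assumes "l > 0"
  shows "chart l r s \<alpha> y \<in> config_space l l"
proof -
  have "norm (vec2 (cos \<alpha>) (sin \<alpha>)) = 1" by (simp add: norm_vec2)
  then show ?thesis
    using assms norm_second_dir[of \<alpha> y] second_dir_neq[of \<alpha> y]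
    by (auto simp: config_space_def chart_def dist_norm)
qed

text \<open>
  A curve that moves in the direction \<open>d\<close> off a finite set can have, at an exceptional point, no
  derivative in another direction: the component orthogonal to \<open>d t\<close> has a derivative that tends
  to \<open>0\<close>, since the speed \<open>\<rho>\<close> is bounded even if it has no limit. Horizontality asks for
  this wherever the derivative happens to exist.
\<close>

lemma derivative_in_span_of_limit_direction:
  fixes f d :: "real \<Rightarrow> 'a::euclidean_space"
  assumes cont: "continuous_on {a..b} f" and \<rho>: "pw_continuous a b S \<rho>"
    and d: "continuous_on {a..b} d"
    and der: "\<And>s. s \<in> {a<..<b} - S \<Longrightarrow> (f has_vector_derivative \<rho> s *\<^sub>R d s) (at s)"
    and t: "t \<in> {a<..<b}" and D: "(f has_vector_derivative D) (at t)"
  shows "D \<in> span {d t}"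
proof -
  define n where "n = D - ((D \<bullet> d t) / (d t \<bullet> d t)) *\<^sub>R d t"
  have n: "d t \<bullet> n = 0" by (cases "d t = 0") (simp_all add: n_def algebra_simps inner_commute)
  obtain B where B: "\<And>s. s \<in> {a<..<b} - S \<Longrightarrow> \<bar>\<rho> s\<bar> \<le> B"
    using \<rho> unfolding pw_continuous_def bounded_iff by force
  have "((\<lambda>s. d s \<bullet> n) \<longlongrightarrow> d t \<bullet> n) (at t within {a..b})"
    using d t by (intro tendsto_intros) (auto simp: continuous_on_def)
  then have "((\<lambda>s. B * (d s \<bullet> n)) \<longlongrightarrow> B * 0) (at t within {a<..<b} - S)"
    unfolding n by (intro tendsto_intros) (auto elim: tendsto_within_subset)
  then have Z: "((\<lambda>s. B * (d s \<bullet> n)) \<longlongrightarrow> 0) (at t within {a<..<b} - S)" by simp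
  have "((\<lambda>s. \<rho> s * (d s \<bullet> n)) \<longlongrightarrow> 0) (at t within {a<..<b} - S)"
  proof (rule tendsto_0_le[OF Z, of _ 1])
    have "norm (\<rho> s * (d s \<bullet> n)) \<le> norm (B * (d s \<bullet> n)) * 1" if "s \<in> {a<..<b} - S" for s
    proof -
      have "\<bar>\<rho> s\<bar> \<le> \<bar>B\<bar>" using B[OF that] by linarith
      then show ?thesis by (simp add: abs_mult mult_right_mono)
    qed
    then show "\<forall>\<^sub>F s in at t within {a<..<b} - S. norm (\<rho> s * (d s \<bullet> n)) \<le> norm (B * (d s \<bullet> n)) * 1"
      by (auto simp: eventually_at_filter)
  qed
  then have "((\<lambda>s. f s \<bullet> n) has_vector_derivative 0) (at t within {a..b})"
    using t \<rho> cont der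
    by (intro has_vector_derivative_limit[where S = S and D = "\<lambda>s. \<rho> s * (d s \<bullet> n)"])
       (auto simp: pw_continuous_def intro!: continuous_intros
          bounded_linear.has_vector_derivative[OF bounded_linear_inner_left, of _ "_ *\<^sub>R _", simplified])
  then have "((\<lambda>s. f s \<bullet> n) has_vector_derivative 0) (at t)"
    using t by (metis at_within_Icc_at greaterThanLessThan_iff)
  moreover have "((\<lambda>s. f s \<bullet> n) has_vector_derivative D \<bullet> n) (at t)"
    by (rule bounded_linear.has_vector_derivative[OF bounded_linear_inner_left D])
  ultimately have "D \<bullet> n = 0" using vector_derivative_unique_at by blast
  then have "n \<bullet> n = 0" using n by (simp add: n_def inner_diff_left)
  then have "D = ((D \<bullet> d t) / (d t \<bullet> d t)) *\<^sub>R d t" by (simp add: n_def)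
  then show ?thesis by (metis span_base span_scale singletonI)
qed

text \<open>
  The tip moves with velocity \<open>p u + q n\<close> in the moving frame \<open>u = (cos \<alpha>, sin \<alpha>)\<close>, \<open>n = rot90 u\<close> of
  the first segment. A foot that does not slip sideways turns its segment with angular speed \<open>q / l\<close>,
  which gives \<open>\<alpha>\<close>; for the second segment of the same length the Riccati equation of its angle
  becomes, in the coordinate \<open>y\<close>, an equation that is linear in \<open>y\<close>.
\<close>

locale steered =
  fixes l a b :: real and S :: "real set" and p q x1 x2 \<alpha> y :: "real \<Rightarrow> real"
  assumes l_pos: "l > 0" and ab: "a < b"
    and p_pw: "pw_continuous a b S p" and q_pw: "pw_continuous a b S q"
    and cont: "continuous_on {a..b} x1" "continuous_on {a..b} x2"
              "continuous_on {a..b} \<alpha>" "continuous_on {a..b} y"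
    and dx1: "t \<in> {a<..<b} - S \<Longrightarrow> (x1 has_real_derivative p t * cos (\<alpha> t) - q t * sin (\<alpha> t)) (at t)"
    and dx2: "t \<in> {a<..<b} - S \<Longrightarrow> (x2 has_real_derivative p t * sin (\<alpha> t) + q t * cos (\<alpha> t)) (at t)"
    and d\<alpha>: "t \<in> {a<..<b} - S \<Longrightarrow> (\<alpha> has_real_derivative q t / l) (at t)"
    and dy: "t \<in> {a<..<b} - S \<Longrightarrow> (y has_real_derivative (p t * y t + q t) / l) (at t)"
begin

definition curve :: "real \<Rightarrow> linkage" where
  "curve t = chart l (x1 t) (x2 t) (\<alpha> t) (y t)"

lemma finS: "finite S" using p_pw by (simp add: pw_continuous_def)

lemma open_dom: "open ({a<..<b} - S)"
  using finS by (simp add: finite_imp_closed open_Diff)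

text \<open>
  The component of the tip velocity along the second segment, which is the signed speed of the
  second foot.
\<close>

definition roll2 :: "real \<Rightarrow> real" where
  "roll2 t = (p t * ((y t)\<^sup>2 - 1) + 2 * q t * y t) / ((y t)\<^sup>2 + 1)"

lemma tip_velocity:
  assumes "t \<in> {a<..<b} - S"
  shows "((\<lambda>t. vec2 (x1 t) (x2 t)) has_vector_derivative
           vec2 (p t * cos (\<alpha> t) - q t * sin (\<alpha> t)) (p t * sin (\<alpha> t) + q t * cos (\<alpha> t))) (at t)"
  by (intro has_vector_derivative_vec2 dx1 dx2 assms)

lemma foot1_velocity:
  assumes "t \<in> {a<..<b} - S"
  shows "((\<lambda>t. vec2 (x1 t) (x2 t) - l *\<^sub>R vec2 (cos (\<alpha> t)) (sin (\<alpha> t))) has_vector_derivative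
           p t *\<^sub>R vec2 (cos (\<alpha> t)) (sin (\<alpha> t))) (at t)"
  unfolding vec2_arith
  by (rule has_vector_derivative_vec2)
     (use l_pos in \<open>auto intro!: derivative_eq_intros dx1[OF assms] dx2[OF assms] d\<alpha>[OF assms]\<close>)

lemma second_dir_derivative:
  assumes t: "t \<in> {a<..<b} - S"
  shows "((\<lambda>t. second_dir (\<alpha> t) (y t)) has_vector_derivative
           ((q t * ((y t)\<^sup>2 - 1) - 2 * p t * y t) / (l * ((y t)\<^sup>2 + 1))) *\<^sub>R rot90 (second_dir (\<alpha> t) (y t))) (at t)"
proof -
  define Y where "Y = (y t)\<^sup>2 + 1"
  have Y: "Y \<noteq> 0" using y2_pos by (simp add: Y_def)
  have yy: "(y t)\<^sup>2 = Y - 1" "y t * y t = Y - 1" by (simp_all add: Y_def power2_eq_square)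
  show ?thesis
    unfolding second_dir_def rot90_vec2 vec2_arith
    apply (rule has_vector_derivative_vec2)
     apply (rule derivative_eq_intros d\<alpha>[OF t] dy[OF t] refl y2_pos)+
    unfolding Y_def[symmetric] using Y l_pos
     apply (simp add: field_simps)
    subgoal using yy by algebra
    apply (rule derivative_eq_intros d\<alpha>[OF t] dy[OF t] refl y2_pos)+
    unfolding Y_def[symmetric] using Y l_pos
    apply (simp add: field_simps)
    subgoal using yy by algebra
    done
qed

lemma foot2_velocity:
  assumes t: "t \<in> {a<..<b} - S"
  shows "((\<lambda>t. vec2 (x1 t) (x2 t) - l *\<^sub>R second_dir (\<alpha> t) (y t)) has_vector_derivative
           roll2 t *\<^sub>R second_dir (\<alpha> t) (y t)) (at t)"
proof -
  define Y where "Y = (y t)\<^sup>2 + 1"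
  have Y: "Y \<noteq> 0" using y2_pos by (simp add: Y_def)
  have yy: "(y t)\<^sup>2 = Y - 1" by (simp add: Y_def)
  have sc: "(sin (\<alpha> t))\<^sup>2 + (cos (\<alpha> t))\<^sup>2 = 1" by simp
  have "vec2 (p t * cos (\<alpha> t) - q t * sin (\<alpha> t)) (p t * sin (\<alpha> t) + q t * cos (\<alpha> t))
      - l *\<^sub>R (((q t * ((y t)\<^sup>2 - 1) - 2 * p t * y t) / (l * ((y t)\<^sup>2 + 1))) *\<^sub>R rot90 (second_dir (\<alpha> t) (y t)))
      = roll2 t *\<^sub>R second_dir (\<alpha> t) (y t)"
    unfolding second_dir_def rot90_vec2 vec2_arith roll2_def vec2_inject Y_def[symmetric]
    using Y l_pos apply (simp add: field_simps)
    using yy by algebra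
  then show ?thesis
    using has_vector_derivative_diff[OF tip_velocity[OF t]
        bounded_linear.has_vector_derivative[OF bounded_linear_scaleR_right second_dir_derivative[OF t], of l]]
    by simp
qed

text \<open>
  By the inequality between the arithmetic and the geometric mean the speed is at most half of
  \<open>1 + p\<^sup>2 + q\<^sup>2\<close>. There is equality at unit speed, so a curve of unit speed that is shortest also has
  the least energy, and the energy is quadratic in the controls.
\<close>

lemma curve_length_le:
  "curve_length a b curve \<le> ennreal (integral {a..b} (\<lambda>t. (1 + ((p t)\<^sup>2 + (q t)\<^sup>2)) / 2))"
proof -
  let ?f = "\<lambda>t. (1 + ((p t)\<^sup>2 + (q t)\<^sup>2)) / 2"
  have "pw_continuous a b S (\<lambda>t. (1/2) * (1 + (p t * p t + q t * q t)))"
    by (intro pw_continuous_intros p_pw q_pw pw_continuousI[OF finS continuous_on_const])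
  from pw_continuous_integrable[OF this] have "?f integrable_on {a..b}"
    by (simp add: power2_eq_square)
  then have I: "(?f has_integral integral {a..b} ?f) {a..b}" by (rule integrable_integral)
  have "AE t in lborel. t \<notin> S \<union> {a, b}"
    using finS by (intro AE_not_in finite_imp_null_set_lborel) auto
  then have "AE t in lborel. ennreal (norm (vector_derivative (tip \<circ> curve) (at t))) * indicator {a..b} t
      \<le> ennreal (indicator {a..b} t * ?f t)"
  proof eventually_elim
    case (elim t)
    show ?case
    proof (cases "t \<in> {a..b}")
      case True
      then have t: "t \<in> {a<..<b} - S" using elim by auto
      have "vector_derivative (tip \<circ> curve) (at t)
          = vec2 (p t * cos (\<alpha> t) - q t * sin (\<alpha> t)) (p t * sin (\<alpha> t) + q t * cos (\<alpha> t))"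
        using tip_velocity[OF t]
        by (intro vector_derivative_at) (simp add: o_def curve_def chart_def)
      also have "norm \<dots> = sqrt ((p t)\<^sup>2 + (q t)\<^sup>2)"
      proof -
        have "(p t * cos (\<alpha> t) - q t * sin (\<alpha> t))\<^sup>2 + (p t * sin (\<alpha> t) + q t * cos (\<alpha> t))\<^sup>2
            = ((p t)\<^sup>2 + (q t)\<^sup>2) * ((sin (\<alpha> t))\<^sup>2 + (cos (\<alpha> t))\<^sup>2)" by algebra
        then show ?thesis by (simp add: norm_vec2)
      qed
      also have "\<dots> \<le> ?f t"
        using arith_geo_mean_sqrt[of 1 "(p t)\<^sup>2 + (q t)\<^sup>2"] by simp
      finally show ?thesis using True by (simp add: ennreal_leI)
    qed simp
  qed
  then have "curve_length a b curve \<le> (\<integral>\<^sup>+ t. ennreal (indicator {a..b} t * ?f t) \<partial>lborel)"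
    unfolding curve_length_def by (rule nn_integral_mono_AE)
  also have "\<dots> = ennreal (integral {a..b} ?f)"
    by (rule nn_integral_has_integral_lebesgue[OF _ I]) auto
  finally show ?thesis .
qed

lemma continuous_second_dir: "continuous_on {a..b} (\<lambda>t. second_dir (\<alpha> t) (y t))"
  unfolding second_dir_def using y2_pos by (intro continuous_intros cont) auto

lemma horizontal: "horizontal_on l l a b curve"
proof -
  let ?D = "{a<..<b} - S"
  let ?u = "\<lambda>t. vec2 (cos (\<alpha> t)) (sin (\<alpha> t))"
  let ?w = "\<lambda>t. second_dir (\<alpha> t) (y t)"
  let ?x = "\<lambda>t. vec2 (x1 t) (x2 t)"
  have contu: "continuous_on {a..b} ?u" by (intro continuous_intros cont)
  have contx: "continuous_on {a..b} ?x" by (intro continuous_intros cont)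
  have curve_eq: "curve = (\<lambda>t. (?x t, ?x t - l *\<^sub>R ?u t, ?x t - l *\<^sub>R ?w t))"
    by (rule ext) (simp add: curve_def chart_def)
  have cont_curve: "continuous_on {a..b} curve"
    unfolding curve_eq by (intro continuous_intros contu contx continuous_second_dir)
  have sub: "?D \<subseteq> {a..b}" by auto
  note cD = continuous_on_subset[OF _ sub]
  have pD: "continuous_on ?D p" "continuous_on ?D q"
    using p_pw q_pw by (auto simp: pw_continuous_def)
  have roll_pw: "pw_continuous a b S roll2"
  proof -
    have "pw_continuous a b S (\<lambda>t. (p t * ((y t)\<^sup>2 - 1) + 2 * q t * y t) * (1 / ((y t)\<^sup>2 + 1)))"
      using y2_pos
      by (intro pw_continuous_intros p_pw q_pw pw_continuousI[OF finS] continuous_intros cont) auto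
    then show ?thesis unfolding roll2_def by simp
  qed
  then have rD: "continuous_on ?D roll2" by (simp add: pw_continuous_def)
  have "curve C1_differentiable_on ?D"
    unfolding C1_differentiable_on_def
  proof (intro exI[of _ "\<lambda>t. (vec2 (p t * cos (\<alpha> t) - q t * sin (\<alpha> t)) (p t * sin (\<alpha> t) + q t * cos (\<alpha> t)),
       p t *\<^sub>R ?u t, roll2 t *\<^sub>R ?w t)"] conjI ballI)
    show "(curve has_vector_derivative (vec2 (p t * cos (\<alpha> t) - q t * sin (\<alpha> t)) (p t * sin (\<alpha> t) + q t * cos (\<alpha> t)),
       p t *\<^sub>R ?u t, roll2 t *\<^sub>R ?w t)) (at t)" if "t \<in> ?D" for t
      unfolding curve_eq
      by (intro has_vector_derivative_Pair tip_velocity foot1_velocity foot2_velocity that)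
    show "continuous_on ?D (\<lambda>t. (vec2 (p t * cos (\<alpha> t) - q t * sin (\<alpha> t)) (p t * sin (\<alpha> t) + q t * cos (\<alpha> t)),
       p t *\<^sub>R ?u t, roll2 t *\<^sub>R ?w t))"
      by (intro continuous_intros pD rD cD[OF cont(3)] cD[OF continuous_second_dir])
  qed
  moreover have "{a..b} - (S \<union> {a,b}) = ?D" by auto
  ultimately have "curve piecewise_C1_differentiable_on {a..b}"
    unfolding piecewise_C1_differentiable_on_def using cont_curve finS
    by (metis finite.emptyI finite_UnI finite_insert)
  moreover have "curve ` {a..b} \<subseteq> config_space l l"
    using chart_in_config_space[OF l_pos] by (auto simp: curve_def)
  moreover have "vector_derivative (foot1 \<circ> curve) (at t) \<in> span {tip (curve t) - foot1 (curve t)} \<and>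
        vector_derivative (foot2 \<circ> curve) (at t) \<in> span {tip (curve t) - foot2 (curve t)}"
    if t: "t \<in> {a<..<b}" and diff: "curve differentiable (at t)" for t
  proof
    obtain D where "(curve has_vector_derivative D) (at t)"
      using diff vector_derivative_works by blast
    then have D: "(foot1 \<circ> curve has_vector_derivative foot1 D) (at t)"
        "(foot2 \<circ> curve has_vector_derivative foot2 D) (at t)"
      by (auto simp: o_def intro!: bounded_linear.has_vector_derivative[OF bounded_linear_fst]
          bounded_linear.has_vector_derivative[OF bounded_linear_snd])
    have l_span: "v \<in> span {l *\<^sub>R w}" if "v \<in> span {w}" for v w :: "real ^ 2"
    proof -
      obtain k where "v = k *\<^sub>R w" using \<open>v \<in> span {w}\<close> by (auto simp: span_singleton)
      then have "v = (k / l) *\<^sub>R (l *\<^sub>R w)" using l_pos by simp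
      then show ?thesis by (metis span_base span_scale singletonI)
    qed
    have "foot1 D \<in> span {?u t}"
      using D(1) by (intro derivative_in_span_of_limit_direction[OF _ p_pw contu foot1_velocity t])
        (auto simp: curve_eq o_def intro!: continuous_intros contx contu)
    then show "vector_derivative (foot1 \<circ> curve) (at t) \<in> span {tip (curve t) - foot1 (curve t)}"
      using vector_derivative_at[OF D(1)] l_span by (simp add: curve_eq)
    have "foot2 D \<in> span {?w t}"
      using D(2) by (intro derivative_in_span_of_limit_direction[OF _ roll_pw continuous_second_dir foot2_velocity t])
        (auto simp: curve_eq o_def intro!: continuous_intros contx continuous_second_dir)
    then show "vector_derivative (foot2 \<circ> curve) (at t) \<in> span {tip (curve t) - foot2 (curve t)}"
      using vector_derivative_at[OF D(2)] l_span by (simp add: curve_eq)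
  qed
  ultimately show ?thesis unfolding horizontal_on_def by blast
qed

end

section \<open>Variations of the controls\<close>

lemma continuous_nonneg_integral_zero:
  fixes f :: "real \<Rightarrow> real"
  assumes pw: "pw_continuous a b S f" and I: "integral {a..b} f = 0"
    and nonneg: "\<And>t. t \<in> {a..b} \<Longrightarrow> 0 \<le> f t" and t: "t \<in> {a<..<b} - S"
  shows "f t = 0"
proof -
  let ?D = "{a<..<b} - S"
  have int: "f integrable_on {a..b}" by (rule pw_continuous_integrable[OF pw])
  have Z: "integral {a..s} f = 0" if "s \<in> ?D" for s
  proof (rule antisym)
    have sub: "{a..s} \<subseteq> {a..b}" using that by auto
    then have i: "f integrable_on {a..s}" using int integrable_subinterval_real by blast
    show "integral {a..s} f \<ge> 0" using sub nonneg by (intro integral_nonneg[OF i]) auto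
    show "integral {a..s} f \<le> 0"
      using integral_subset_le[OF sub i int] nonneg I by simp
  qed
  have "open ?D" using pw by (simp add: pw_continuous_def finite_imp_closed open_Diff)
  moreover have "((\<lambda>s. integral {a..s} f) has_vector_derivative f t) (at t)"
    by (rule pw_continuous_antiderivative(2)[OF pw t])
  ultimately have "((\<lambda>s. 0) has_vector_derivative f t) (at t)"
    using Z t by (auto intro: has_vector_derivative_transform_within_open[of _ _ _ ?D])
  then show ?thesis using vector_derivative_unique_at[OF _ has_vector_derivative_const] by blast
qed

text \<open>
  One coordinate for each of energy, \<open>x1\<close>, \<open>x2\<close>, \<open>\<alpha>\<close> and \<open>y\<close>. The same type serves as parameter
  space of the variations, as target of the map to be inverted, and for Lagrange multipliers.
\<close>

type_synonym multiplier = "real \<times> real \<times> real \<times> real \<times> real"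

context steered
begin

definition L :: "real \<Rightarrow> real" where "L t = integral {a..t} p / l"

text \<open>
  The factor by which a change of \<open>y\<close> at time \<open>t\<close> has grown by time \<open>b\<close>, divided by \<open>l\<close>.
\<close>

definition weight :: "real \<Rightarrow> real" where "weight t = exp (L b - L t) / l"

text \<open>
  The functions \<open>P\<close> and \<open>Q\<close> are the gradients, with respect to the controls \<open>p\<close> and \<open>q\<close> at time \<open>t\<close>, of
  the five quantities energy, \<open>x1 b\<close>, \<open>x2 b\<close>, \<open>\<alpha> b\<close> and \<open>y b\<close>. The terms with \<open>x1 b - x1 t\<close> and
  \<open>x2 b - x2 t\<close> arise because turning the frame at time \<open>t\<close> rotates the rest of the path about its
  current point.
\<close>

definition P :: "real \<Rightarrow> multiplier" where
  "P t = (p t, cos (\<alpha> t), sin (\<alpha> t), 0, weight t * y t)"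

definition Q :: "real \<Rightarrow> multiplier" where
  "Q t = (q t, - sin (\<alpha> t) - (x2 b - x2 t) / l, cos (\<alpha> t) + (x1 b - x1 t) / l, 1 / l, weight t)"

text \<open>
  The antiderivatives \<open>A\<close> and \<open>B\<close> are the first-order changes of \<open>\<alpha>\<close> and \<open>L\<close> when the
  controls are changed in the directions \<open>Q\<close> and \<open>P\<close>.
\<close>

definition A :: "real \<Rightarrow> multiplier" where "A t = (1 / l) *\<^sub>R integral {a..t} Q"

definition B :: "real \<Rightarrow> multiplier" where "B t = (1 / l) *\<^sub>R integral {a..t} P"

lemma cont_L: "continuous_on {a..b} L"
  unfolding L_def by (intro continuous_intros pw_continuous_antiderivative[OF p_pw]) (use l_pos in auto)

lemma dL: "t \<in> {a<..<b} - S \<Longrightarrow> (L has_real_derivative p t / l) (at t)"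
  using pw_continuous_antiderivative(2)[OF p_pw] l_pos unfolding L_def
  by (auto intro!: derivative_eq_intros simp: has_real_derivative_iff_has_vector_derivative[symmetric])

lemma cont_weight: "continuous_on {a..b} weight"
  unfolding weight_def by (intro continuous_intros cont_L) (use l_pos in auto)

lemma weight_pos: "weight t > 0" using l_pos by (simp add: weight_def)

lemma dweight: "t \<in> {a<..<b} - S \<Longrightarrow> (weight has_real_derivative - p t / l * weight t) (at t)"
  using l_pos unfolding weight_def
  by (auto intro!: derivative_eq_intros dL simp: field_simps)

lemma pw_of_cont: "continuous_on {a..b} g \<Longrightarrow> pw_continuous a b S g"
  by (rule pw_continuousI[OF finS])

lemma P_pw: "pw_continuous a b S P"
  unfolding P_def
  by (intro pw_continuous_Pair p_pw pw_of_cont continuous_intros cont cont_weight)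

lemma Q_pw: "pw_continuous a b S Q"
  unfolding Q_def using l_pos
  by (intro pw_continuous_Pair q_pw pw_of_cont continuous_intros cont cont_weight) auto

lemma cont_A: "continuous_on {a..b} A"
  unfolding A_def by (intro continuous_intros pw_continuous_antiderivative[OF Q_pw])

lemma cont_B: "continuous_on {a..b} B"
  unfolding B_def by (intro continuous_intros pw_continuous_antiderivative[OF P_pw])

lemma dA: "t \<in> {a<..<b} - S \<Longrightarrow> (A has_vector_derivative (1 / l) *\<^sub>R Q t) (at t)"
  unfolding A_def
  by (intro bounded_linear.has_vector_derivative[OF bounded_linear_scaleR_right]
      pw_continuous_antiderivative(2)[OF Q_pw])

lemma dB: "t \<in> {a<..<b} - S \<Longrightarrow> (B has_vector_derivative (1 / l) *\<^sub>R P t) (at t)"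
  unfolding B_def
  by (intro bounded_linear.has_vector_derivative[OF bounded_linear_scaleR_right]
      pw_continuous_antiderivative(2)[OF P_pw])

lemma A_B_start [simp]: "A a = 0" "B a = 0" "L a = 0"
  by (simp_all add: A_def B_def L_def)

text \<open>
  Variation of constants for the linear equation of \<open>y\<close>, with integrating factor \<open>exp (- L)\<close>.
\<close>

lemma y_quadrature:
  assumes t: "t \<in> {a..b}"
  shows "exp (L t) * (y a + integral {a..t} (\<lambda>s. q s * exp (- L s)) / l) = y t"
proof -
  have "((\<lambda>s. q s * exp (- L s) / l) has_integral exp (- L t) * y t - exp (- L a) * y a) {a..t}"
  proof (rule fundamental_theorem_of_calculus_interior_strong[OF finS])
    show "continuous_on {a..t} (\<lambda>s. exp (- L s) * y s)"
    proof (rule continuous_on_subset[of "{a..b}"])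
      show "continuous_on {a..b} (\<lambda>s. exp (- L s) * y s)" by (intro continuous_intros cont cont_L)
    qed (use t in auto)
    fix s assume "s \<in> {a<..<t} - S"
    then have s: "s \<in> {a<..<b} - S" using t by auto
    show "((\<lambda>s. exp (- L s) * y s) has_vector_derivative q s * exp (- L s) / l) (at s)"
      unfolding has_real_derivative_iff_has_vector_derivative[symmetric]
      by (rule DERIV_cong[OF DERIV_mult[OF DERIV_fun_exp[OF DERIV_minus[OF dL[OF s]]] dy[OF s]]])
         (use l_pos in \<open>simp add: field_simps\<close>)
  qed (use t in auto)
  from integral_unique[OF this]
  have "integral {a..t} (\<lambda>s. q s * exp (- L s)) / l = exp (- L t) * y t - y a" by simp
  then show ?thesis by (simp add: exp_minus field_simps)
qed

text \<open>
  The variation adds \<open>s \<bullet> P\<close> and \<open>s \<bullet> Q\<close> to the controls, so that the varied directions are the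
  gradients themselves. Every other quantity of the varied motion follows by quadrature.
\<close>

definition ps :: "multiplier \<Rightarrow> real \<Rightarrow> real" where "ps s t = p t + s \<bullet> P t"
definition qs :: "multiplier \<Rightarrow> real \<Rightarrow> real" where "qs s t = q t + s \<bullet> Q t"
definition \<alpha>s :: "multiplier \<Rightarrow> real \<Rightarrow> real" where "\<alpha>s s t = \<alpha> t + s \<bullet> A t"
definition Ls :: "multiplier \<Rightarrow> real \<Rightarrow> real" where "Ls s t = L t + s \<bullet> B t"
definition x1s :: "multiplier \<Rightarrow> real \<Rightarrow> real" where
  "x1s s t = x1 a + integral {a..t} (\<lambda>\<tau>. ps s \<tau> * cos (\<alpha>s s \<tau>) - qs s \<tau> * sin (\<alpha>s s \<tau>))"
definition x2s :: "multiplier \<Rightarrow> real \<Rightarrow> real" where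
  "x2s s t = x2 a + integral {a..t} (\<lambda>\<tau>. ps s \<tau> * sin (\<alpha>s s \<tau>) + qs s \<tau> * cos (\<alpha>s s \<tau>))"
definition ys :: "multiplier \<Rightarrow> real \<Rightarrow> real" where
  "ys s t = exp (Ls s t) * (y a + integral {a..t} (\<lambda>\<tau>. qs s \<tau> * exp (- Ls s \<tau>)) / l)"

lemma pw_ps: "pw_continuous a b S (ps s)" and pw_qs: "pw_continuous a b S (qs s)"
  unfolding ps_def qs_def
  by (intro pw_continuous_intros p_pw q_pw P_pw Q_pw pw_of_cont continuous_intros)+

lemma cont_\<alpha>s: "continuous_on {a..b} (\<alpha>s s)" and cont_Ls: "continuous_on {a..b} (Ls s)"
  unfolding \<alpha>s_def Ls_def by (intro continuous_intros cont cont_L cont_A cont_B)+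

lemma d\<alpha>s: "t \<in> {a<..<b} - S \<Longrightarrow> (\<alpha>s s has_real_derivative qs s t / l) (at t)"
  using bounded_linear.has_vector_derivative[OF bounded_linear_inner_right dA, of t s] d\<alpha>[of t] l_pos
  unfolding \<alpha>s_def qs_def has_real_derivative_iff_has_vector_derivative
  by (auto intro!: derivative_eq_intros simp: add_divide_distrib)

lemma dLs: "t \<in> {a<..<b} - S \<Longrightarrow> (Ls s has_real_derivative ps s t / l) (at t)"
  using bounded_linear.has_vector_derivative[OF bounded_linear_inner_right dB, of t s] dL[of t] l_pos
  unfolding Ls_def ps_def has_real_derivative_iff_has_vector_derivative
  by (auto intro!: derivative_eq_intros simp: add_divide_distrib)

lemma steered_variation:
  "steered l a b S (ps s) (qs s) (x1s s) (x2s s) (\<alpha>s s) (ys s)"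
proof -
  have pwx1: "pw_continuous a b S (\<lambda>\<tau>. ps s \<tau> * cos (\<alpha>s s \<tau>) - qs s \<tau> * sin (\<alpha>s s \<tau>))"
    by (intro pw_continuous_intros pw_ps pw_qs pw_of_cont continuous_intros cont_\<alpha>s)
  have pwx2: "pw_continuous a b S (\<lambda>\<tau>. ps s \<tau> * sin (\<alpha>s s \<tau>) + qs s \<tau> * cos (\<alpha>s s \<tau>))"
    by (intro pw_continuous_intros pw_ps pw_qs pw_of_cont continuous_intros cont_\<alpha>s)
  have pwy: "pw_continuous a b S (\<lambda>\<tau>. qs s \<tau> * exp (- Ls s \<tau>))"
    by (intro pw_continuous_intros pw_qs pw_of_cont continuous_intros cont_Ls)
  note ad = pw_continuous_antiderivative
  show ?thesis
  proof
    fix t assume t: "t \<in> {a<..<b} - S"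
    show "(x1s s has_real_derivative ps s t * cos (\<alpha>s s t) - qs s t * sin (\<alpha>s s t)) (at t)"
      using DERIV_add[OF DERIV_const ad(2)[OF pwx1 t, folded has_real_derivative_iff_has_vector_derivative]]
      unfolding x1s_def by simp
    show "(x2s s has_real_derivative ps s t * sin (\<alpha>s s t) + qs s t * cos (\<alpha>s s t)) (at t)"
      using DERIV_add[OF DERIV_const ad(2)[OF pwx2 t, folded has_real_derivative_iff_has_vector_derivative]]
      unfolding x2s_def by simp
    note dJ = DERIV_add[OF DERIV_const DERIV_cdivide[OF ad(2)[OF pwy t, folded has_real_derivative_iff_has_vector_derivative]]]
    have de: "((\<lambda>t. exp (Ls s t)) has_real_derivative exp (Ls s t) * (ps s t / l)) (at t)"
      by (rule DERIV_fun_exp[OF dLs[OF t]])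
    show "(ys s has_real_derivative (ps s t * ys s t + qs s t) / l) (at t)"
      unfolding ys_def
      by (rule DERIV_cong[OF DERIV_mult[OF de dJ]]) (use l_pos in \<open>simp add: exp_minus field_simps\<close>)
  next
    show "continuous_on {a..b} (x1s s)"
      unfolding x1s_def by (rule continuous_on_add[OF continuous_on_const ad(1)[OF pwx1]])
    show "continuous_on {a..b} (x2s s)"
      unfolding x2s_def by (rule continuous_on_add[OF continuous_on_const ad(1)[OF pwx2]])
    have "continuous_on {a..b} (\<lambda>t. integral {a..t} (\<lambda>\<tau>. qs s \<tau> * exp (- Ls s \<tau>)) / l)"
      by (rule continuous_on_divide[OF ad(1)[OF pwy] continuous_on_const]) (use l_pos in auto)
    then show "continuous_on {a..b} (ys s)"
      unfolding ys_def
      by (intro continuous_on_mult continuous_on_exp continuous_on_add continuous_on_const cont_Ls)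
  qed (simp_all add: l_pos ab pw_ps pw_qs cont_\<alpha>s d\<alpha>s)
qed

lemma variation_start: "x1s s a = x1 a" "x2s s a = x2 a" "\<alpha>s s a = \<alpha> a" "ys s a = y a"
  by (simp_all add: x1s_def x2s_def \<alpha>s_def ys_def Ls_def)

definition end_map :: "multiplier \<Rightarrow> multiplier" where
  "end_map s = (integral {a..b} (\<lambda>t. ((ps s t)\<^sup>2 + (qs s t)\<^sup>2) / 2), x1s s b, x2s s b, \<alpha>s s b, ys s b)"

lemma end_map_0: "end_map 0 = (integral {a..b} (\<lambda>t. ((p t)\<^sup>2 + (q t)\<^sup>2) / 2), x1 b, x2 b, \<alpha> b, y b)"
proof -
  have zero: "ps 0 = p" "qs 0 = q" "\<alpha>s 0 = \<alpha>" "Ls 0 = L"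
    by (auto simp: ps_def qs_def \<alpha>s_def Ls_def)
  have "((\<lambda>t. p t * cos (\<alpha> t) - q t * sin (\<alpha> t)) has_integral x1 b - x1 a) {a..b}"
    using ab by (intro fundamental_theorem_of_calculus_interior_strong[OF finS] cont)
      (auto simp: has_real_derivative_iff_has_vector_derivative[symmetric] intro!: dx1)
  then have "x1s 0 b = x1 b" by (simp add: x1s_def zero integral_unique)
  moreover have "((\<lambda>t. p t * sin (\<alpha> t) + q t * cos (\<alpha> t)) has_integral x2 b - x2 a) {a..b}"
    using ab by (intro fundamental_theorem_of_calculus_interior_strong[OF finS] cont)
      (auto simp: has_real_derivative_iff_has_vector_derivative[symmetric] intro!: dx2)
  then have "x2s 0 b = x2 b" by (simp add: x2s_def zero integral_unique)
  moreover have "ys 0 b = y b" using y_quadrature[of b] ab by (simp add: ys_def zero)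
  ultimately show ?thesis by (simp add: end_map_def zero)
qed

lemma energy_derivative:
  "((\<lambda>s. integral {a..b} (\<lambda>t. ((ps s t)\<^sup>2 + (qs s t)\<^sup>2) / 2)) has_derivative
    (\<lambda>r. r \<bullet> integral {a..b} (\<lambda>t. ps s0 t *\<^sub>R P t + qs s0 t *\<^sub>R Q t))) (at s0)"
proof -
  obtain BP where BP: "\<And>t. t \<in> {a<..<b} - S \<Longrightarrow> norm (P t) \<le> BP"
    using P_pw unfolding pw_continuous_def bounded_iff by blast
  obtain BQ where BQ: "\<And>t. t \<in> {a<..<b} - S \<Longrightarrow> norm (Q t) \<le> BQ"
    using Q_pw unfolding pw_continuous_def bounded_iff by blast
  show ?thesis
  proof (rule has_derivative_integral_quadratic[where S = S and C = "BP\<^sup>2 + BQ\<^sup>2"])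
    show "(\<lambda>t. ((ps s t)\<^sup>2 + (qs s t)\<^sup>2) / 2) integrable_on {a..b}" for s
    proof -
      have "pw_continuous a b S (\<lambda>t. (1 / 2) * (ps s t * ps s t + qs s t * qs s t))"
        by (intro pw_continuous_intros pw_ps pw_qs pw_of_cont continuous_intros)
      from pw_continuous_integrable[OF this] show ?thesis by (simp add: power2_eq_square)
    qed
    show "(\<lambda>t. ps s0 t *\<^sub>R P t + qs s0 t *\<^sub>R Q t) integrable_on {a..b}"
      by (intro pw_continuous_integrable[of _ _ S] pw_continuous_add
          pw_continuous_bilinear[OF bounded_bilinear_scaleR] pw_ps pw_qs P_pw Q_pw)
    fix s t assume t: "t \<in> {a<..<b} - S"
    define r where "r = s - s0"
    have sq: "(r \<bullet> v)\<^sup>2 \<le> C\<^sup>2 * (norm r)\<^sup>2" if "norm v \<le> C" for v :: multiplier and C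
    proof -
      have "\<bar>r \<bullet> v\<bar> \<le> norm r * norm v" by (rule Cauchy_Schwarz_ineq2)
      also have "\<dots> \<le> norm r * C" using that by (rule mult_left_mono) simp
      finally have "\<bar>r \<bullet> v\<bar>\<^sup>2 \<le> (norm r * C)\<^sup>2" by (rule power_mono) simp
      then show ?thesis by (simp add: power_mult_distrib mult.commute)
    qed
    have e: "ps s t = ps s0 t + r \<bullet> P t" "qs s t = qs s0 t + r \<bullet> Q t"
      by (simp_all add: ps_def qs_def r_def algebra_simps)
    have "((ps s t)\<^sup>2 + (qs s t)\<^sup>2) / 2 - ((ps s0 t)\<^sup>2 + (qs s0 t)\<^sup>2) / 2 -
        (s - s0) \<bullet> (ps s0 t *\<^sub>R P t + qs s0 t *\<^sub>R Q t) = ((r \<bullet> P t)\<^sup>2 + (r \<bullet> Q t)\<^sup>2) / 2"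
      unfolding e r_def[symmetric] by (simp add: inner_right_distrib power2_eq_square field_simps)
    moreover have "\<bar>((r \<bullet> P t)\<^sup>2 + (r \<bullet> Q t)\<^sup>2) / 2\<bar> \<le> (BP\<^sup>2 + BQ\<^sup>2) * (norm r)\<^sup>2"
    proof -
      have "\<bar>((r \<bullet> P t)\<^sup>2 + (r \<bullet> Q t)\<^sup>2) / 2\<bar> = ((r \<bullet> P t)\<^sup>2 + (r \<bullet> Q t)\<^sup>2) / 2" by simp
      also have "\<dots> \<le> (r \<bullet> P t)\<^sup>2 + (r \<bullet> Q t)\<^sup>2" using sum_power2_ge_zero[of "r \<bullet> P t" "r \<bullet> Q t"] by simp
      also have "\<dots> \<le> (BP\<^sup>2 + BQ\<^sup>2) * (norm r)\<^sup>2"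
        using sq[OF BP[OF t]] sq[OF BQ[OF t]] by (simp add: algebra_simps)
      finally show ?thesis .
    qed
    ultimately show "\<bar>((ps s t)\<^sup>2 + (qs s t)\<^sup>2) / 2 - ((ps s0 t)\<^sup>2 + (qs s0 t)\<^sup>2) / 2 -
        (s - s0) \<bullet> (ps s0 t *\<^sub>R P t + qs s0 t *\<^sub>R Q t)\<bar> \<le> (BP\<^sup>2 + BQ\<^sup>2) * (norm (s - s0))\<^sup>2"
      by (simp only: r_def)
  qed (use ab finS in auto)
qed

lemma P_param:
  assumes "\<And>x. (\<phi> has_real_derivative \<phi>' x) (at x)" "\<And>x. (\<phi>' has_real_derivative \<phi>'' x) (at x)"
    "continuous_on UNIV \<phi>''"
  shows "((\<lambda>s. integral {a..b} (\<lambda>t. ps s t * \<phi> (\<alpha>s s t))) has_derivative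
    (\<lambda>r. r \<bullet> integral {a..b} (\<lambda>t. \<phi> (\<alpha>s s0 t) *\<^sub>R P t + (ps s0 t * \<phi>' (\<alpha>s s0 t)) *\<^sub>R A t))) (at s0)"
  unfolding ps_def \<alpha>s_def
  by (rule has_derivative_integral_parameter[OF less_imp_le[OF ab] p_pw P_pw cont(3) cont_A assms])

lemma Q_param:
  assumes "\<And>x. (\<phi> has_real_derivative \<phi>' x) (at x)" "\<And>x. (\<phi>' has_real_derivative \<phi>'' x) (at x)"
    "continuous_on UNIV \<phi>''"
  shows "((\<lambda>s. integral {a..b} (\<lambda>t. qs s t * \<phi> (\<alpha>s s t))) has_derivative
    (\<lambda>r. r \<bullet> integral {a..b} (\<lambda>t. \<phi> (\<alpha>s s0 t) *\<^sub>R Q t + (qs s0 t * \<phi>' (\<alpha>s s0 t)) *\<^sub>R A t))) (at s0)"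
  unfolding qs_def \<alpha>s_def
  by (rule has_derivative_integral_parameter[OF less_imp_le[OF ab] q_pw Q_pw cont(3) cont_A assms])

lemma Q_exp_param:
  "((\<lambda>s. integral {a..b} (\<lambda>t. qs s t * exp (- Ls s t))) has_derivative
    (\<lambda>r. r \<bullet> integral {a..b} (\<lambda>t. exp (- Ls s0 t) *\<^sub>R Q t + (qs s0 t * - exp (- Ls s0 t)) *\<^sub>R B t))) (at s0)"
  unfolding qs_def Ls_def
  by (rule has_derivative_integral_parameter[OF less_imp_le[OF ab] q_pw Q_pw cont_L cont_B,
        of "\<lambda>x. exp (- x)" "\<lambda>x. - exp (- x)" "\<lambda>x. exp (- x)"])
     (auto intro!: derivative_eq_intros continuous_intros)

lemma pw_trig_integrable:
  assumes "pw_continuous a b S g" "continuous_on UNIV (\<phi> :: real \<Rightarrow> real)"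
  shows "(\<lambda>t. g t * \<phi> (\<alpha>s s t)) integrable_on {a..b}"
  by (intro pw_continuous_integrable[of _ _ S] pw_continuous_intros assms(1) pw_of_cont
      continuous_on_compose2[OF assms(2) cont_\<alpha>s]) auto

lemma x1s_end: "x1s s b = x1 a + integral {a..b} (\<lambda>t. ps s t * cos (\<alpha>s s t))
    - integral {a..b} (\<lambda>t. qs s t * sin (\<alpha>s s t))"
  unfolding x1s_def
  by (subst integral_diff) (auto intro!: pw_trig_integrable pw_ps pw_qs continuous_intros)

lemma x2s_end: "x2s s b = x2 a + integral {a..b} (\<lambda>t. ps s t * sin (\<alpha>s s t))
    + integral {a..b} (\<lambda>t. qs s t * cos (\<alpha>s s t))"
  unfolding x2s_def
  by (subst integral_add) (auto intro!: pw_trig_integrable pw_ps pw_qs continuous_intros)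

lemma x1s_derivative:
  "((\<lambda>s. x1s s b) has_derivative
    (\<lambda>r. r \<bullet> (integral {a..b} (\<lambda>t. cos (\<alpha>s s0 t) *\<^sub>R P t + (ps s0 t * - sin (\<alpha>s s0 t)) *\<^sub>R A t)
           - integral {a..b} (\<lambda>t. sin (\<alpha>s s0 t) *\<^sub>R Q t + (qs s0 t * cos (\<alpha>s s0 t)) *\<^sub>R A t)))) (at s0)"
proof -
  note D = has_derivative_diff[OF has_derivative_add[OF has_derivative_const
     P_param[of cos "\<lambda>x. - sin x" "\<lambda>x. - cos x" s0]] Q_param[of sin cos "\<lambda>x. - sin x" s0]]
  show ?thesis
    unfolding x1s_end inner_diff_right
    by (rule has_derivative_eq_rhs[OF D]) (auto intro!: derivative_eq_intros continuous_intros)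
qed

lemma x2s_derivative:
  "((\<lambda>s. x2s s b) has_derivative
    (\<lambda>r. r \<bullet> (integral {a..b} (\<lambda>t. sin (\<alpha>s s0 t) *\<^sub>R P t + (ps s0 t * cos (\<alpha>s s0 t)) *\<^sub>R A t)
           + integral {a..b} (\<lambda>t. cos (\<alpha>s s0 t) *\<^sub>R Q t + (qs s0 t * - sin (\<alpha>s s0 t)) *\<^sub>R A t)))) (at s0)"
proof -
  note D = has_derivative_add[OF has_derivative_add[OF has_derivative_const
     P_param[of sin cos "\<lambda>x. - sin x" s0]] Q_param[of cos "\<lambda>x. - sin x" "\<lambda>x. - cos x" s0]]
  show ?thesis
    unfolding x2s_end inner_add_right
    by (rule has_derivative_eq_rhs[OF D]) (auto intro!: derivative_eq_intros continuous_intros)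
qed

lemma ys_derivative:
  "((\<lambda>s. ys s b) has_derivative
    (\<lambda>r. r \<bullet> (ys s0 b *\<^sub>R B b + (exp (Ls s0 b) / l) *\<^sub>R
       integral {a..b} (\<lambda>t. exp (- Ls s0 t) *\<^sub>R Q t + (qs s0 t * - exp (- Ls s0 t)) *\<^sub>R B t)))) (at s0)"
proof -
  have "((\<lambda>s. Ls s b) has_derivative (\<lambda>r. r \<bullet> B b)) (at s0)"
    unfolding Ls_def by (auto intro!: derivative_eq_intros)
  moreover define J where "J s = integral {a..b} (\<lambda>t. qs s t * exp (- Ls s t))" for s
  define j where "j = integral {a..b} (\<lambda>t. exp (- Ls s0 t) *\<^sub>R Q t + (qs s0 t * - exp (- Ls s0 t)) *\<^sub>R B t)"
  have "(J has_derivative (\<lambda>r. r \<bullet> j)) (at s0)"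
    unfolding J_def j_def by (rule Q_exp_param)
  ultimately show ?thesis
    unfolding ys_def J_def[symmetric] j_def[symmetric] using l_pos
    by (auto intro!: derivative_eq_intros simp: inner_add_right field_simps)
qed

lemma \<alpha>s_derivative: "((\<lambda>s. \<alpha>s s b) has_derivative (\<lambda>r. r \<bullet> A b)) (at s0)"
  unfolding \<alpha>s_def by (auto intro!: derivative_eq_intros)

end

section \<open>The multiplier rule\<close>

context steered
begin

text \<open>
  Since the gradients are also the directions of variation, the derivative of the end map is the
  Gram operator of the five pairs of components of \<open>P\<close> and \<open>Q\<close>.
\<close>

definition gram :: "multiplier \<Rightarrow> multiplier" where
  "gram r = integral {a..b} (\<lambda>t. (r \<bullet> P t) *\<^sub>R P t + (r \<bullet> Q t) *\<^sub>R Q t)"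

text \<open>
  For a coordinate \<open>c\<close>, the gradient at \<open>0\<close> of that coordinate of the end map.
\<close>

definition grad :: "(multiplier \<Rightarrow> real) \<Rightarrow> multiplier" where
  "grad c = integral {a..b} (\<lambda>t. c (P t) *\<^sub>R P t + c (Q t) *\<^sub>R Q t)"

lemma pw_integrable_scaleR:
  assumes "pw_continuous a b S f" "pw_continuous a b S g"
  shows "(\<lambda>t. f t *\<^sub>R (g t :: multiplier)) integrable_on {a..b}"
  by (intro pw_continuous_integrable[of _ _ S] pw_continuous_bilinear[OF bounded_bilinear_scaleR] assms)

lemma integral_of_derivative:
  fixes F :: "real \<Rightarrow> multiplier"
  assumes "continuous_on {a..b} F" "\<And>t. t \<in> {a<..<b} - S \<Longrightarrow> (F has_vector_derivative f t) (at t)"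
  shows "(f has_integral F b - F a) {a..b}"
  using assms ab by (intro fundamental_theorem_of_calculus_interior_strong[OF finS]) auto

lemma zero_param: "ps 0 = p" "qs 0 = q" "\<alpha>s 0 = \<alpha>" "Ls 0 = L" "ys 0 b = y b"
  using end_map_0 by (auto simp: ps_def qs_def \<alpha>s_def Ls_def end_map_def)

lemmas pw_int = pw_integrable_scaleR[OF _ P_pw] pw_integrable_scaleR[OF _ Q_pw]
  pw_integrable_scaleR[OF _ pw_of_cont[OF cont_A]] pw_integrable_scaleR[OF _ pw_of_cont[OF cont_B]]

text \<open>
  Differentiation under the integral leaves a term with the antiderivative \<open>A\<close>; integrating it by
  parts against \<open>x2 b - x2 t\<close>, which vanishes at \<open>b\<close> while \<open>A\<close> vanishes at \<open>a\<close>, moves the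
  derivative onto \<open>A\<close> and produces the second component of \<open>Q\<close>.
\<close>

lemma x1_gradient:
  "integral {a..b} (\<lambda>t. cos (\<alpha> t) *\<^sub>R P t + (p t * - sin (\<alpha> t)) *\<^sub>R A t)
     - integral {a..b} (\<lambda>t. sin (\<alpha> t) *\<^sub>R Q t + (q t * cos (\<alpha> t)) *\<^sub>R A t)
   = grad (\<lambda>v. fst (snd v))"
proof -
  have "((\<lambda>t. (x2 b - x2 t) *\<^sub>R ((1 / l) *\<^sub>R Q t) + (- (p t * sin (\<alpha> t) + q t * cos (\<alpha> t))) *\<^sub>R A t)
      has_integral (x2 b - x2 b) *\<^sub>R A b - (x2 b - x2 a) *\<^sub>R A a) {a..b}"
  proof (rule integral_of_derivative)
    show "continuous_on {a..b} (\<lambda>t. (x2 b - x2 t) *\<^sub>R A t)" by (intro continuous_intros cont cont_A)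
    show "((\<lambda>t. (x2 b - x2 t) *\<^sub>R A t) has_vector_derivative
        (x2 b - x2 t) *\<^sub>R ((1 / l) *\<^sub>R Q t) + (- (p t * sin (\<alpha> t) + q t * cos (\<alpha> t))) *\<^sub>R A t) (at t)"
      if t: "t \<in> {a<..<b} - S" for t
      using has_vector_derivative_scaleR[OF DERIV_diff[OF DERIV_const dx2[OF t]] dA[OF t]] by simp
  qed
  moreover have "(\<lambda>t. cos (\<alpha> t) *\<^sub>R P t + (p t * - sin (\<alpha> t)) *\<^sub>R A t) integrable_on {a..b}"
    "(\<lambda>t. sin (\<alpha> t) *\<^sub>R Q t + (q t * cos (\<alpha> t)) *\<^sub>R A t) integrable_on {a..b}"
    by (intro integrable_add pw_int pw_continuous_intros p_pw q_pw pw_of_cont continuous_intros cont)+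
  ultimately have "((\<lambda>t. (cos (\<alpha> t) *\<^sub>R P t + (p t * - sin (\<alpha> t)) *\<^sub>R A t)
      - (sin (\<alpha> t) *\<^sub>R Q t + (q t * cos (\<alpha> t)) *\<^sub>R A t)
      - ((x2 b - x2 t) *\<^sub>R ((1 / l) *\<^sub>R Q t) + (- (p t * sin (\<alpha> t) + q t * cos (\<alpha> t))) *\<^sub>R A t))
      has_integral integral {a..b} (\<lambda>t. cos (\<alpha> t) *\<^sub>R P t + (p t * - sin (\<alpha> t)) *\<^sub>R A t)
     - integral {a..b} (\<lambda>t. sin (\<alpha> t) *\<^sub>R Q t + (q t * cos (\<alpha> t)) *\<^sub>R A t) - 0) {a..b}"
    by (intro has_integral_diff integrable_integral) auto
  moreover have "(\<lambda>t. (cos (\<alpha> t) *\<^sub>R P t + (p t * - sin (\<alpha> t)) *\<^sub>R A t)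
      - (sin (\<alpha> t) *\<^sub>R Q t + (q t * cos (\<alpha> t)) *\<^sub>R A t)
      - ((x2 b - x2 t) *\<^sub>R ((1 / l) *\<^sub>R Q t) + (- (p t * sin (\<alpha> t) + q t * cos (\<alpha> t))) *\<^sub>R A t))
      = (\<lambda>t. fst (snd (P t)) *\<^sub>R P t + fst (snd (Q t)) *\<^sub>R Q t)"
  proof (rule ext, goal_cases)
    case (1 t)
    have "fst (snd (P t)) = cos (\<alpha> t)" "fst (snd (Q t)) = - sin (\<alpha> t) - (x2 b - x2 t) * (1 / l)"
      by (simp_all add: P_def Q_def)
    then show ?case by (simp only:) (simp add: algebra_simps)
  qed
  ultimately show ?thesis unfolding grad_def by (simp add: integral_unique)
qed

lemma x2_gradient:
  "integral {a..b} (\<lambda>t. sin (\<alpha> t) *\<^sub>R P t + (p t * cos (\<alpha> t)) *\<^sub>R A t)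
     + integral {a..b} (\<lambda>t. cos (\<alpha> t) *\<^sub>R Q t + (q t * - sin (\<alpha> t)) *\<^sub>R A t)
   = grad (\<lambda>v. fst (snd (snd v)))"
proof -
  have "((\<lambda>t. (x1 b - x1 t) *\<^sub>R ((1 / l) *\<^sub>R Q t) + (- (p t * cos (\<alpha> t) - q t * sin (\<alpha> t))) *\<^sub>R A t)
      has_integral (x1 b - x1 b) *\<^sub>R A b - (x1 b - x1 a) *\<^sub>R A a) {a..b}"
  proof (rule integral_of_derivative)
    show "continuous_on {a..b} (\<lambda>t. (x1 b - x1 t) *\<^sub>R A t)" by (intro continuous_intros cont cont_A)
    show "((\<lambda>t. (x1 b - x1 t) *\<^sub>R A t) has_vector_derivative
        (x1 b - x1 t) *\<^sub>R ((1 / l) *\<^sub>R Q t) + (- (p t * cos (\<alpha> t) - q t * sin (\<alpha> t))) *\<^sub>R A t) (at t)"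
      if t: "t \<in> {a<..<b} - S" for t
      using has_vector_derivative_scaleR[OF DERIV_diff[OF DERIV_const dx1[OF t]] dA[OF t]] by simp
  qed
  moreover have "(\<lambda>t. sin (\<alpha> t) *\<^sub>R P t + (p t * cos (\<alpha> t)) *\<^sub>R A t) integrable_on {a..b}"
    "(\<lambda>t. cos (\<alpha> t) *\<^sub>R Q t + (q t * - sin (\<alpha> t)) *\<^sub>R A t) integrable_on {a..b}"
    by (intro integrable_add pw_int pw_continuous_intros p_pw q_pw pw_of_cont continuous_intros cont)+
  ultimately have "((\<lambda>t. (sin (\<alpha> t) *\<^sub>R P t + (p t * cos (\<alpha> t)) *\<^sub>R A t)
      + (cos (\<alpha> t) *\<^sub>R Q t + (q t * - sin (\<alpha> t)) *\<^sub>R A t)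
      + ((x1 b - x1 t) *\<^sub>R ((1 / l) *\<^sub>R Q t) + (- (p t * cos (\<alpha> t) - q t * sin (\<alpha> t))) *\<^sub>R A t))
      has_integral integral {a..b} (\<lambda>t. sin (\<alpha> t) *\<^sub>R P t + (p t * cos (\<alpha> t)) *\<^sub>R A t)
     + integral {a..b} (\<lambda>t. cos (\<alpha> t) *\<^sub>R Q t + (q t * - sin (\<alpha> t)) *\<^sub>R A t) + 0) {a..b}"
    by (intro has_integral_add integrable_integral) auto
  moreover have "(\<lambda>t. (sin (\<alpha> t) *\<^sub>R P t + (p t * cos (\<alpha> t)) *\<^sub>R A t)
      + (cos (\<alpha> t) *\<^sub>R Q t + (q t * - sin (\<alpha> t)) *\<^sub>R A t)
      + ((x1 b - x1 t) *\<^sub>R ((1 / l) *\<^sub>R Q t) + (- (p t * cos (\<alpha> t) - q t * sin (\<alpha> t))) *\<^sub>R A t))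
      = (\<lambda>t. fst (snd (snd (P t))) *\<^sub>R P t + fst (snd (snd (Q t))) *\<^sub>R Q t)"
  proof (rule ext, goal_cases)
    case (1 t)
    have "fst (snd (snd (P t))) = sin (\<alpha> t)" "fst (snd (snd (Q t))) = cos (\<alpha> t) + (x1 b - x1 t) * (1 / l)"
      by (simp_all add: P_def Q_def)
    then show ?case by (simp only:) (simp add: algebra_simps)
  qed
  ultimately show ?thesis unfolding grad_def by (simp add: integral_unique)
qed

lemma \<alpha>_gradient: "A b = grad (\<lambda>v. fst (snd (snd (snd v))))"
proof -
  have "fst (snd (snd (snd (P t)))) = 0" "fst (snd (snd (snd (Q t)))) = 1 / l" for t
    by (simp_all add: P_def Q_def)
  then show ?thesis unfolding A_def grad_def by simp
qed

text \<open>
  Here the integration by parts uses the derivative of \<open>weight t * y t\<close>, in which the terms with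
  \<open>p t * y t\<close> cancel.
\<close>

lemma y_gradient:
  "y b *\<^sub>R B b + (exp (L b) / l) *\<^sub>R
       integral {a..b} (\<lambda>t. exp (- L t) *\<^sub>R Q t + (q t * - exp (- L t)) *\<^sub>R B t)
   = grad (\<lambda>v. snd (snd (snd (snd v))))"
proof -
  have "((\<lambda>t. (weight t * y t) *\<^sub>R ((1 / l) *\<^sub>R P t) + (weight t * q t / l) *\<^sub>R B t)
      has_integral (weight b * y b) *\<^sub>R B b - (weight a * y a) *\<^sub>R B a) {a..b}"
  proof (rule integral_of_derivative)
    show "continuous_on {a..b} (\<lambda>t. (weight t * y t) *\<^sub>R B t)"
      by (intro continuous_intros cont cont_B cont_weight)
    show "((\<lambda>t. (weight t * y t) *\<^sub>R B t) has_vector_derivative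
        (weight t * y t) *\<^sub>R ((1 / l) *\<^sub>R P t) + (weight t * q t / l) *\<^sub>R B t) (at t)"
      if t: "t \<in> {a<..<b} - S" for t
    proof -
      have "((\<lambda>t. weight t * y t) has_real_derivative weight t * q t / l) (at t)"
        by (rule DERIV_cong[OF DERIV_mult[OF dweight[OF t] dy[OF t]]]) (use l_pos in \<open>simp add: field_simps\<close>)
      from has_vector_derivative_scaleR[OF this dB[OF t]] show ?thesis .
    qed
  qed
  from has_integral_cmul[OF this, of l]
  have "((\<lambda>t. l *\<^sub>R ((weight t * y t) *\<^sub>R ((1 / l) *\<^sub>R P t) + (weight t * q t / l) *\<^sub>R B t))
      has_integral y b *\<^sub>R B b) {a..b}"
    using l_pos by (simp add: weight_def)
  moreover have "(\<lambda>t. exp (- L t) *\<^sub>R Q t + (q t * - exp (- L t)) *\<^sub>R B t) integrable_on {a..b}"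
    by (intro integrable_add pw_int pw_continuous_intros q_pw pw_of_cont continuous_intros cont_L)
  ultimately have "((\<lambda>t. l *\<^sub>R ((weight t * y t) *\<^sub>R ((1 / l) *\<^sub>R P t) + (weight t * q t / l) *\<^sub>R B t)
       + (exp (L b) / l) *\<^sub>R (exp (- L t) *\<^sub>R Q t + (q t * - exp (- L t)) *\<^sub>R B t)) has_integral
     y b *\<^sub>R B b + (exp (L b) / l) *\<^sub>R
       integral {a..b} (\<lambda>t. exp (- L t) *\<^sub>R Q t + (q t * - exp (- L t)) *\<^sub>R B t)) {a..b}"
    by (intro has_integral_add has_integral_cmul integrable_integral)
  moreover have "(\<lambda>t. l *\<^sub>R ((weight t * y t) *\<^sub>R ((1 / l) *\<^sub>R P t) + (weight t * q t / l) *\<^sub>R B t)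
       + (exp (L b) / l) *\<^sub>R (exp (- L t) *\<^sub>R Q t + (q t * - exp (- L t)) *\<^sub>R B t))
     = (\<lambda>t. snd (snd (snd (snd (P t)))) *\<^sub>R P t + snd (snd (snd (snd (Q t)))) *\<^sub>R Q t)"
  proof (rule ext, goal_cases)
    case (1 t)
    have w: "exp (L b) / l * exp (- L t) = weight t" by (simp add: weight_def exp_diff exp_minus field_simps)
    have c: "snd (snd (snd (snd (P t)))) = weight t * y t" "snd (snd (snd (snd (Q t)))) = weight t"
      by (simp_all add: P_def Q_def)
    have "(exp (L b) / l) *\<^sub>R (exp (- L t) *\<^sub>R Q t + (q t * - exp (- L t)) *\<^sub>R B t)
       = (exp (L b) / l * exp (- L t)) *\<^sub>R Q t - (exp (L b) / l * exp (- L t) * q t) *\<^sub>R B t"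
      by (simp add: algebra_simps)
    also have "\<dots> = weight t *\<^sub>R Q t - (weight t * q t) *\<^sub>R B t" unfolding w ..
    finally show ?case unfolding c using l_pos by (simp add: algebra_simps)
  qed
  ultimately show ?thesis unfolding grad_def by (simp add: integral_unique)
qed

lemma energy_gradient: "integral {a..b} (\<lambda>t. p t *\<^sub>R P t + q t *\<^sub>R Q t) = grad fst"
  unfolding grad_def by (simp add: P_def Q_def)

lemma grad_components:
  "(r \<bullet> grad fst, r \<bullet> grad (\<lambda>v. fst (snd v)), r \<bullet> grad (\<lambda>v. fst (snd (snd v))),
    r \<bullet> grad (\<lambda>v. fst (snd (snd (snd v)))), r \<bullet> grad (\<lambda>v. snd (snd (snd (snd v))))) = gram r"
proof -
  have int: "(\<lambda>t. (r \<bullet> P t) *\<^sub>R P t + (r \<bullet> Q t) *\<^sub>R Q t) integrable_on {a..b}"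
    by (intro integrable_add pw_int pw_continuous_intros P_pw Q_pw pw_of_cont continuous_intros)
  have main: "r \<bullet> grad c = c (gram r)" if c: "bounded_linear c" for c :: "multiplier \<Rightarrow> real"
  proof -
    interpret bounded_linear c by fact
    have pwc: "pw_continuous a b S (\<lambda>t. c (f t))" if "pw_continuous a b S f" for f
      using pw_continuous_bilinear[OF bounded_bilinear_mult _ _] that
      by (auto simp: pw_continuous_def intro!: continuous_on bounded_linear_image[OF _ c]
            simp flip: image_image)
    have i: "(\<lambda>t. c (P t) *\<^sub>R P t + c (Q t) *\<^sub>R Q t) integrable_on {a..b}"
      by (intro integrable_add pw_int pwc P_pw Q_pw)
    have "r \<bullet> grad c = integral {a..b} (\<lambda>t. r \<bullet> (c (P t) *\<^sub>R P t + c (Q t) *\<^sub>R Q t))"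
      unfolding grad_def
      using integral_linear[OF i bounded_linear_inner_right[of r]] by (simp add: o_def)
    also have "\<dots> = integral {a..b} (\<lambda>t. c ((r \<bullet> P t) *\<^sub>R P t + (r \<bullet> Q t) *\<^sub>R Q t))"
      by (simp add: inner_add_right add scaleR mult.commute)
    also have "\<dots> = c (gram r)"
      unfolding gram_def using integral_linear[OF int c] by (simp add: o_def)
    finally show ?thesis .
  qed
  show ?thesis
    by (simp add: main bounded_linear_fst bounded_linear_snd bounded_linear_compose[OF bounded_linear_fst]
       bounded_linear_compose[OF bounded_linear_snd])
qed

lemma end_map_differentiable: "\<exists>D. (end_map has_derivative D) (at s0)"
  unfolding end_map_def
  by (rule exI, rule has_derivative_Pair[OF energy_derivative has_derivative_Pair[OF x1s_derivative
        has_derivative_Pair[OF x2s_derivative has_derivative_Pair[OF \<alpha>s_derivative ys_derivative]]]])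

lemma end_map_derivative: "(end_map has_derivative gram) (at 0)"
proof -
  have "(end_map has_derivative (\<lambda>r. (r \<bullet> grad fst, r \<bullet> grad (\<lambda>v. fst (snd v)), r \<bullet> grad (\<lambda>v. fst (snd (snd v))),
    r \<bullet> grad (\<lambda>v. fst (snd (snd (snd v)))), r \<bullet> grad (\<lambda>v. snd (snd (snd (snd v))))))) (at 0)"
    unfolding end_map_def energy_gradient[symmetric] x1_gradient[symmetric] x2_gradient[symmetric]
      \<alpha>_gradient[symmetric] y_gradient[symmetric]
    using energy_derivative[of 0] x1s_derivative[of 0] x2s_derivative[of 0] \<alpha>s_derivative[of 0] ys_derivative[of 0]
    unfolding zero_param by (intro has_derivative_Pair)
  then show ?thesis unfolding grad_components by simp
qed

text \<open>
  If no nontrivial combination of the gradients vanished, the Gram operator would be injective, hence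
  invertible, and the end map would be open at \<open>0\<close>. Then some nearby controls would reach the same
  end point with less energy. For the openness, differentiability at one point and continuity are
  enough.
\<close>

lemma multiplier_rule:
  assumes min: "\<And>s. snd (end_map s) = snd (end_map 0) \<Longrightarrow> fst (end_map 0) \<le> fst (end_map s)"
  shows "\<exists>h. h \<noteq> 0 \<and> (\<forall>t\<in>{a<..<b} - S. h \<bullet> P t = 0 \<and> h \<bullet> Q t = 0)"
proof (rule ccontr)
  assume contra: "\<not> ?thesis"
  have bl: "bounded_linear gram" by (rule has_derivative_bounded_linear[OF end_map_derivative])
  then have lin: "linear gram" by (rule bounded_linear.linear)
  have "h = 0" if "gram h = 0" for h
  proof (rule ccontr)
    assume "h \<noteq> 0"
    have int: "(\<lambda>t. (h \<bullet> P t) *\<^sub>R P t + (h \<bullet> Q t) *\<^sub>R Q t) integrable_on {a..b}"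
      by (intro integrable_add pw_int pw_continuous_intros P_pw Q_pw pw_of_cont continuous_intros)
    have pw: "pw_continuous a b S (\<lambda>t. (h \<bullet> P t) * (h \<bullet> P t) + (h \<bullet> Q t) * (h \<bullet> Q t))"
      by (intro pw_continuous_intros P_pw Q_pw pw_of_cont continuous_intros)
    have "integral {a..b} (\<lambda>t. (h \<bullet> P t) * (h \<bullet> P t) + (h \<bullet> Q t) * (h \<bullet> Q t)) = h \<bullet> gram h"
      unfolding gram_def using integral_linear[OF int bounded_linear_inner_right[of h]]
      by (simp add: o_def inner_add_right)
    then have zero: "integral {a..b} (\<lambda>t. (h \<bullet> P t) * (h \<bullet> P t) + (h \<bullet> Q t) * (h \<bullet> Q t)) = 0"
      using that by simp
    have "h \<bullet> P t = 0 \<and> h \<bullet> Q t = 0" if "t \<in> {a<..<b} - S" for t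
      using continuous_nonneg_integral_zero[OF pw zero _ that]
      by (simp add: sum_squares_eq_zero_iff)
    with contra \<open>h \<noteq> 0\<close> show False by blast
  qed
  then have inj: "inj gram" using lin by (simp add: linear_injective_0)
  have "surj gram" using linear_inj_imp_surj lin inj by blast
  then obtain g where g: "linear g" "gram \<circ> g = id"
    using linear_surjective_right_inverse[OF lin] by blast
  have "end_map 0 \<in> interior (end_map ` UNIV)"
  proof (rule sussmann_open_mapping[OF open_UNIV _ _ end_map_derivative])
    show "continuous_on UNIV end_map"
      using end_map_differentiable has_derivative_continuous
      by (metis continuous_at_imp_continuous_on)
    show "bounded_linear g" using g(1) by (simp add: linear_conv_bounded_linear)
  qed (use g in auto)
  then obtain e where e: "e > 0" "ball (end_map 0) e \<subseteq> range end_map"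
    by (auto simp: mem_interior)
  \<comment> \<open>Lower the energy and keep the end point.\<close>
  define z where "z = end_map 0 - (e / 2, 0)"
  have "dist (end_map 0) z < e"
    using e by (simp add: z_def dist_norm norm_Pair)
  then have "z \<in> range end_map" using e(2) by (auto simp only: mem_ball dest: subsetD)
  then obtain s where "end_map s = z" by blast
  then have "snd (end_map s) = snd (end_map 0)" "fst (end_map s) = fst (end_map 0) - e / 2"
    by (simp_all add: z_def)
  with min[of s] e(1) show False by simp
qed

end

section \<open>Unit-speed horizontal curves in half-angle coordinates\<close>

lemma rot90_props:
  "u \<bullet> rot90 u = 0" "rot90 u \<bullet> rot90 v = u \<bullet> v" "rot90 (rot90 u) = - u" "rot90 u \<bullet> v = - (u \<bullet> rot90 v)"
  by (simp_all add: rot90_def inner_vec_def sum_2 vec_eq_iff forall_2)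

lemma rot90_nth: "rot90 v $ 1 = - v $ 2" "rot90 v $ 2 = v $ 1"
  by (simp_all add: rot90_def)

lemma orthonormal_expansion:
  fixes u v :: "real ^ 2"
  assumes "norm u = 1"
  shows "v = (v \<bullet> u) *\<^sub>R u + (v \<bullet> rot90 u) *\<^sub>R rot90 u"
proof -
  have "u $ 1 * u $ 1 + u $ 2 * u $ 2 = 1"
    using assms by (simp add: norm_eq_1 inner_vec_def sum_2)
  then show ?thesis
    by (simp add: vec_eq_iff forall_2 rot90_def inner_vec_def sum_2) algebra
qed

text \<open>
  The direction of a segment of fixed length is a unit vector, so its derivative is orthogonal to
  it; since the foot moves along the segment, the orthogonal part is due to the velocity of the tip
  alone.
\<close>

lemma segment_direction_derivative:
  fixes X m :: "real \<Rightarrow> real ^ 2"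
  assumes l: "l > 0" and D: "open D" "t \<in> D" and dist: "\<And>s. s \<in> D \<Longrightarrow> dist (X s) (m s) = l"
    and X: "(X has_vector_derivative v) (at t)" and m: "(m has_vector_derivative w) (at t)"
    and w: "w \<in> span {X t - m t}"
  defines "U \<equiv> (\<lambda>s. (1 / l) *\<^sub>R (X s - m s))"
  shows "(U has_vector_derivative ((v \<bullet> rot90 (U t)) / l) *\<^sub>R rot90 (U t)) (at t)"
proof -
  obtain k where k: "w = k *\<^sub>R (X t - m t)" using w by (auto simp: span_singleton)
  have wU: "w = (k * l) *\<^sub>R U t" using l by (simp add: k U_def)
  have U1: "norm (U s) = 1" if "s \<in> D" for s
    using dist[OF that] l by (simp add: U_def dist_norm)
  have dU: "(U has_vector_derivative (1 / l) *\<^sub>R (v - w)) (at t)"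
    unfolding U_def by (intro bounded_linear.has_vector_derivative[OF bounded_linear_scaleR_right]
        has_vector_derivative_diff X m)
  have "((\<lambda>s. U s \<bullet> U s) has_vector_derivative U t \<bullet> ((1 / l) *\<^sub>R (v - w)) + ((1 / l) *\<^sub>R (v - w)) \<bullet> U t) (at t)"
    by (rule bounded_bilinear.has_vector_derivative[OF bounded_bilinear_inner dU dU])
  then have "((\<lambda>s. 1) has_vector_derivative U t \<bullet> ((1 / l) *\<^sub>R (v - w)) + ((1 / l) *\<^sub>R (v - w)) \<bullet> U t) (at t)"
    by (rule has_vector_derivative_transform_within_open[OF _ D]) (use U1 in \<open>simp add: norm_eq_1\<close>)
  then have "U t \<bullet> ((1 / l) *\<^sub>R (v - w)) + ((1 / l) *\<^sub>R (v - w)) \<bullet> U t = 0"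
    using vector_derivative_unique_at has_vector_derivative_const by blast
  then have "(v - w) \<bullet> U t = 0" using l by (simp add: inner_commute)
  then have "v \<bullet> U t = k * l" using U1[OF D(2)] by (simp add: wU inner_diff_left norm_eq_1)
  with orthonormal_expansion[OF U1[OF D(2)], of v]
  have "v - w = (v \<bullet> rot90 (U t)) *\<^sub>R rot90 (U t)" by (simp add: wU algebra_simps)
  with dU show ?thesis by simp
qed

text \<open>
  If the speed differed from \<open>1\<close> at a point where it is continuous, it would be bounded away from \<open>1\<close>, on one
  side, on a short interval around it, whose length would then be wrong.
\<close>

lemma speed_one_of_length:
  assumes len: "\<And>s t. a \<le> s \<Longrightarrow> s \<le> t \<Longrightarrow> t \<le> b \<Longrightarrow> curve_length s t \<gamma> = ennreal (t - s)"
    and D: "open D" "D \<subseteq> {a..b}" "t \<in> D"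
    and der: "\<And>s. s \<in> D \<Longrightarrow> (tip \<circ> \<gamma> has_vector_derivative v s) (at s)"
    and v: "continuous_on D v"
  shows "norm (v t) = 1"
proof -
  have cont: "isCont (\<lambda>s. norm (v s)) t"
    using v D by (simp add: continuous_on_eq_continuous_at continuous_norm)
  have nbhd: "\<exists>\<delta>>0. {t - \<delta>..t + \<delta>} \<subseteq> D \<and> (\<forall>s\<in>{t - \<delta>..t + \<delta>}. \<bar>norm (v s) - norm (v t)\<bar> \<le> e)"
    if "e > 0" for e
  proof -
    obtain r where r: "r > 0" "cball t r \<subseteq> D" using D open_contains_cball by blast
    obtain d where d: "d > 0" "\<And>s. dist s t < d \<Longrightarrow> dist (norm (v s)) (norm (v t)) < e"
      using cont \<open>e > 0\<close> unfolding continuous_at_eps_delta by blast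
    define \<delta> where "\<delta> = min r (d / 2)"
    have "\<delta> > 0" "\<delta> \<le> r" "\<delta> < d" using r d by (auto simp: \<delta>_def min_def)
    moreover have "{t - \<delta>..t + \<delta>} \<subseteq> D" using \<open>\<delta> \<le> r\<close> r(2) by (auto simp: cball_def dist_real_def subset_iff)
    moreover have "\<bar>norm (v s) - norm (v t)\<bar> \<le> e" if "s \<in> {t - \<delta>..t + \<delta>}" for s
    proof -
      have "dist s t < d" using that \<open>\<delta> < d\<close> by (auto simp: dist_real_def abs_if)
      from d(2)[OF this] show ?thesis by (simp add: dist_real_def)
    qed
    ultimately show ?thesis by blast
  qed
  have const: "(\<integral>\<^sup>+ s\<in>{u..w}. ennreal c \<partial>lborel) = ennreal (c * (w - u))" if "u \<le> w" "c \<ge> 0" for u w c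
    using that by (simp add: nn_integral_cmult_indicator ennreal_mult)
  have le: "curve_length u w \<gamma> \<le> ennreal (c * (w - u))"
    if "u \<le> w" "c \<ge> 0" "{u..w} \<subseteq> D" "\<And>s. s \<in> {u..w} \<Longrightarrow> norm (v s) \<le> c" for u w c
    unfolding const[OF that(1,2), symmetric] curve_length_def
    using that vector_derivative_at[OF der]
    by (intro nn_integral_mono) (auto split: split_indicator intro!: ennreal_leI)
  have ge: "curve_length u w \<gamma> \<ge> ennreal (c * (w - u))"
    if "u \<le> w" "c \<ge> 0" "{u..w} \<subseteq> D" "\<And>s. s \<in> {u..w} \<Longrightarrow> norm (v s) \<ge> c" for u w c
    unfolding const[OF that(1,2), symmetric] curve_length_def
    using that vector_derivative_at[OF der]
    by (intro nn_integral_mono) (auto split: split_indicator intro!: ennreal_leI)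
  show ?thesis
  proof (rule ccontr)
    assume "norm (v t) \<noteq> 1"
    define e where "e = \<bar>norm (v t) - 1\<bar> / 2"
    have "e > 0" using \<open>norm (v t) \<noteq> 1\<close> by (simp add: e_def)
    from nbhd[OF this] obtain \<delta> where \<delta>: "\<delta> > 0" "{t - \<delta>..t + \<delta>} \<subseteq> D"
      "\<And>s. s \<in> {t - \<delta>..t + \<delta>} \<Longrightarrow> \<bar>norm (v s) - norm (v t)\<bar> \<le> e" by blast
    have sub: "t - \<delta> \<in> D" "t + \<delta> \<in> D" using \<delta> by auto
    then have L: "curve_length (t - \<delta>) (t + \<delta>) \<gamma> = ennreal (2 * \<delta>)"
      using len[of "t - \<delta>" "t + \<delta>"] D(2) \<delta>(1) by (auto simp: subset_iff)
    show False
    proof (cases "norm (v t) > 1")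
      case True
      have "norm (v s) \<ge> 1 + e" if "s \<in> {t - \<delta>..t + \<delta>}" for s
        using \<delta>(3)[OF that] True by (simp add: e_def field_simps abs_if split: if_splits)
      then have "ennreal ((1 + e) * (2 * \<delta>)) \<le> ennreal (2 * \<delta>)"
        using ge[of "t - \<delta>" "t + \<delta>" "1 + e"] \<delta>(1,2) \<open>e > 0\<close> L by simp
      then show False using \<delta>(1) \<open>e > 0\<close> by (simp add: algebra_simps)
    next
      case False
      then have "norm (v t) < 1" using \<open>norm (v t) \<noteq> 1\<close> by simp
      moreover have "norm (v s) \<le> 1 - e" if "s \<in> {t - \<delta>..t + \<delta>}" for s
        using \<delta>(3)[OF that] calculation by (simp add: e_def field_simps abs_if split: if_splits)
      moreover have "\<bar>norm (v t) - 1\<bar> < 2" using \<open>norm (v t) < 1\<close> norm_ge_zero[of "v t"] by linarith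
      then have "e < 1" by (simp add: e_def)
      ultimately have "ennreal (2 * \<delta>) \<le> ennreal ((1 - e) * (2 * \<delta>))"
        using le[of "t - \<delta>" "t + \<delta>" "1 - e"] \<delta>(1,2) L by simp
      then have "2 * \<delta> \<le> (1 - e) * (2 * \<delta>)"
        using \<open>e < 1\<close> \<delta>(1) by (subst (asm) ennreal_le_iff) auto
      moreover have "e * \<delta> > 0" using \<delta>(1) \<open>e > 0\<close> by simp
      ultimately show False by (simp add: algebra_simps)
    qed
  qed
qed

text \<open>
  With \<open>U\<close> and \<open>W\<close> the directions of the two segments, the controls are the components of the tip
  velocity in the frame of \<open>U\<close>. The angle \<open>\<alpha>\<close> is obtained by integrating its derivative, and
  agrees with the direction \<open>U\<close> because the inner product of the two unit vectors is constant. The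
  cotangent of the half angle is \<open>B / (1 - A)\<close>, where \<open>A\<close> and \<open>B\<close> are the cosine and sine of the
  angle from \<open>U\<close> to \<open>W\<close>, and \<open>A \<noteq> 1\<close> says that the feet differ.
\<close>

lemma horizontal_imp_steered:
  assumes l: "l > 0" and ab: "a < b" and hor: "horizontal_on l l a b \<gamma>"
    and len: "\<And>s t. a \<le> s \<Longrightarrow> s \<le> t \<Longrightarrow> t \<le> b \<Longrightarrow> curve_length s t \<gamma> = ennreal (t - s)"
  obtains S p q x1 x2 \<alpha> y where "steered l a b S p q x1 x2 \<alpha> y"
    and "\<And>t. t \<in> {a..b} \<Longrightarrow> steered.curve l x1 x2 \<alpha> y t = \<gamma> t"
    and "\<And>t. t \<in> {a<..<b} - S \<Longrightarrow> (p t)\<^sup>2 + (q t)\<^sup>2 = 1"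
proof -
  obtain S Dv where S: "finite S" and cont: "continuous_on {a..b} \<gamma>"
    and dv: "\<And>t. t \<in> {a..b} - S \<Longrightarrow> (\<gamma> has_vector_derivative Dv t) (at t)"
    and cdv: "continuous_on ({a..b} - S) Dv"
    using hor unfolding horizontal_on_def piecewise_C1_differentiable_on_def C1_differentiable_on_def by blast
  define D where "D = {a<..<b} - S"
  have opD: "open D" using S by (simp add: D_def finite_imp_closed open_Diff)
  have subD: "D \<subseteq> {a..b}" "D \<subseteq> {a..b} - S" by (auto simp: D_def)
  define X where "X = (\<lambda>t. fst (\<gamma> t))"
  define m1 where "m1 = (\<lambda>t. fst (snd (\<gamma> t)))"
  define m2 where "m2 = (\<lambda>t. snd (snd (\<gamma> t)))"
  have \<gamma>: "\<gamma> t = (X t, m1 t, m2 t)" for t by (simp add: X_def m1_def m2_def)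
  have cX: "continuous_on {a..b} X" "continuous_on {a..b} m1" "continuous_on {a..b} m2"
    unfolding X_def m1_def m2_def by (intro continuous_intros cont)+
  define v where "v t = fst (Dv t)" for t
  have dX: "(X has_vector_derivative v t) (at t)" 
    and dm1: "(m1 has_vector_derivative fst (snd (Dv t))) (at t)"
    and dm2: "(m2 has_vector_derivative snd (snd (Dv t))) (at t)" if "t \<in> D" for t
    using dv[of t] that subD unfolding X_def m1_def m2_def v_def
    by (auto intro!: bounded_linear.has_vector_derivative[OF bounded_linear_fst]
          bounded_linear.has_vector_derivative[OF bounded_linear_snd])
  have cv: "continuous_on D v"
    unfolding v_def by (intro continuous_intros continuous_on_subset[OF cdv subD(2)])
  have v1: "norm (v t) = 1" if "t \<in> D" for t
    by (rule speed_one_of_length[OF len opD subD(1) that _ cv]) (use dX in \<open>auto simp: X_def o_def\<close>)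
  have conf: "dist (X t) (m1 t) = l" "dist (X t) (m2 t) = l" "m1 t \<noteq> m2 t" if "t \<in> {a..b}" for t
  proof -
    have "\<gamma> t \<in> config_space l l" using hor that unfolding horizontal_on_def by blast
    then show "dist (X t) (m1 t) = l" "dist (X t) (m2 t) = l" "m1 t \<noteq> m2 t"
      unfolding config_space_def X_def m1_def m2_def by auto
  qed
  have span: "fst (snd (Dv t)) \<in> span {X t - m1 t}" "snd (snd (Dv t)) \<in> span {X t - m2 t}" if t: "t \<in> D" for t
  proof -
    have "\<gamma> differentiable (at t)" using dv t subD(2) by (blast intro: differentiableI_vector)
    moreover have "t \<in> {a<..<b}" using t by (simp add: D_def)
    ultimately have "vector_derivative (foot1 \<circ> \<gamma>) (at t) \<in> span {X t - m1 t}"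
      "vector_derivative (foot2 \<circ> \<gamma>) (at t) \<in> span {X t - m2 t}"
      using hor unfolding horizontal_on_def X_def m1_def m2_def by auto
    moreover have "foot1 \<circ> \<gamma> = m1" "foot2 \<circ> \<gamma> = m2" by (auto simp: m1_def m2_def)
    ultimately show "fst (snd (Dv t)) \<in> span {X t - m1 t}" "snd (snd (Dv t)) \<in> span {X t - m2 t}"
      using vector_derivative_at[OF dm1[OF t]] vector_derivative_at[OF dm2[OF t]] by simp_all
  qed
  define U where "U = (\<lambda>t. (1 / l) *\<^sub>R (X t - m1 t))"
  define W where "W = (\<lambda>t. (1 / l) *\<^sub>R (X t - m2 t))"
  have dU: "(U has_vector_derivative ((v t \<bullet> rot90 (U t)) / l) *\<^sub>R rot90 (U t)) (at t)"
    and dW: "(W has_vector_derivative ((v t \<bullet> rot90 (W t)) / l) *\<^sub>R rot90 (W t)) (at t)" if t: "t \<in> D" for t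
    unfolding U_def W_def
    by (rule segment_direction_derivative[OF l opD t _ dX[OF t] dm1[OF t] span(1)[OF t]],
        use conf subD in blast)
       (rule segment_direction_derivative[OF l opD t _ dX[OF t] dm2[OF t] span(2)[OF t]],
        use conf subD in blast)
  define c s w1 w2 v1' v2' where "c = (\<lambda>t. U t $ 1)" and "s = (\<lambda>t. U t $ 2)"
    and "w1 = (\<lambda>t. W t $ 1)" and "w2 = (\<lambda>t. W t $ 2)"
    and "v1' = (\<lambda>t. v t $ 1)" and "v2' = (\<lambda>t. v t $ 2)"
  note comp = c_def s_def w1_def w2_def v1'_def v2'_def
  define p where "p = (\<lambda>t. v1' t * c t + v2' t * s t)"
  define q where "q = (\<lambda>t. v2' t * c t - v1' t * s t)"
  define q2 where "q2 = (\<lambda>t. v2' t * w1 t - v1' t * w2 t)"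
  have rr: "v t \<bullet> rot90 (U t) = q t" "v t \<bullet> rot90 (W t) = q2 t" for t
    by (simp_all add: q_def q2_def comp rot90_def inner_vec_def sum_2)
  have cs1: "c t * c t + s t * s t = 1" "w1 t * w1 t + w2 t * w2 t = 1" if "t \<in> {a..b}" for t
  proof -
    have "norm (U t) = 1" "norm (W t) = 1" using conf[OF that] l by (simp_all add: U_def W_def dist_norm)
    then show "c t * c t + s t * s t = 1" "w1 t * w1 t + w2 t * w2 t = 1"
      by (simp_all add: norm_eq_1 comp inner_vec_def sum_2)
  qed
  have vv: "v1' t * v1' t + v2' t * v2' t = 1" if "t \<in> D" for t
    using v1[OF that] by (simp add: norm_eq_1 comp inner_vec_def sum_2)
  have pq: "(p t)\<^sup>2 + (q t)\<^sup>2 = 1" if "t \<in> D" for t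
  proof -
    have "t \<in> {a..b}" using that subD by blast
    from vv[OF that] cs1(1)[OF this] show ?thesis unfolding p_def q_def by algebra
  qed
  have dc: "(c has_real_derivative - (q t / l) * s t) (at t)" and ds: "(s has_real_derivative (q t / l) * c t) (at t)"
    and dw1: "(w1 has_real_derivative - (q2 t / l) * w2 t) (at t)" and dw2: "(w2 has_real_derivative (q2 t / l) * w1 t) (at t)"
    if "t \<in> D" for t
    using has_vector_derivative_nth[OF dU[OF that], of 1] has_vector_derivative_nth[OF dU[OF that], of 2]
      has_vector_derivative_nth[OF dW[OF that], of 1] has_vector_derivative_nth[OF dW[OF that], of 2]
    unfolding rr by (simp_all add: comp rot90_nth)
  have cc: "continuous_on {a..b} c" "continuous_on {a..b} s" "continuous_on {a..b} w1" "continuous_on {a..b} w2"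
    unfolding comp U_def W_def by (intro continuous_intros cX)+
  have cvv: "continuous_on D v1'" "continuous_on D v2'"
    unfolding comp by (intro continuous_intros cv)+
  have "continuous_on D p" "continuous_on D q"
    unfolding p_def q_def by (intro continuous_intros cvv continuous_on_subset[OF cc(1) subD(1)] continuous_on_subset[OF cc(2) subD(1)])+
  moreover have "\<bar>p t\<bar> \<le> 1 \<and> \<bar>q t\<bar> \<le> 1" if "t \<in> D" for t
    using pq[OF that] by (metis abs_square_le_1 add_increasing add_increasing2 dual_order.refl zero_le_power2)
  then have "bounded (p ` D)" "bounded (q ` D)" unfolding bounded_iff by auto
  ultimately have pw: "pw_continuous a b S p" "pw_continuous a b S q"
    using S by (simp_all add: pw_continuous_def D_def)
  obtain \<alpha>0 where \<alpha>0: "c a = cos \<alpha>0" "s a = sin \<alpha>0"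
    using sincos_total_2pi[of "c a" "s a"] cs1(1)[of a] ab by (auto simp: power2_eq_square)
  define \<alpha> where "\<alpha> = (\<lambda>t. \<alpha>0 + integral {a..t} q / l)"
  have c\<alpha>: "continuous_on {a..b} \<alpha>"
    unfolding \<alpha>_def using l by (intro continuous_intros pw_continuous_antiderivative(1)[OF pw(2)]) auto
  have d\<alpha>: "(\<alpha> has_real_derivative q t / l) (at t)" if "t \<in> D" for t
  proof -
    have "((\<lambda>t. integral {a..t} q) has_real_derivative q t) (at t)"
      unfolding has_real_derivative_iff_has_vector_derivative
      using that by (intro pw_continuous_antiderivative(2)[OF pw(2)]) (simp add: D_def)
    from DERIV_add[OF DERIV_const DERIV_cdivide[OF this]] show ?thesis by (simp add: \<alpha>_def)
  qed
  have cs\<alpha>: "c t = cos (\<alpha> t)" "s t = sin (\<alpha> t)" if t: "t \<in> {a..b}" for t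
  proof -
    have "(\<lambda>t. c t * cos (\<alpha> t) + s t * sin (\<alpha> t)) t = (\<lambda>t. c t * cos (\<alpha> t) + s t * sin (\<alpha> t)) a"
    proof (rule derivative_zero_imp_constant[OF S _ _ t])
      show "continuous_on {a..b} (\<lambda>t. c t * cos (\<alpha> t) + s t * sin (\<alpha> t))"
        by (intro continuous_intros cc c\<alpha>)
      fix \<tau> assume "\<tau> \<in> {a<..<b} - S"
      then have \<tau>: "\<tau> \<in> D" by (simp add: D_def)
      show "((\<lambda>t. c t * cos (\<alpha> t) + s t * sin (\<alpha> t)) has_vector_derivative 0) (at \<tau>)"
        unfolding has_real_derivative_iff_has_vector_derivative[symmetric]
        by (auto intro!: derivative_eq_intros dc[OF \<tau>] ds[OF \<tau>] d\<alpha>[OF \<tau>] simp: algebra_simps)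
    qed
    moreover have "\<alpha> a = \<alpha>0" by (simp add: \<alpha>_def)
    ultimately have "c t * cos (\<alpha> t) + s t * sin (\<alpha> t) = 1"
      using \<alpha>0 sin_cos_squared_add[of \<alpha>0] by (simp add: power2_eq_square)
    moreover have "sin (\<alpha> t) * sin (\<alpha> t) + cos (\<alpha> t) * cos (\<alpha> t) = 1"
      using sin_cos_squared_add[of "\<alpha> t"] by (simp add: power2_eq_square)
    moreover have "(c t - cos (\<alpha> t))\<^sup>2 + (s t - sin (\<alpha> t))\<^sup>2 = (c t * c t + s t * s t)
         + (sin (\<alpha> t) * sin (\<alpha> t) + cos (\<alpha> t) * cos (\<alpha> t)) - 2 * (c t * cos (\<alpha> t) + s t * sin (\<alpha> t))"
      by (simp add: power2_eq_square algebra_simps)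
    ultimately have "(c t - cos (\<alpha> t))\<^sup>2 + (s t - sin (\<alpha> t))\<^sup>2 = 0" using cs1(1)[OF t] by simp
    then show "c t = cos (\<alpha> t)" "s t = sin (\<alpha> t)" by (auto simp: sum_power2_eq_zero_iff)
  qed
  define A where "A = (\<lambda>t. w1 t * c t + w2 t * s t)"
  define B where "B = (\<lambda>t. w2 t * c t - w1 t * s t)"
  define y where "y = (\<lambda>t. B t / (1 - A t))"
  have AB: "A t * A t + B t * B t = 1" if "t \<in> {a..b}" for t
    using cs1[OF that] unfolding A_def B_def by algebra
  have A1: "A t \<noteq> 1" if t: "t \<in> {a..b}" for t
  proof
    assume "A t = 1"
    moreover have "(w1 t - c t)\<^sup>2 + (w2 t - s t)\<^sup>2 = (w1 t * w1 t + w2 t * w2 t) + (c t * c t + s t * s t) - 2 * A t"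
      by (simp add: A_def power2_eq_square algebra_simps)
    ultimately have "w1 t = c t" "w2 t = s t" using cs1[OF t] by (auto simp: sum_power2_eq_zero_iff)
    then have "W t = U t" by (simp add: comp vec_eq_iff forall_2)
    then show False using conf(3)[OF t] l by (simp add: U_def W_def)
  qed
  have cA: "continuous_on {a..b} A" "continuous_on {a..b} B"
    unfolding A_def B_def by (intro continuous_intros cc)+
  have cy: "continuous_on {a..b} y"
    unfolding y_def using A1 by (intro continuous_intros cA) force
  have dy: "(y has_real_derivative (p t * y t + q t) / l) (at t)" if t: "t \<in> D" for t
  proof -
    have tab: "t \<in> {a..b}" using t subD by blast
    have q2: "q2 t = q t * A t - p t * B t"
      using cs1(1)[OF tab] unfolding q2_def q_def p_def A_def B_def by algebra
    have dA: "(A has_real_derivative (q t - q2 t) * B t / l) (at t)"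
      unfolding A_def B_def using l
      by (auto intro!: derivative_eq_intros dc[OF t] ds[OF t] dw1[OF t] dw2[OF t] simp: field_simps)
    have dB: "(B has_real_derivative (q2 t - q t) * A t / l) (at t)"
      unfolding A_def B_def using l
      by (auto intro!: derivative_eq_intros dc[OF t] ds[OF t] dw1[OF t] dw2[OF t] simp: field_simps)
    have n0: "1 - A t \<noteq> 0" using A1[OF tab] by simp
    have "(y has_real_derivative ((q2 t - q t) * A t / l * (1 - A t) - B t * (0 - (q t - q2 t) * B t / l)) / ((1 - A t) * (1 - A t))) (at t)"
      unfolding y_def by (rule DERIV_divide[OF dB DERIV_diff[OF DERIV_const dA] n0])
    moreover have "((q2 t - q t) * A t / l * (1 - A t) - B t * (0 - (q t - q2 t) * B t / l)) / ((1 - A t) * (1 - A t))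
        = (p t * y t + q t) / l"
    proof -
      define N where "N = 1 - A t"
      have N: "N \<noteq> 0" using n0 by (simp add: N_def)
      have key: "(q2 t - q t) * A t * N + B t * ((q t - q2 t) * B t) = (p t * B t + q t * N) * N"
        using AB[OF tab] unfolding q2 N_def by algebra
      have "(q2 t - q t) * A t / l * N - B t * (0 - (q t - q2 t) * B t / l)
          = ((q2 t - q t) * A t * N + B t * ((q t - q2 t) * B t)) / l"
        using l by (simp add: field_simps)
      also have "\<dots> / (N * N) = (p t * (B t / N) + q t) / l"
        unfolding key using N l by (simp add: field_simps)
      finally show ?thesis unfolding y_def N_def .
    qed
    ultimately show ?thesis by simp
  qed
  have st: "steered l a b S p q (\<lambda>t. X t $ 1) (\<lambda>t. X t $ 2) \<alpha> y"
  proof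
    fix t assume "t \<in> {a<..<b} - S"
    then have t: "t \<in> D" by (simp add: D_def)
    then have tab: "t \<in> {a..b}" using subD by blast
    have e: "v1' t = p t * cos (\<alpha> t) - q t * sin (\<alpha> t)" "v2' t = p t * sin (\<alpha> t) + q t * cos (\<alpha> t)"
      unfolding cs\<alpha>[OF tab, symmetric] p_def q_def using cs1(1)[OF tab] by algebra+
    show "((\<lambda>t. X t $ 1) has_real_derivative p t * cos (\<alpha> t) - q t * sin (\<alpha> t)) (at t)"
      "((\<lambda>t. X t $ 2) has_real_derivative p t * sin (\<alpha> t) + q t * cos (\<alpha> t)) (at t)"
      using has_vector_derivative_nth[OF dX[OF t], of 1] has_vector_derivative_nth[OF dX[OF t], of 2] e
      by (simp_all only: comp)
    show "(\<alpha> has_real_derivative q t / l) (at t)" by (rule d\<alpha>[OF t])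
    show "(y has_real_derivative (p t * y t + q t) / l) (at t)" by (rule dy[OF t])
  qed (use l ab pw c\<alpha> cy in \<open>auto intro!: continuous_intros cX\<close>)
  show ?thesis
  proof (rule that[OF st])
    show "(p t)\<^sup>2 + (q t)\<^sup>2 = 1" if "t \<in> {a<..<b} - S" for t using pq that by (simp add: D_def)
    fix t assume t: "t \<in> {a..b}"
    have n0: "1 - A t \<noteq> 0" using A1[OF t] by simp
    have "second_dir (\<alpha> t) (y t) = W t"
    proof -
      have y1: "((y t)\<^sup>2 + 1) * (1 - A t) = 2"
      proof -
        have "((y t)\<^sup>2 + 1) * (1 - A t) * (1 - A t) = 2 * (1 - A t)"
        proof -
          have yB: "y t * (1 - A t) = B t" using n0 by (simp add: y_def)
          have "((y t)\<^sup>2 + 1) * (1 - A t) * (1 - A t) = (y t * (1 - A t)) * (y t * (1 - A t)) + (1 - A t) * (1 - A t)"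
            by (simp add: algebra_simps power2_eq_square)
          also have "\<dots> = (A t * A t + B t * B t) + 1 - 2 * A t" unfolding yB by (simp add: algebra_simps)
          finally show ?thesis using AB[OF t] by simp
        qed
        then show ?thesis using mult_right_cancel[OF n0] by blast
      qed
      have y2: "2 * y t = B t * ((y t)\<^sup>2 + 1)"
      proof -
        have yB: "B t = y t * (1 - A t)" using n0 by (simp add: y_def)
        have "B t * ((y t)\<^sup>2 + 1) = y t * (((y t)\<^sup>2 + 1) * (1 - A t))"
          unfolding yB by (simp add: algebra_simps)
        then show ?thesis using y1 by simp
      qed
      have y3: "(y t)\<^sup>2 - 1 = A t * ((y t)\<^sup>2 + 1)" using y1 by (simp add: algebra_simps)
      have "A t * c t - B t * s t = w1 t * (c t * c t + s t * s t)"
        "A t * s t + B t * c t = w2 t * (c t * c t + s t * s t)"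
        unfolding A_def B_def by algebra+
      then have w: "w1 t = A t * c t - B t * s t" "w2 t = A t * s t + B t * c t"
        using cs1(1)[OF t] by simp_all
      have "((y t)\<^sup>2 - 1) * cos (\<alpha> t) - 2 * y t * sin (\<alpha> t) = w1 t * ((y t)\<^sup>2 + 1)"
        "((y t)\<^sup>2 - 1) * sin (\<alpha> t) + 2 * y t * cos (\<alpha> t) = w2 t * ((y t)\<^sup>2 + 1)"
        unfolding cs\<alpha>[OF t, symmetric] y2 y3 w by (simp_all add: algebra_simps)
      then show ?thesis
        unfolding second_dir_def by (simp add: vec_eq_iff forall_2 comp y2_pos)
    qed
    moreover have "vec2 (cos (\<alpha> t)) (sin (\<alpha> t)) = U t"
      by (simp add: vec_eq_iff forall_2 comp cs\<alpha>[OF t, symmetric])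
    moreover have "vec2 (X t $ 1) (X t $ 2) = X t" by (simp add: vec_eq_iff forall_2)
    ultimately show "steered.curve l (\<lambda>t. X t $ 1) (\<lambda>t. X t $ 2) \<alpha> y t = \<gamma> t"
      unfolding steered.curve_def[OF st] chart_def \<gamma> using l by (simp add: U_def W_def)
  qed
qed

text \<open>
  Length and energy are tied by the bound on the length of a steered curve, which is sharp for
  the given curve because its speed is \<open>1\<close>.
\<close>

lemma (in steered) minimizer_multiplier:
  assumes min: "\<And>\<sigma>. horizontal_on l l a b \<sigma> \<Longrightarrow> \<sigma> a = curve a \<Longrightarrow> \<sigma> b = curve b \<Longrightarrow>
      ennreal (b - a) \<le> curve_length a b \<sigma>"
    and unit: "\<And>t. t \<in> {a<..<b} - S \<Longrightarrow> (p t)\<^sup>2 + (q t)\<^sup>2 = 1"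
  shows "\<exists>h. h \<noteq> 0 \<and> (\<forall>t\<in>{a<..<b} - S. h \<bullet> P t = 0 \<and> h \<bullet> Q t = 0)"
proof (rule multiplier_rule)
  fix s assume eq: "snd (end_map s) = snd (end_map 0)"
  interpret var: steered l a b S "ps s" "qs s" "x1s s" "x2s s" "\<alpha>s s" "ys s"
    by (rule steered_variation)
  have "((\<lambda>t. ((p t)\<^sup>2 + (q t)\<^sup>2) / 2) has_integral (b - a) / 2) {a..b}"
  proof (rule has_integral_spike_finite[of "S \<union> {a,b}" _ _ "\<lambda>t. 1 / 2"])
    show "((\<lambda>t. 1 / 2) has_integral (b - a) / 2) {a..b}"
      using has_integral_const_real[of "1/2 :: real" a b] ab by simp
  qed (use finS unit in auto)
  from integral_unique[OF this] have e0: "fst (end_map 0) = (b - a) / 2" by (simp only: end_map_0 fst_conv)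
  have "var.curve a = curve a" "var.curve b = curve b"
    using eq by (simp_all add: var.curve_def curve_def variation_start end_map_0) (simp add: end_map_def)
  then have "ennreal (b - a) \<le> curve_length a b var.curve"
    by (intro min var.horizontal)
  also have "\<dots> \<le> ennreal (integral {a..b} (\<lambda>t. (1 + ((ps s t)\<^sup>2 + (qs s t)\<^sup>2)) / 2))"
    by (rule var.curve_length_le)
  also have "integral {a..b} (\<lambda>t. (1 + ((ps s t)\<^sup>2 + (qs s t)\<^sup>2)) / 2) = (b - a) / 2 + fst (end_map s)"
  proof -
    have "pw_continuous a b S (\<lambda>t. (1 / 2) * (ps s t * ps s t + qs s t * qs s t))"
      by (intro pw_continuous_intros pw_ps pw_qs pw_of_cont continuous_intros)
    from pw_continuous_integrable[OF this]
    have i: "(\<lambda>t. ((ps s t)\<^sup>2 + (qs s t)\<^sup>2) / 2) integrable_on {a..b}" by (simp add: power2_eq_square)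
    have "((\<lambda>t. 1 / 2 + ((ps s t)\<^sup>2 + (qs s t)\<^sup>2) / 2) has_integral (b - a) / 2 + fst (end_map s)) {a..b}"
      using has_integral_const_real[of "1/2 :: real" a b] ab integrable_integral[OF i]
      by (intro has_integral_add) (simp_all add: end_map_def)
    then show ?thesis by (simp add: add_divide_distrib integral_unique)
  qed
  finally have le: "ennreal (b - a) \<le> ennreal ((b - a) / 2 + fst (end_map s))" .
  have "fst (end_map s) \<ge> 0"
    unfolding end_map_def by (cases "(\<lambda>t. ((ps s t)\<^sup>2 + (qs s t)\<^sup>2) / 2) integrable_on {a..b}")
      (auto intro!: integral_nonneg simp: not_integrable_integral)
  then have "b - a \<le> (b - a) / 2 + fst (end_map s)"
    using le ab by (subst (asm) ennreal_le_iff) auto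
  then show "fst (end_map 0) \<le> fst (end_map s)" unfolding e0 by (simp add: field_simps)
qed

section \<open>Extremals are elastic\<close>

context steered
begin

lemma dom_nonempty: "\<exists>t. t \<in> {a<..<b} - S"
  using ab finS by (metis Diff_infinite_finite all_not_in_conv finite.emptyI infinite_Ioo)

lemma zero_on_dom_imp_zero:
  fixes f :: "real \<Rightarrow> real"
  assumes cont: "continuous_on {a..b} f" and Z: "\<And>t. t \<in> {a<..<b} - S \<Longrightarrow> f t = 0" and t: "t \<in> {a..b}"
  shows "f t = 0"
proof -
  have const: "f s = f a" if "s \<in> {a..b}" for s
  proof (rule derivative_zero_imp_constant[OF finS cont _ that])
    fix r assume r: "r \<in> {a<..<b} - S"
    show "(f has_vector_derivative 0) (at r)"
      by (rule has_vector_derivative_transform_within_open[OF has_vector_derivative_const open_dom r])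
         (simp add: Z)
  qed
  obtain r where r: "r \<in> {a<..<b} - S" using dom_nonempty by blast
  then have "f a = 0" using const[of r] Z[OF r] by auto
  then show ?thesis using const[OF t] by simp
qed

lemma tendsto_of_continuous:
  assumes "continuous_on {a..b} g" "t \<in> {a..b}"
  shows "(g \<longlongrightarrow> g t) (at t within {a<..<b} - S)"
proof (rule tendsto_within_subset)
  show "(g \<longlongrightarrow> g t) (at t within {a..b})" using assms by (simp add: continuous_on_def)
qed auto

lemma derivative_everywhere:
  fixes f g :: "real \<Rightarrow> real"
  assumes "continuous_on {a..b} f" "continuous_on {a..b} g"
    and "\<And>t. t \<in> {a<..<b} - S \<Longrightarrow> (f has_real_derivative g t) (at t)" and "t \<in> {a..b}"
  shows "(f has_real_derivative g t) (at t within {a..b})"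
  unfolding has_real_derivative_iff_has_vector_derivative
  by (rule has_vector_derivative_limit[OF finS assms(1,4) _ tendsto_of_continuous[OF assms(2,4)]])
     (use assms(3) in \<open>simp add: has_real_derivative_iff_has_vector_derivative\<close>)

lemma const_of_derivative_zero:
  fixes f :: "real \<Rightarrow> real"
  assumes "continuous_on {a..b} f" "\<And>t. t \<in> {a<..<b} - S \<Longrightarrow> (f has_real_derivative 0) (at t)"
    and "s \<in> {a..b}" "t \<in> {a..b}"
  shows "f s = f t"
  using derivative_zero_imp_constant[OF finS assms(1) _ assms(3)]
    derivative_zero_imp_constant[OF finS assms(1) _ assms(4)] assms(2)
  by (simp add: has_real_derivative_iff_has_vector_derivative)

lemma at_dom: "t \<in> {a<..<b} - S \<Longrightarrow> at t within {a..b} = at t"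
  by (simp add: at_within_Icc_at)

text \<open>
  The classical characterization of elastic curves: the curvature is an affine function of the
  position. Then the second derivative of the curvature is \<open>\<kappa>\<close> times a linear form in the tangent, and
  that form plus \<open>\<kappa>\<^sup>2 / 2\<close> is conserved.

  The tangent \<open>(T1, T2)\<close> is assumed continuous on the whole interval and equal to the velocity off
  the exceptional set, which makes all derivatives exist at the exceptional points too.
\<close>

lemma affine_curvature_imp_elastic:
  assumes T: "continuous_on {a..b} T1" "continuous_on {a..b} T2"
    and vel: "\<And>t. t \<in> {a<..<b} - S \<Longrightarrow> T1 t = p t * cos (\<alpha> t) - q t * sin (\<alpha> t)"
             "\<And>t. t \<in> {a<..<b} - S \<Longrightarrow> T2 t = p t * sin (\<alpha> t) + q t * cos (\<alpha> t)"
    and unit: "\<And>t. t \<in> {a<..<b} - S \<Longrightarrow> (p t)\<^sup>2 + (q t)\<^sup>2 = 1"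
    and \<kappa>: "\<And>t. \<kappa> t = c0 + c1 * x1 t + c2 * x2 t"
    and dT: "\<And>t. t \<in> {a<..<b} - S \<Longrightarrow> (T1 has_real_derivative - \<kappa> t * T2 t) (at t)"
            "\<And>t. t \<in> {a<..<b} - S \<Longrightarrow> (T2 has_real_derivative \<kappa> t * T1 t) (at t)"
  shows "elastic_curve_on {a..b} (\<lambda>t. vec2 (x1 t) (x2 t))"
proof -
  let ?I = "{a..b}"
  have dx: "(x1 has_real_derivative T1 t) (at t within ?I)" "(x2 has_real_derivative T2 t) (at t within ?I)"
    if "t \<in> ?I" for t
    using dx1 dx2 vel by (auto intro!: derivative_everywhere cont T that)
  have c\<kappa>: "continuous_on ?I \<kappa>" unfolding \<kappa> by (intro continuous_intros cont)
  have dT': "(T1 has_real_derivative - \<kappa> t * T2 t) (at t within ?I)"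
    "(T2 has_real_derivative \<kappa> t * T1 t) (at t within ?I)" if "t \<in> ?I" for t
  proof -
    have "continuous_on ?I (\<lambda>t. - \<kappa> t * T2 t)" by (intro continuous_intros c\<kappa> T)
    from derivative_everywhere[OF T(1) this _ that] dT(1)
    show "(T1 has_real_derivative - \<kappa> t * T2 t) (at t within ?I)" by blast
    have "continuous_on ?I (\<lambda>t. \<kappa> t * T1 t)" by (intro continuous_intros c\<kappa> T)
    from derivative_everywhere[OF T(2) this _ that] dT(2)
    show "(T2 has_real_derivative \<kappa> t * T1 t) (at t within ?I)" by blast
  qed
  have d\<kappa>: "(\<kappa> has_real_derivative c1 * T1 t + c2 * T2 t) (at t within ?I)" if "t \<in> ?I" for t
    unfolding \<kappa>[abs_def] by (auto intro!: derivative_eq_intros dx[OF that])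
  define \<kappa>2 where "\<kappa>2 t = \<kappa> t * (c2 * T1 t - c1 * T2 t)" for t
  have d\<kappa>2: "((\<lambda>t. c1 * T1 t + c2 * T2 t) has_real_derivative \<kappa>2 t) (at t within ?I)" if "t \<in> ?I" for t
    unfolding \<kappa>2_def by (auto intro!: derivative_eq_intros dT'[OF that] simp: algebra_simps)
  define M where "M t = c2 * T1 t - c1 * T2 t + (1 / 2) * (\<kappa> t * \<kappa> t)" for t
  have M: "M t = M a" if "t \<in> ?I" for t
  proof (rule const_of_derivative_zero[OF _ _ that])
    show "continuous_on ?I M" unfolding M_def by (intro continuous_intros T c\<kappa>)
    fix r assume r: "r \<in> {a<..<b} - S"
    then have rI: "r \<in> ?I" by auto
    have "(M has_real_derivative 0) (at r within ?I)"
      unfolding M_def[abs_def]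
      by (auto intro!: derivative_eq_intros dT'[OF rI] d\<kappa>[OF rI] simp: algebra_simps)
    then show "(M has_real_derivative 0) (at r)" using at_dom[OF r] by simp
  qed (use ab in auto)
  have unitT: "T1 t * T1 t + T2 t * T2 t - 1 = 0" if "t \<in> ?I" for t
  proof (rule zero_on_dom_imp_zero[OF _ _ that])
    show "continuous_on ?I (\<lambda>t. T1 t * T1 t + T2 t * T2 t - 1)" by (intro continuous_intros T)
    fix r assume r: "r \<in> {a<..<b} - S"
    have "T1 r * T1 r + T2 r * T2 r = ((p r)\<^sup>2 + (q r)\<^sup>2) * ((sin (\<alpha> r))\<^sup>2 + (cos (\<alpha> r))\<^sup>2)"
      unfolding vel[OF r] by algebra
    then show "T1 r * T1 r + T2 r * T2 r - 1 = 0" using unit[OF r] by simp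
  qed
  show ?thesis
    unfolding elastic_curve_on_def
  proof (intro exI ballI conjI)
    fix t assume t: "t \<in> ?I"
    show "norm (vec2 (T1 t) (T2 t)) = 1" using unitT[OF t] by (simp add: norm_vec2 power2_eq_square)
    show "((\<lambda>t. vec2 (x1 t) (x2 t)) has_vector_derivative vec2 (T1 t) (T2 t)) (at t within ?I)"
      by (intro has_vector_derivative_vec2 dx t)
    have "((\<lambda>t. vec2 (T1 t) (T2 t)) has_vector_derivative vec2 (- \<kappa> t * T2 t) (\<kappa> t * T1 t)) (at t within ?I)"
      by (intro has_vector_derivative_vec2 dT' t)
    then show "((\<lambda>t. vec2 (T1 t) (T2 t)) has_vector_derivative \<kappa> t *\<^sub>R rot90 (vec2 (T1 t) (T2 t))) (at t within ?I)"
      by (simp add: vec2_arith)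
    show "(\<kappa> has_real_derivative c1 * T1 t + c2 * T2 t) (at t within ?I)" by (rule d\<kappa>[OF t])
    show "((\<lambda>t. c1 * T1 t + c2 * T2 t) has_real_derivative \<kappa>2 t) (at t within ?I)" by (rule d\<kappa>2[OF t])
    have \<kappa>2: "c2 * T1 t - c1 * T2 t = M a - (1 / 2) * (\<kappa> t * \<kappa> t)" using M[OF t] unfolding M_def[of t] by simp
    show "\<kappa>2 t + (1 / 2) * \<kappa> t ^ 3 + (- M a) * \<kappa> t = 0"
      unfolding \<kappa>2_def \<kappa>2 by (simp add: algebra_simps power3_eq_cube)
  qed
qed

text \<open>
  The multiplier rule expresses the controls through the state, so they extend continuously over
  the exceptional set. With \<open>k\<close> the normal component of the covector \<open>(c1, c2)\<close> plus
  \<open>\<eta> * weight\<close>, differentiating gives \<open>p' = q * k / l\<close> and \<open>q' = - p * k / l\<close>; the tangent therefore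
  turns at the rate \<open>(q - k) / l\<close>, and \<open>q - k\<close> is affine in the position.
\<close>

lemma normal_imp_elastic:
  assumes unit: "\<And>t. t \<in> {a<..<b} - S \<Longrightarrow> (p t)\<^sup>2 + (q t)\<^sup>2 = 1"
    and P: "\<And>t. t \<in> {a<..<b} - S \<Longrightarrow> p t = c1 * cos (\<alpha> t) + c2 * sin (\<alpha> t) + \<eta> * (weight t * y t)"
    and Q: "\<And>t. t \<in> {a<..<b} - S \<Longrightarrow> q t = c1 * (- sin (\<alpha> t) - (x2 b - x2 t) / l)
        + c2 * (cos (\<alpha> t) + (x1 b - x1 t) / l) + \<nu> / l + \<eta> * weight t"
  shows "elastic_curve_on {a..b} (\<lambda>t. vec2 (x1 t) (x2 t))"
proof -
  define p' where "p' t = c1 * cos (\<alpha> t) + c2 * sin (\<alpha> t) + \<eta> * (weight t * y t)" for t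
  define k where "k t = - c1 * sin (\<alpha> t) + c2 * cos (\<alpha> t) + \<eta> * weight t" for t
  define \<kappa> where "\<kappa> t = (\<nu> - c1 * x2 b + c2 * x1 b) / l\<^sup>2 + (- c2 / l\<^sup>2) * x1 t + (c1 / l\<^sup>2) * x2 t" for t
  define q' where "q' t = k t + l * \<kappa> t" for t
  have eq: "p' t = p t" "q' t = q t" if "t \<in> {a<..<b} - S" for t
    unfolding P[OF that] Q[OF that] p'_def q'_def k_def \<kappa>_def using l_pos
    by (simp_all add: field_simps power2_eq_square)
  have c\<kappa>: "continuous_on {a..b} \<kappa>" unfolding \<kappa>_def by (intro continuous_intros cont)
  have cpq: "continuous_on {a..b} p'" "continuous_on {a..b} q'"
    unfolding p'_def q'_def k_def by (intro continuous_intros cont cont_weight c\<kappa>)+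
  have dwy: "((\<lambda>t. weight t * y t) has_real_derivative weight t * q t / l) (at t)"
    if t: "t \<in> {a<..<b} - S" for t
    by (rule DERIV_cong[OF DERIV_mult[OF dweight[OF t] dy[OF t]]]) (use l_pos in \<open>simp add: field_simps\<close>)
  have dp': "(p' has_real_derivative q t * k t / l) (at t)" if t: "t \<in> {a<..<b} - S" for t
    unfolding p'_def k_def
    by (rule derivative_eq_intros d\<alpha>[OF t] dwy[OF t] refl)+ (use l_pos in \<open>simp add: field_simps\<close>)
  have d\<kappa>: "(\<kappa> has_real_derivative (- c2 / l\<^sup>2) * (p t * cos (\<alpha> t) - q t * sin (\<alpha> t))
        + (c1 / l\<^sup>2) * (p t * sin (\<alpha> t) + q t * cos (\<alpha> t))) (at t)"
    if t: "t \<in> {a<..<b} - S" for t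
    unfolding \<kappa>_def by (rule derivative_eq_intros dx1[OF t] dx2[OF t] refl)+ (simp add: mult.commute)
  have dq': "(q' has_real_derivative - p t * k t / l) (at t)" if t: "t \<in> {a<..<b} - S" for t
    unfolding q'_def k_def
    apply (rule derivative_eq_intros d\<alpha>[OF t] dweight[OF t] d\<kappa>[OF t] refl)+
    using l_pos by (simp add: field_simps power2_eq_square)
  show ?thesis
  proof (rule affine_curvature_imp_elastic[of "\<lambda>t. p' t * cos (\<alpha> t) - q' t * sin (\<alpha> t)"
        "\<lambda>t. p' t * sin (\<alpha> t) + q' t * cos (\<alpha> t)" \<kappa>
        "(\<nu> - c1 * x2 b + c2 * x1 b) / l\<^sup>2" "- c2 / l\<^sup>2" "c1 / l\<^sup>2"])
    fix t assume t: "t \<in> {a<..<b} - S"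
    have ql: "q t = k t + l * \<kappa> t" using eq(2)[OF t] by (simp add: q'_def)
    show "((\<lambda>t. p' t * cos (\<alpha> t) - q' t * sin (\<alpha> t)) has_real_derivative
        - \<kappa> t * (p' t * sin (\<alpha> t) + q' t * cos (\<alpha> t))) (at t)"
      apply (rule derivative_eq_intros dp'[OF t] dq'[OF t] d\<alpha>[OF t] refl)+
      unfolding eq[OF t] using l_pos
      apply (simp add: field_simps)
      using ql by algebra
    show "((\<lambda>t. p' t * sin (\<alpha> t) + q' t * cos (\<alpha> t)) has_real_derivative
        \<kappa> t * (p' t * cos (\<alpha> t) - q' t * sin (\<alpha> t))) (at t)"
      apply (rule derivative_eq_intros dp'[OF t] dq'[OF t] d\<alpha>[OF t] refl)+
      unfolding eq[OF t] using l_pos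
      apply (simp add: field_simps)
      using ql by algebra
  qed (use unit in \<open>auto simp: eq \<kappa>_def intro!: continuous_intros cpq cont\<close>)
qed

lemma constant_velocity_imp_elastic:
  assumes e: "e1\<^sup>2 + e2\<^sup>2 = 1"
    and vel: "\<And>t. t \<in> {a<..<b} - S \<Longrightarrow> p t * cos (\<alpha> t) - q t * sin (\<alpha> t) = e1"
             "\<And>t. t \<in> {a<..<b} - S \<Longrightarrow> p t * sin (\<alpha> t) + q t * cos (\<alpha> t) = e2"
    and unit: "\<And>t. t \<in> {a<..<b} - S \<Longrightarrow> (p t)\<^sup>2 + (q t)\<^sup>2 = 1"
  shows "elastic_curve_on {a..b} (\<lambda>t. vec2 (x1 t) (x2 t))"
  by (rule affine_curvature_imp_elastic[of "\<lambda>_. e1" "\<lambda>_. e2" "\<lambda>_. 0" 0 0 0])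
     (use vel unit in auto)

text \<open>
  Without energy term the constraints force the velocity to be parallel to the fixed vector
  \<open>(c1, c2)\<close>, but its sign could still change at exceptional points. Along such a line the whole
  configuration is a function of the position \<open>g\<close> of the tip: the angle between the first segment and the
  line obeys a first-order equation in \<open>g\<close>, with the conserved quantity \<open>F\<close> below, and \<open>y\<close> is determined
  by that angle. A reversal would thus revisit a configuration, which injectivity of the curve excludes.
\<close>

lemma abnormal_imp_elastic:
  assumes unit: "\<And>t. t \<in> {a<..<b} - S \<Longrightarrow> (p t)\<^sup>2 + (q t)\<^sup>2 = 1"
    and P: "\<And>t. t \<in> {a<..<b} - S \<Longrightarrow> c1 * cos (\<alpha> t) + c2 * sin (\<alpha> t) + \<eta> * (weight t * y t) = 0"
    and Q: "\<And>t. t \<in> {a<..<b} - S \<Longrightarrow> c1 * (- sin (\<alpha> t) - (x2 b - x2 t) / l)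
        + c2 * (cos (\<alpha> t) + (x1 b - x1 t) / l) + \<nu> / l + \<eta> * weight t = 0"
    and nz: "(c1, c2, \<nu>, \<eta>) \<noteq> 0"
    and inj: "\<And>s t. a \<le> s \<Longrightarrow> s < t \<Longrightarrow> t \<le> b \<Longrightarrow> curve s \<noteq> curve t"
  shows "elastic_curve_on {a..b} (\<lambda>t. vec2 (x1 t) (x2 t))"
proof -
  let ?D = "{a<..<b} - S"
  \<comment> \<open>Components of \<open>(c1, c2)\<close> in the moving frame; \<open>V\<close> below is the component of the velocity
     along \<open>(c1, c2)\<close>, up to the factor \<open>C\<close>.\<close>
  define A1 where "A1 t = c1 * cos (\<alpha> t) + c2 * sin (\<alpha> t)" for t
  define B1 where "B1 t = - c1 * sin (\<alpha> t) + c2 * cos (\<alpha> t)" for t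
  define k where "k t = B1 t + \<eta> * weight t" for t
  define C where "C = sqrt (c1\<^sup>2 + c2\<^sup>2)"
  have cA: "continuous_on {a..b} A1" "continuous_on {a..b} B1"
    unfolding A1_def B1_def by (intro continuous_intros cont)+
  have ck: "continuous_on {a..b} k" unfolding k_def by (intro continuous_intros cA cont_weight)
  have zero_deriv: "z = 0" if "(f has_real_derivative z) (at t)" "t \<in> ?D" "\<And>s. s \<in> ?D \<Longrightarrow> f s = 0"
    for f :: "real \<Rightarrow> real" and z t
  proof -
    have "((\<lambda>_. 0) has_real_derivative z) (at t)"
      using has_field_derivative_transform_within_open[OF that(1) open_dom that(2)] that(3) by simp
    then show ?thesis using DERIV_unique[OF _ DERIV_const] by blast
  qed
  have dA1: "(A1 has_real_derivative q t / l * B1 t) (at t)"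
    and dB1: "(B1 has_real_derivative - (q t / l) * A1 t) (at t)" if t: "t \<in> ?D" for t
    unfolding A1_def B1_def
    by (rule derivative_eq_intros d\<alpha>[OF t] refl | simp add: algebra_simps)+
  have dwy: "((\<lambda>t. weight t * y t) has_real_derivative weight t * q t / l) (at t)"
    if t: "t \<in> ?D" for t
    by (rule DERIV_cong[OF DERIV_mult[OF dweight[OF t] dy[OF t]]]) (use l_pos in \<open>simp add: field_simps\<close>)
  have AP: "A1 t + \<eta> * (weight t * y t) = 0" if "t \<in> ?D" for t
    using P[OF that] by (simp add: A1_def)
  have KQ: "k t + (c2 * (x1 b - x1 t) - c1 * (x2 b - x2 t) + \<nu>) / l = 0" if "t \<in> ?D" for t
  proof -
    have "k t + (c2 * (x1 b - x1 t) - c1 * (x2 b - x2 t) + \<nu>) / l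
        = c1 * (- sin (\<alpha> t) - (x2 b - x2 t) / l) + c2 * (cos (\<alpha> t) + (x1 b - x1 t) / l) + \<nu> / l + \<eta> * weight t"
      by (simp add: k_def B1_def algebra_simps diff_divide_distrib add_divide_distrib)
    then show ?thesis using Q[OF that] by simp
  qed
  have kD: "k t = 0" if t: "t \<in> ?D" for t
  proof -
    have "((\<lambda>t. A1 t + \<eta> * (weight t * y t)) has_real_derivative q t * k t / l) (at t)"
      by (rule DERIV_cong[OF DERIV_add[OF dA1[OF t] DERIV_cmult[OF dwy[OF t]]]])
         (use l_pos in \<open>simp add: k_def field_simps\<close>)
    from zero_deriv[OF this t AP] have qk: "q t * k t = 0" using l_pos by simp
    have "((\<lambda>t. c2 * (x1 b - x1 t) - c1 * (x2 b - x2 t) + \<nu>) has_real_derivative q t * A1 t - p t * B1 t) (at t)"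
      by (rule derivative_eq_intros dx1[OF t] dx2[OF t] refl)+ (simp add: A1_def B1_def algebra_simps)
    note DERIV_add[OF DERIV_add[OF dB1[OF t] DERIV_cmult[OF dweight[OF t], of \<eta>]] DERIV_cdivide[OF this, of l]]
    then have "((\<lambda>t. k t + (c2 * (x1 b - x1 t) - c1 * (x2 b - x2 t) + \<nu>) / l) has_real_derivative - p t * k t / l) (at t)"
      unfolding k_def by (rule DERIV_cong) (use l_pos in \<open>simp add: field_simps\<close>)
    from zero_deriv[OF this t KQ] have "p t * k t = 0" using l_pos by simp
    then show ?thesis using qk unit[OF t] by auto
  qed
  have k0: "k t = 0" if "t \<in> {a..b}" for t by (rule zero_on_dom_imp_zero[OF ck kD that])
  have B1w: "B1 t = - \<eta> * weight t" if "t \<in> {a..b}" for t using k0[OF that] by (simp add: k_def)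
  have A1y: "A1 t - B1 t * y t = 0" if "t \<in> {a..b}" for t
  proof (rule zero_on_dom_imp_zero[OF _ _ that])
    show "continuous_on {a..b} (\<lambda>t. A1 t - B1 t * y t)" by (intro continuous_intros cA cont)
    fix s assume s: "s \<in> ?D"
    then have "s \<in> {a..b}" by auto
    from AP[OF s] B1w[OF this] show "A1 s - B1 s * y s = 0" by (simp add: algebra_simps)
  qed
  have line: "c2 * (x1 b - x1 t) - c1 * (x2 b - x2 t) + \<nu> = 0" if "t \<in> ?D" for t
    using KQ[OF that] kD[OF that] l_pos by simp
  have sq: "A1 t * A1 t + B1 t * B1 t = c1\<^sup>2 + c2\<^sup>2" for t
  proof -
    have "A1 t * A1 t + B1 t * B1 t = (c1\<^sup>2 + c2\<^sup>2) * ((sin (\<alpha> t))\<^sup>2 + (cos (\<alpha> t))\<^sup>2)"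
      unfolding A1_def B1_def by algebra
    then show ?thesis by simp
  qed
  obtain t0 where t0: "t0 \<in> ?D" using dom_nonempty by blast
  then have t0': "t0 \<in> {a..b}" by auto
  have \<eta>: "\<eta> \<noteq> 0"
  proof
    assume "\<eta> = 0"
    then have "B1 t0 = 0" "A1 t0 = 0" using B1w[OF t0'] A1y[OF t0'] by auto
    then have "c1 = 0" "c2 = 0" using sq[of t0] by (auto simp: sum_power2_eq_zero_iff)
    then have "\<nu> = 0" using line[OF t0] by simp
    with \<open>\<eta> = 0\<close> \<open>c1 = 0\<close> \<open>c2 = 0\<close> nz show False by (simp add: zero_prod_def)
  qed
  have B10: "B1 t \<noteq> 0" if "t \<in> {a..b}" for t
    using B1w[OF that] \<eta> weight_pos[of t] by simp
  have C2: "C * C = c1\<^sup>2 + c2\<^sup>2" by (simp add: C_def)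
  have Cpos: "C > 0"
  proof -
    have "B1 t0 * B1 t0 > 0" using B10[OF t0'] by (auto simp: zero_less_mult_iff)
    then have "c1\<^sup>2 + c2\<^sup>2 > 0" using sq[of t0] by (metis add_nonneg_pos zero_le_square)
    then show ?thesis by (simp add: C_def)
  qed
  define V where "V t = c1 * (p t * cos (\<alpha> t) - q t * sin (\<alpha> t)) + c2 * (p t * sin (\<alpha> t) + q t * cos (\<alpha> t))" for t
  have V: "V t = p t * A1 t + q t * B1 t" for t by (simp add: V_def A1_def B1_def algebra_simps)
  have perp: "p t * B1 t - q t * A1 t = 0" if t: "t \<in> ?D" for t
  proof -
    have "((\<lambda>t. c2 * (x1 b - x1 t) - c1 * (x2 b - x2 t) + \<nu>) has_real_derivative - (p t * B1 t - q t * A1 t)) (at t)"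
      by (rule derivative_eq_intros dx1[OF t] dx2[OF t] refl)+ (simp add: A1_def B1_def algebra_simps)
    from zero_deriv[OF this t line] show ?thesis by simp
  qed
  have V2: "V t * V t = C * C" if t: "t \<in> ?D" for t
  proof -
    have "V t * V t + (p t * B1 t - q t * A1 t)\<^sup>2 = ((p t)\<^sup>2 + (q t)\<^sup>2) * (A1 t * A1 t + B1 t * B1 t)"
      unfolding V by algebra
    then show ?thesis using perp[OF t] unit[OF t] by (simp add: C2 sq)
  qed
  define g where "g t = c1 * x1 t + c2 * x2 t" for t
  have cg: "continuous_on {a..b} g" unfolding g_def by (intro continuous_intros cont)
  have dg: "(g has_real_derivative V t) (at t)" if t: "t \<in> ?D" for t
    unfolding g_def V_def by (rule derivative_eq_intros dx1[OF t] dx2[OF t] refl)+ (simp add: algebra_simps)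
  \<comment> \<open>The first factor is the tangent of half the angle between the first segment and the line.\<close>
  define F where "F t = (C - A1 t) / B1 t * exp (g t / (C * l))" for t
  have Fconst: "F s = F t" if "s \<in> {a..b}" "t \<in> {a..b}" for s t
  proof (rule const_of_derivative_zero[OF _ _ that])
    show "continuous_on {a..b} F"
      unfolding F_def using B10 Cpos l_pos by (intro continuous_intros cA cg) auto
    fix r assume r: "r \<in> ?D"
    then have rI: "r \<in> {a..b}" by auto
    have b0: "B1 r \<noteq> 0" by (rule B10[OF rI])
    have CC: "C * C = A1 r * A1 r + B1 r * B1 r" using sq[of r] C2 by simp
    have qV: "q r * (C * C) = V r * B1 r" using perp[OF r] unfolding CC V by algebra
    have dF: "(F has_real_derivative
        (((0 - q r / l * B1 r) * B1 r - (C - A1 r) * (- (q r / l) * A1 r)) / (B1 r * B1 r)) * exp (g r / (C * l))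
         + exp (g r / (C * l)) * (V r / (C * l)) * ((C - A1 r) / B1 r)) (at r)"
      unfolding F_def
      by (rule DERIV_mult[OF DERIV_divide[OF DERIV_diff[OF DERIV_const dA1[OF r]] dB1[OF r] b0]
            DERIV_fun_exp[OF DERIV_cdivide[OF dg[OF r]]]])
    have quot: "((0 - q r / l * B1 r) * B1 r - (C - A1 r) * (- (q r / l) * A1 r)) / (B1 r * B1 r)
        = - (V r / (C * l)) * ((C - A1 r) / B1 r)"
    proof -
      have n: "(0 - q r / l * B1 r) * B1 r - (C - A1 r) * (- (q r / l) * A1 r)
          = q r * (- (B1 r * B1 r) + (C - A1 r) * A1 r) / l"
        by (simp add: algebra_simps diff_divide_distrib add_divide_distrib)
      have m: "- (B1 r * B1 r) + (C - A1 r) * A1 r = - C * (C - A1 r)" using CC by algebra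
      have "q r * (- C * (C - A1 r)) * C = - (V r * B1 r) * (C - A1 r)" using qV by algebra
      then have e: "q r * (- C * (C - A1 r)) = - (V r * B1 r) * (C - A1 r) / C"
        using Cpos nonzero_eq_divide_eq[of C] by blast
      show ?thesis unfolding n m e using b0 Cpos l_pos by (simp add: field_simps)
    qed
    show "(F has_real_derivative 0) (at r)"
      by (rule DERIV_cong[OF dF]) (simp only: quot, simp add: mult_ac)
  qed
  have perp_const: "c2 * x1 s - c1 * x2 s = c2 * x1 t - c1 * x2 t" if "s \<in> {a..b}" "t \<in> {a..b}" for s t
  proof (rule const_of_derivative_zero[OF _ _ that])
    show "continuous_on {a..b} (\<lambda>t. c2 * x1 t - c1 * x2 t)" by (intro continuous_intros cont)
    fix r assume r: "r \<in> ?D"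
    show "((\<lambda>t. c2 * x1 t - c1 * x2 t) has_real_derivative 0) (at r)"
      by (rule derivative_eq_intros dx1[OF r] dx2[OF r] refl)+
         (use perp[OF r] in \<open>simp add: A1_def B1_def algebra_simps\<close>)
  qed
  have solve: "u1 = v1 \<and> u2 = v2" if "c1 * u1 + c2 * u2 = c1 * v1 + c2 * v2" "c2 * u1 - c1 * u2 = c2 * v1 - c1 * v2"
    for u1 u2 v1 v2 :: real
  proof -
    have "C * C * u1 = C * C * v1" "C * C * u2 = C * C * v2"
      using that unfolding C2 by algebra+
    then show ?thesis using Cpos by simp
  qed
  have ginj: "inj_on g {a..b}"
  proof (rule linorder_inj_onI)
    fix s t assume st: "s < t" and s: "s \<in> {a..b}" and t: "t \<in> {a..b}"
    show "g s \<noteq> g t"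
    proof
      assume g: "g s = g t"
      then have x: "x1 s = x1 t \<and> x2 s = x2 t"
        using perp_const[OF s t] unfolding g_def by (intro solve)
      define \<tau> where "\<tau> = (C - A1 s) / B1 s"
      have "\<tau> * exp (g t / (C * l)) = (C - A1 t) / B1 t * exp (g t / (C * l))"
        using Fconst[OF s t] unfolding F_def g \<tau>_def .
      then have \<tau>: "\<tau> = (C - A1 t) / B1 t" using mult_right_cancel[OF exp_not_eq_zero] by blast
      have det: "B1 r * (1 + \<tau> * \<tau>) = 2 * \<tau> * C \<and> A1 r = C - \<tau> * B1 r"
        if "r \<in> {a..b}" "\<tau> = (C - A1 r) / B1 r" for r
      proof -
        have A: "A1 r = C - \<tau> * B1 r" using that B10[OF that(1)] by simp
        have "A1 r * A1 r + B1 r * B1 r = C * C" using sq[of r] C2 by simp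
        then have "B1 r * (B1 r * (1 + \<tau> * \<tau>)) = B1 r * (2 * \<tau> * C)" unfolding A by algebra
        then show ?thesis using B10[OF that(1)] A by simp
      qed
      have "1 + \<tau> * \<tau> \<noteq> 0" using y2_pos[of \<tau>] by (simp add: power2_eq_square add.commute)
      moreover have "B1 s * (1 + \<tau> * \<tau>) = B1 t * (1 + \<tau> * \<tau>)" using det[OF s \<tau>_def] det[OF t \<tau>] by simp
      ultimately have B: "B1 s = B1 t" by simp
      then have A: "A1 s = A1 t" using det[OF s \<tau>_def] det[OF t \<tau>] by simp
      have trig: "cos (\<alpha> s) = cos (\<alpha> t) \<and> sin (\<alpha> s) = sin (\<alpha> t)"
        using A B by (intro solve) (simp_all add: A1_def B1_def algebra_simps)
      have "B1 s * y s = B1 s * y t" using A1y[OF s] A1y[OF t] A B by simp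
      then have "y s = y t" using B10[OF s] by simp
      with x trig have "curve s = curve t" by (simp add: curve_def chart_def second_dir_def)
      then show False using inj[of s t] st s t by auto
    qed
  qed (rule linear)
  have VC: "V t = C \<or> V t = - C" if "t \<in> ?D" for t
    using V2[OF that] by (metis square_eq_iff)
  \<comment> \<open>Injective and continuous along the line, hence monotone: the sign \<open>\<sigma>\<close> of the velocity is
     constant.\<close>
  have "strict_mono_on {a..b} g \<or> strict_antimono_on {a..b} g"
    using injective_eq_monotone_map[OF is_interval_cc cg] ginj by blast
  then obtain \<sigma> :: real where \<sigma>: "\<sigma> * \<sigma> = 1" and mono: "\<And>s t. s \<in> {a..b} \<Longrightarrow> t \<in> {a..b} \<Longrightarrow> s < t \<Longrightarrow> \<sigma> * g s < \<sigma> * g t"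
  proof
    assume m: "strict_mono_on {a..b} g"
    show thesis
      by (rule that[of 1]) (use strict_mono_onD[OF m] in auto)
  next
    assume m: "strict_antimono_on {a..b} g"
    show thesis
      by (rule that[of "-1"]) (use m in \<open>auto simp: monotone_on_def\<close>)
  qed
  have Vt: "V t = \<sigma> * C" if t: "t \<in> ?D" for t
  proof (rule ccontr)
    assume "V t \<noteq> \<sigma> * C"
    then have "V t = - \<sigma> * C" using VC[OF t] \<sigma> by (auto simp: square_eq_1_iff)
    then have "\<sigma> * V t = - C" using \<sigma> by simp
    then have "((\<lambda>t. \<sigma> * g t) has_real_derivative - C) (at t)"
      using DERIV_cmult[OF dg[OF t], of \<sigma>] by simp
    from DERIV_neg_dec_right[OF this] Cpos
    obtain d where d: "d > 0" "\<And>h. 0 < h \<Longrightarrow> h < d \<Longrightarrow> \<sigma> * g (t + h) < \<sigma> * g t" by auto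
    define h where "h = min (d / 2) (b - t)"
    have h: "0 < h" "h < d" "t + h \<le> b" using d(1) t by (auto simp: h_def min_def)
    have "\<sigma> * g t < \<sigma> * g (t + h)" using h t by (intro mono) auto
    with d(2)[OF h(1,2)] show False by simp
  qed
  show ?thesis
  proof (rule constant_velocity_imp_elastic[of "\<sigma> * c1 / C" "\<sigma> * c2 / C"])
    show "(\<sigma> * c1 / C)\<^sup>2 + (\<sigma> * c2 / C)\<^sup>2 = 1"
    proof -
      have "(\<sigma> * c1 / C)\<^sup>2 + (\<sigma> * c2 / C)\<^sup>2 = (\<sigma> * \<sigma>) * (c1\<^sup>2 + c2\<^sup>2) / (C * C)"
        by (simp add: power2_eq_square add_divide_distrib distrib_left mult_ac)
      then show ?thesis using \<sigma> Cpos by (simp add: C2[symmetric])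
    qed
    fix t assume t: "t \<in> ?D"
    let ?T1 = "p t * cos (\<alpha> t) - q t * sin (\<alpha> t)" and ?T2 = "p t * sin (\<alpha> t) + q t * cos (\<alpha> t)"
    have Cn: "C \<noteq> 0" using Cpos by simp
    have "c1 * ?T1 + c2 * ?T2 = \<sigma> * C" using Vt[OF t] by (simp add: V_def)
    also have "\<dots> = \<sigma> / C * (C * C)" using Cn by simp
    also have "\<dots> = \<sigma> / C * (c1 * c1 + c2 * c2)" unfolding C2 by (simp add: power2_eq_square)
    also have "\<dots> = c1 * (\<sigma> * c1 / C) + c2 * (\<sigma> * c2 / C)" by (simp add: algebra_simps add_divide_distrib)
    finally have a: "c1 * ?T1 + c2 * ?T2 = c1 * (\<sigma> * c1 / C) + c2 * (\<sigma> * c2 / C)" .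
    have b: "c2 * ?T1 - c1 * ?T2 = c2 * (\<sigma> * c1 / C) - c1 * (\<sigma> * c2 / C)"
      using perp[OF t] by (simp add: A1_def B1_def algebra_simps)
    from solve[OF a b] show "?T1 = \<sigma> * c1 / C" "?T2 = \<sigma> * c2 / C" by auto
  qed (use unit in auto)
qed

end

section \<open>Gluing elastic arcs\<close>

text \<open>
  Multiply by \<open>exp (- K * t)\<close> to go forward in time, and by \<open>exp (K * t)\<close> to go backward.
\<close>

lemma gronwall_zero:
  fixes f :: "real \<Rightarrow> real"
  assumes uv: "u \<le> v" and cont: "continuous_on {u..v} f"
    and der: "\<And>t. t \<in> {u<..<v} \<Longrightarrow> (f has_real_derivative f' t) (at t)"
    and le: "\<And>t. t \<in> {u<..<v} \<Longrightarrow> \<bar>f' t\<bar> \<le> K * f t"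
  shows "f u = 0 \<Longrightarrow> f v \<le> 0" and "f v = 0 \<Longrightarrow> f u \<le> 0"
proof -
  have e: "((\<lambda>t. exp (k * t)) has_real_derivative exp (k * t) * k) (at t)" for k t :: real
    by (auto intro!: derivative_eq_intros)
  have "exp (- K * v) * f v \<le> exp (- K * u) * f u"
  proof (rule DERIV_nonpos_imp_decreasing_open[OF uv])
    fix t assume "u < t" "t < v"
    then have t: "t \<in> {u<..<v}" by simp
    show "\<exists>D. ((\<lambda>t. exp (- K * t) * f t) has_real_derivative D) (at t) \<and> D \<le> 0"
    proof (intro exI conjI)
      show "((\<lambda>t. exp (- K * t) * f t) has_real_derivative exp (- K * t) * - K * f t + f' t * exp (- K * t)) (at t)"
        by (rule DERIV_mult[OF e der[OF t]])
      have "exp (- K * t) * (f' t - K * f t) \<le> 0" using le[OF t] by (intro mult_nonneg_nonpos) auto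
      then show "exp (- K * t) * - K * f t + f' t * exp (- K * t) \<le> 0" by (simp add: algebra_simps)
    qed
  qed (intro continuous_intros cont)
  then show "f u = 0 \<Longrightarrow> f v \<le> 0" by (simp add: mult_le_0_iff)
  have "exp (K * u) * f u \<le> exp (K * v) * f v"
  proof (rule DERIV_nonneg_imp_increasing_open[OF uv])
    fix t assume "u < t" "t < v"
    then have t: "t \<in> {u<..<v}" by simp
    show "\<exists>D. ((\<lambda>t. exp (K * t) * f t) has_real_derivative D) (at t) \<and> 0 \<le> D"
    proof (intro exI conjI)
      show "((\<lambda>t. exp (K * t) * f t) has_real_derivative exp (K * t) * K * f t + f' t * exp (K * t)) (at t)"
        by (rule DERIV_mult[OF e der[OF t]])
      have "0 \<le> exp (K * t) * (f' t + K * f t)" using le[OF t] by (intro mult_nonneg_nonneg) auto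
      then show "0 \<le> exp (K * t) * K * f t + f' t * exp (K * t)" by (simp add: algebra_simps)
    qed
  qed (intro continuous_intros cont)
  then show "f v = 0 \<Longrightarrow> f u \<le> 0" by (simp add: mult_le_0_iff)
qed

text \<open>
  Uniqueness for the elastica equation at the zero solution, by the Gronwall estimate for
  \<open>\<kappa>\<^sup>2 + \<kappa>1\<^sup>2\<close>.
\<close>

lemma elastica_equation_zero:
  fixes \<kappa> \<kappa>1 \<kappa>2 :: "real \<Rightarrow> real"
  assumes I: "is_interval I"
    and d: "\<And>t. t \<in> I \<Longrightarrow> (\<kappa> has_real_derivative \<kappa>1 t) (at t within I)"
           "\<And>t. t \<in> I \<Longrightarrow> (\<kappa>1 has_real_derivative \<kappa>2 t) (at t within I)"
    and ode: "\<And>t. t \<in> I \<Longrightarrow> \<kappa>2 t + (1 / 2) * \<kappa> t ^ 3 + A * \<kappa> t = 0"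
    and s: "s \<in> I" "\<kappa> s = 0" "\<kappa>1 s = 0" and t: "t \<in> I"
  shows "\<kappa> t = 0"
proof -
  define u v where "u = min s t" and "v = max s t"
  have uv: "u \<le> v" "u \<in> I" "v \<in> I" using s t by (auto simp: u_def v_def min_def max_def)
  have sub: "{u..v} \<subseteq> I" using mem_is_interval_1_I[OF I uv(2,3)] by auto
  have c\<kappa>: "continuous_on {u..v} \<kappa>" "continuous_on {u..v} \<kappa>1"
    using DERIV_continuous_on[of I \<kappa> \<kappa>1] DERIV_continuous_on[of I \<kappa>1 \<kappa>2] d sub
    by (auto intro: continuous_on_subset)
  have dI: "(\<kappa> has_real_derivative \<kappa>1 r) (at r)" "(\<kappa>1 has_real_derivative \<kappa>2 r) (at r)"
    if r: "r \<in> {u<..<v}" for r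
  proof -
    have "r \<in> interior I" using r sub by (meson greaterThanLessThan_subseteq_atLeastAtMost_iff interior_maximal open_greaterThanLessThan order.trans order_refl subsetD)
    then have "at r within I = at r" by (rule at_within_interior)
    then show "(\<kappa> has_real_derivative \<kappa>1 r) (at r)" "(\<kappa>1 has_real_derivative \<kappa>2 r) (at r)"
      using d[of r] r sub by (auto simp: subset_iff)
  qed
  define c where "c r = 1 - \<kappa> r * \<kappa> r / 2 - A" for r
  have "bounded (c ` {u..v})"
    unfolding c_def by (intro compact_imp_bounded compact_continuous_image compact_Icc continuous_intros c\<kappa>) auto
  then obtain K where "\<forall>z\<in>c ` {u..v}. norm z \<le> K" unfolding bounded_iff by blast
  then have K: "\<bar>1 - \<kappa> r * \<kappa> r / 2 - A\<bar> \<le> K" if "r \<in> {u..v}" for r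
    using that by (simp add: c_def)
  define f where "f r = \<kappa> r * \<kappa> r + \<kappa>1 r * \<kappa>1 r" for r
  define f' where "f' r = 2 * (\<kappa> r * \<kappa>1 r) * (1 - \<kappa> r * \<kappa> r / 2 - A)" for r
  have cf: "continuous_on {u..v} f" unfolding f_def by (intro continuous_intros c\<kappa>)
  have df: "(f has_real_derivative f' r) (at r)" if r: "r \<in> {u<..<v}" for r
  proof -
    have k2: "\<kappa>2 r = - (1 / 2) * \<kappa> r ^ 3 - A * \<kappa> r"
      using ode[of r] sub r by (auto simp: subset_iff algebra_simps)
    have e: "\<kappa>2 r * \<kappa>1 r = - (\<kappa> r * \<kappa>1 r) * (\<kappa> r * \<kappa> r / 2 + A)"
      unfolding k2 by (simp add: algebra_simps power3_eq_cube)
    have "(f has_real_derivative (\<kappa>1 r * \<kappa> r + \<kappa>1 r * \<kappa> r) + (\<kappa>2 r * \<kappa>1 r + \<kappa>2 r * \<kappa>1 r)) (at r)"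
      unfolding f_def by (intro DERIV_add DERIV_mult dI[OF r])
    then show ?thesis unfolding e f'_def by (simp add: algebra_simps)
  qed
  have lf: "\<bar>f' r\<bar> \<le> K * f r" if r: "r \<in> {u<..<v}" for r
  proof -
    have "(\<bar>\<kappa> r\<bar> - \<bar>\<kappa>1 r\<bar>)\<^sup>2 \<ge> 0" by simp
    then have "\<bar>2 * (\<kappa> r * \<kappa>1 r)\<bar> \<le> f r" unfolding f_def
      by (simp add: power2_diff abs_mult flip: power2_eq_square)
    then have "\<bar>2 * (\<kappa> r * \<kappa>1 r)\<bar> * \<bar>1 - \<kappa> r * \<kappa> r / 2 - A\<bar> \<le> f r * K"
      using K[of r] r by (intro mult_mono) (auto simp: f_def)
    then show ?thesis unfolding f'_def abs_mult by (simp add: mult.commute)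
  qed
  have fs: "f s = 0" using s by (simp add: f_def)
  have "f t \<le> 0"
    using gronwall_zero[OF uv(1) cf df lf] fs
    by (cases "s \<le> t") (auto simp: u_def v_def min_def max_def split: if_splits)
  then show ?thesis
    by (metis f_def mult_eq_0_iff sum_squares_le_zero_iff)
qed

lemma elastic_curve_on_cong:
  assumes "elastic_curve_on I x" "\<And>t. t \<in> I \<Longrightarrow> x t = x' t"
  shows "elastic_curve_on I x'"
proof -
  have "(x' has_vector_derivative v) (at t within I)"
    if "(x has_vector_derivative v) (at t within I)" "t \<in> I" for v t
    using has_vector_derivative_transform[OF that(2) _ that(1)] assms(2) by metis
  then show ?thesis using assms(1) unfolding elastic_curve_on_def by meson
qed

text \<open>
  Derivatives within a single point are arbitrary, so any unit vector serves as tangent.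
\<close>

lemma elastic_curve_on_trivial_interval:
  assumes "\<And>s t. s \<in> I \<Longrightarrow> t \<in> I \<Longrightarrow> s = t"
  shows "elastic_curve_on I x"
proof -
  have "at t within I = bot" if "t \<in> I" for t
  proof -
    have "I = {t}" using that assms by auto
    then show ?thesis by (simp add: at_within_def)
  qed
  then have "(f has_vector_derivative v) (at t within I)" "(g has_real_derivative w) (at t within I)"
    if "t \<in> I" for f :: "real \<Rightarrow> real ^ 2" and v t g w
    using that by (simp_all add: has_real_derivative_iff_has_vector_derivative
        has_vector_derivative_def has_derivative_def bounded_linear_scaleR_left bounded_linear_mult_left)
  then show ?thesis
    unfolding elastic_curve_on_def
    by (intro exI[of _ "\<lambda>_. vec2 1 0"] exI[of _ "\<lambda>_. 0 :: real"] exI[of _ "0 :: real"])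
       (simp add: norm_vec2)
qed

text \<open>
  Tangent and curvature are determined by the curve, so they agree where two arcs overlap; only the
  constant \<open>A\<close> needs an argument. Near a point where the curvature does not vanish identically, the
  equation determines \<open>A\<close>, by uniqueness at the zero solution even close to zeros of the curvature;
  where it vanishes identically, every \<open>A\<close> is admissible. In both cases the set of constants that are
  admissible near a point is locally constant along the interval, hence constant.
\<close>

lemma elastic_curve_on_glue:
  assumes I: "is_interval I" and nontriv: "\<exists>s\<in>I. \<exists>t\<in>I. s \<noteq> t"
    and loc: "\<And>t. t \<in> I \<Longrightarrow> \<exists>a b e. e > 0 \<and> {a..b} \<subseteq> I \<and> I \<inter> ball t e \<subseteq> {a..b} \<and> elastic_curve_on {a..b} x"
  shows "elastic_curve_on I x"
proof -
  have conn: "connected I" using I by (simp add: is_interval_connected_1)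
  have nb: "at t within I \<noteq> bot" if "t \<in> I" for t
  proof -
    have "\<nexists>z. I = {z}" using nontriv by auto
    then have "t islimpt I" using conn that by (meson connected_imp_perfect)
    then show ?thesis by (simp add: trivial_limit_within)
  qed
  define T where "T t = vector_derivative x (at t within I)" for t
  define \<kappa> where "\<kappa> t = vector_derivative T (at t within I) \<bullet> rot90 (T t)" for t
  define \<kappa>1 where "\<kappa>1 t = vector_derivative \<kappa> (at t within I)" for t
  define \<kappa>2 where "\<kappa>2 t = vector_derivative \<kappa>1 (at t within I)" for t
  note vdw = vector_derivative_within[OF nb]
  have local: "\<exists>e>0. \<exists>A. \<forall>s\<in>I \<inter> ball t e. norm (T s) = 1 \<and>
        (x has_vector_derivative T s) (at s within I) \<and>
        (T has_vector_derivative \<kappa> s *\<^sub>R rot90 (T s)) (at s within I) \<and>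
        (\<kappa> has_real_derivative \<kappa>1 s) (at s within I) \<and>
        (\<kappa>1 has_real_derivative \<kappa>2 s) (at s within I) \<and>
        \<kappa>2 s + (1 / 2) * \<kappa> s ^ 3 + A * \<kappa> s = 0" if t: "t \<in> I" for t
  proof -
    obtain a b e where e: "e > 0" "{a..b} \<subseteq> I" "I \<inter> ball t e \<subseteq> {a..b}" and el: "elastic_curve_on {a..b} x"
      using loc[OF t] by blast
    obtain T' k k1 k2 A where el: "\<And>s. s \<in> {a..b} \<Longrightarrow> norm (T' s) = 1 \<and>
        (x has_vector_derivative T' s) (at s within {a..b}) \<and>
        (T' has_vector_derivative k s *\<^sub>R rot90 (T' s)) (at s within {a..b}) \<and>
        (k has_real_derivative k1 s) (at s within {a..b}) \<and>
        (k1 has_real_derivative k2 s) (at s within {a..b}) \<and>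
        k2 s + (1 / 2) * k s ^ 3 + A * k s = 0"
      using el unfolding elastic_curve_on_def by blast
    let ?N = "I \<inter> ball t e"
    have filt: "at s within {a..b} = at s within I" if "s \<in> ?N" for s
      using that e by (intro at_within_nhd[of s "ball t e"]) auto
    have sI: "s \<in> {a..b}" "s \<in> I" if "s \<in> ?N" for s using that e by auto
    have transfer: "(g has_vector_derivative v) (at s within I)"
      if f: "(f has_vector_derivative v) (at s within I)" and eq: "\<And>r. r \<in> ?N \<Longrightarrow> f r = g r" and s: "s \<in> ?N"
      for f g :: "real \<Rightarrow> 'z::real_normed_vector" and v s
    proof -
      obtain d where d: "d > 0" "ball s d \<subseteq> ball t e" by (rule openE[of "ball t e" s]) (use s in auto)
      show ?thesis
        by (rule has_vector_derivative_transform_within[OF f d(1) sI(2)[OF s]])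
           (use d eq in \<open>auto simp: dist_commute subset_iff\<close>)
    qed
    have dx: "(x has_vector_derivative T' s) (at s within I)" if "s \<in> ?N" for s
      using el[OF sI(1)[OF that]] filt[OF that] by simp
    have T: "T' s = T s" if "s \<in> ?N" for s
      unfolding T_def using vdw[OF sI(2)[OF that] dx[OF that]] by simp
    have dT: "(T has_vector_derivative k s *\<^sub>R rot90 (T s)) (at s within I)" if "s \<in> ?N" for s
      using el[OF sI(1)[OF that]] filt[OF that] T by (intro transfer[OF _ T that]) (auto simp: T[OF that, symmetric])
    have unit: "norm (T s) = 1" if "s \<in> ?N" for s using el[OF sI(1)[OF that]] T[OF that] by simp
    have k: "k s = \<kappa> s" if "s \<in> ?N" for s
      unfolding \<kappa>_def vdw[OF sI(2)[OF that] dT[OF that]]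
      using unit[OF that] by (simp add: rot90_props norm_eq_1)
    have dk: "(\<kappa> has_vector_derivative k1 s) (at s within I)" if "s \<in> ?N" for s
      using el[OF sI(1)[OF that]] filt[OF that]
      by (intro transfer[OF _ k that]) (simp add: has_real_derivative_iff_has_vector_derivative)
    have k1: "k1 s = \<kappa>1 s" if "s \<in> ?N" for s
      unfolding \<kappa>1_def using vdw[OF sI(2)[OF that] dk[OF that]] by simp
    have dk1: "(\<kappa>1 has_vector_derivative k2 s) (at s within I)" if "s \<in> ?N" for s
      using el[OF sI(1)[OF that]] filt[OF that]
      by (intro transfer[OF _ k1 that]) (simp add: has_real_derivative_iff_has_vector_derivative)
    have k2: "k2 s = \<kappa>2 s" if "s \<in> ?N" for s
      unfolding \<kappa>2_def using vdw[OF sI(2)[OF that] dk1[OF that]] by simp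
    show ?thesis
    proof (rule exI[of _ e], rule conjI[OF e(1)], rule exI[of _ A], intro ballI conjI)
      fix s assume s: "s \<in> ?N"
      show "norm (T s) = 1" by (rule unit[OF s])
      show "(x has_vector_derivative T s) (at s within I)" using dx[OF s] T[OF s] by simp
      show "(T has_vector_derivative \<kappa> s *\<^sub>R rot90 (T s)) (at s within I)" using dT[OF s] k[OF s] by simp
      show "(\<kappa> has_real_derivative \<kappa>1 s) (at s within I)" "(\<kappa>1 has_real_derivative \<kappa>2 s) (at s within I)"
        using dk[OF s] dk1[OF s] k1[OF s] k2[OF s] by (simp_all add: has_real_derivative_iff_has_vector_derivative)
      show "\<kappa>2 s + (1 / 2) * \<kappa> s ^ 3 + A * \<kappa> s = 0"
        using el[OF sI(1)[OF s]] k[OF s] k2[OF s] by simp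
    qed
  qed
  have frenet: "norm (T t) = 1 \<and>
        (x has_vector_derivative T t) (at t within I) \<and>
        (T has_vector_derivative \<kappa> t *\<^sub>R rot90 (T t)) (at t within I) \<and>
        (\<kappa> has_real_derivative \<kappa>1 t) (at t within I) \<and>
        (\<kappa>1 has_real_derivative \<kappa>2 t) (at t within I)" if "t \<in> I" for t
    using local[OF that] that by (metis IntI centre_in_ball)
  define good where "good A t \<longleftrightarrow> (\<exists>e>0. \<forall>s\<in>I \<inter> ball t e. \<kappa>2 s + (1 / 2) * \<kappa> s ^ 3 + A * \<kappa> s = 0)" for A t
  have const: "\<forall>A. good A s \<longleftrightarrow> good A t" if st: "s \<in> I" "t \<in> I" for s t
  proof (rule connected_equivalence_relation[OF conn st, of "\<lambda>s t. \<forall>A. good A s \<longleftrightarrow> good A t"])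
    fix t assume t: "t \<in> I"
    obtain e A0 where e: "e > 0" and ode: "\<And>s. s \<in> I \<inter> ball t e \<Longrightarrow> \<kappa>2 s + (1 / 2) * \<kappa> s ^ 3 + A0 * \<kappa> s = 0"
      using local[OF t] by blast
    let ?N = "I \<inter> ball t e"
    have tN: "t \<in> ?N" using t e by simp
    have sub: "\<exists>d>0. I \<inter> ball s d \<subseteq> ?N" if sN: "s \<in> ?N" for s
    proof -
      obtain d where "d > 0" "ball s d \<subseteq> ball t e" by (rule openE[of "ball t e" s]) (use sN in auto)
      then show ?thesis by blast
    qed
    have "\<forall>A. good A t \<longleftrightarrow> good A s" if s: "s \<in> ?N" for s
    proof (cases "\<forall>r\<in>?N. \<kappa> r = 0 \<and> \<kappa>2 r = 0")
      case True
      then have "good A r" if rN: "r \<in> ?N" for A r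
      proof -
        obtain d where "d > 0" "I \<inter> ball r d \<subseteq> ?N" using sub[OF rN] by blast
        then show ?thesis unfolding good_def using True by (intro exI[of _ d]) auto
      qed
      then show ?thesis using s tN by blast
    next
      case False
      have int: "is_interval ?N" using I by (simp add: is_interval_Int is_interval_ball_real)
      have d\<kappa>: "(\<kappa> has_real_derivative \<kappa>1 r) (at r within ?N)" "(\<kappa>1 has_real_derivative \<kappa>2 r) (at r within ?N)"
        if "r \<in> ?N" for r
        using frenet[of r] that by (auto intro: DERIV_subset)
      obtain r0 where r0: "r0 \<in> ?N" "\<kappa> r0 \<noteq> 0"
        using False ode by force
      have nz: "\<not> (\<kappa> r = 0 \<and> \<kappa>1 r = 0)" if "r \<in> ?N" for r
        using elastica_equation_zero[OF int d\<kappa> ode that _ _ r0(1)] r0(2) by blast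
      have "good A r \<longleftrightarrow> A = A0" if r: "r \<in> ?N" for A r
      proof
        assume "A = A0"
        obtain d where "d > 0" "I \<inter> ball r d \<subseteq> ?N" using sub[OF r] by blast
        then show "good A r" unfolding good_def using ode \<open>A = A0\<close> by (intro exI[of _ d]) auto
      next
        assume "good A r"
        then obtain d' where d': "d' > 0" "\<And>s. s \<in> I \<inter> ball r d' \<Longrightarrow> \<kappa>2 s + (1 / 2) * \<kappa> s ^ 3 + A * \<kappa> s = 0"
          unfolding good_def by blast
        obtain d where d: "d > 0" "I \<inter> ball r d \<subseteq> ?N" using sub[OF r] by blast
        show "A = A0"
        proof (rule ccontr)
          assume "A \<noteq> A0"
          have Z: "\<kappa> s = 0" if "s \<in> I" "dist s r < min d d'" for s
          proof -
            have "s \<in> I \<inter> ball r d'" "s \<in> ?N" using that d by (auto simp: dist_commute subset_iff)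
            then have "\<kappa>2 s + (1 / 2) * \<kappa> s ^ 3 + A * \<kappa> s = \<kappa>2 s + (1 / 2) * \<kappa> s ^ 3 + A0 * \<kappa> s"
              using d'(2) ode by simp
            then show ?thesis using \<open>A \<noteq> A0\<close> by simp
          qed
          have rI: "r \<in> I" using r by simp
          have "(\<kappa> has_vector_derivative \<kappa>1 r) (at r within I)"
            using frenet[OF rI] by (simp add: has_real_derivative_iff_has_vector_derivative)
          moreover have "(\<kappa> has_vector_derivative 0) (at r within I)"
            by (rule has_vector_derivative_transform_within[OF has_vector_derivative_const[of 0] _ rI, of "min d d'"])
               (use Z d d' in auto)
          ultimately have "\<kappa>1 r = 0" using vdw[OF rI] by metis
          moreover have "\<kappa> r = 0" using Z[OF rI] d d' by simp
          ultimately show False using nz[OF r] by blast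
        qed
      qed
      then show ?thesis using s tN by blast
    qed
    then show "\<exists>N. openin (top_of_set I) N \<and> t \<in> N \<and> (\<forall>s\<in>N. \<forall>A. good A t \<longleftrightarrow> good A s)"
      using tN by (intro exI[of _ ?N]) (auto simp: openin_open_Int)
  qed auto
  obtain t0 where t0: "t0 \<in> I" using nontriv by blast
  obtain A where A: "good A t0" using local[OF t0] unfolding good_def by meson
  have "\<kappa>2 t + (1 / 2) * \<kappa> t ^ 3 + A * \<kappa> t = 0" if "t \<in> I" for t
  proof -
    have "good A t" using const[OF t0 that] A by blast
    then show ?thesis unfolding good_def using that by auto
  qed
  with frenet show ?thesis unfolding elastic_curve_on_def by blast
qed

section \<open>Geodesics project to elastic curves\<close>

lemma interval_relative_neighbourhood:
  fixes I :: "real set"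
  assumes I: "is_interval I" and t: "t \<in> I" and d: "d > 0" and s: "s \<in> I" "s \<noteq> t"
  obtains a b e where "a \<in> I" "b \<in> I" "a < b" "t - d < a" "b < t + d" "e > 0" "I \<inter> ball t e \<subseteq> {a..b}"
proof -
  have L: "\<exists>a e. a \<in> I \<and> a \<le> t \<and> t - d < a \<and> e > 0 \<and> (\<forall>r\<in>I. dist r t < e \<longrightarrow> a \<le> r) \<and> ((\<exists>r\<in>I. r < t) \<longrightarrow> a < t)"
  proof (cases "\<exists>r\<in>I. r < t")
    case True
    then obtain r where r: "r \<in> I" "r < t" by blast
    define a where "a = max r (t - d / 2)"
    have a: "r \<le> a" "a < t" "t - d < a" using r d by (auto simp: a_def)
    have "a \<in> I" using mem_is_interval_1_I[OF I r(1) t] a by simp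
    moreover have "a \<le> r'" if "dist r' t < t - a" for r' using that by (auto simp: dist_real_def abs_if split: if_splits)
    ultimately show ?thesis using a by (intro exI[of _ a] exI[of _ "t - a"]) auto
  next
    case False
    then show ?thesis using t d by (intro exI[of _ t] exI[of _ 1]) (auto simp: not_less)
  qed
  have R: "\<exists>b e. b \<in> I \<and> t \<le> b \<and> b < t + d \<and> e > 0 \<and> (\<forall>r\<in>I. dist r t < e \<longrightarrow> r \<le> b) \<and> ((\<exists>r\<in>I. r > t) \<longrightarrow> t < b)"
  proof (cases "\<exists>r\<in>I. r > t")
    case True
    then obtain r where r: "r \<in> I" "r > t" by blast
    define b where "b = min r (t + d / 2)"
    have b: "b \<le> r" "t < b" "b < t + d" using r d by (auto simp: b_def)
    have "b \<in> I" using mem_is_interval_1_I[OF I t r(1)] b by simp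
    moreover have "r' \<le> b" if "dist r' t < b - t" for r' using that by (auto simp: dist_real_def abs_if split: if_splits)
    ultimately show ?thesis using b by (intro exI[of _ b] exI[of _ "b - t"]) auto
  next
    case False
    then show ?thesis using t d by (intro exI[of _ t] exI[of _ 1]) (auto simp: not_less)
  qed
  from L obtain a ea where a: "a \<in> I" "a \<le> t" "t - d < a" "ea > 0" "\<And>r. r \<in> I \<Longrightarrow> dist r t < ea \<Longrightarrow> a \<le> r"
    "(\<exists>r\<in>I. r < t) \<longrightarrow> a < t" by blast
  from R obtain b eb where b: "b \<in> I" "t \<le> b" "b < t + d" "eb > 0" "\<And>r. r \<in> I \<Longrightarrow> dist r t < eb \<Longrightarrow> r \<le> b"
    "(\<exists>r\<in>I. r > t) \<longrightarrow> t < b" by blast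
  have "a < b" using a b s by (metis le_less_trans less_le_trans linorder_neqE)
  moreover have "I \<inter> ball t (min ea eb) \<subseteq> {a..b}" using a(5) b(5) by (auto simp: dist_commute)
  ultimately show ?thesis using that[of a b "min ea eb"] a b by simp
qed

text \<open>
  The multiplier of the energy decides between the two cases. In the abnormal case a minimizing
  arc cannot pass twice through the same configuration, because a constant curve over a
  one-point interval would join the two with length \<open>0\<close>.
\<close>

lemma minimizing_arc_elastic:
  assumes l: "l > 0" and ab: "a < b"
    and arc: "\<And>s t. a \<le> s \<Longrightarrow> s \<le> t \<Longrightarrow> t \<le> b \<Longrightarrow>
        horizontal_on l l s t \<gamma> \<and> curve_length s t \<gamma> = ennreal (t - s) \<and> length_minimizing_on l l s t \<gamma>"
  shows "elastic_curve_on {a..b} (tip \<circ> \<gamma>)"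
proof -
  have len: "curve_length s t \<gamma> = ennreal (t - s)" if "a \<le> s" "s \<le> t" "t \<le> b" for s t
    using arc[OF that] by blast
  have hor: "horizontal_on l l a b \<gamma>" using arc[of a b] ab by simp
  obtain S p q x1 x2 \<alpha> y where st: "steered l a b S p q x1 x2 \<alpha> y"
    and curve: "\<And>t. t \<in> {a..b} \<Longrightarrow> steered.curve l x1 x2 \<alpha> y t = \<gamma> t"
    and unit: "\<And>t. t \<in> {a<..<b} - S \<Longrightarrow> (p t)\<^sup>2 + (q t)\<^sup>2 = 1"
    by (rule horizontal_imp_steered[OF l ab hor len]) blast+
  interpret steered l a b S p q x1 x2 \<alpha> y by (rule st)
  have "ennreal (b - a) \<le> curve_length a b \<sigma>"
    if "horizontal_on l l a b \<sigma>" "\<sigma> a = curve a" "\<sigma> b = curve b" for \<sigma>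
    using arc[of a b] ab that curve[of a] curve[of b] unfolding length_minimizing_on_def by auto
  from minimizer_multiplier[OF this unit] obtain h
    where h: "h \<noteq> 0" "\<And>t. t \<in> {a<..<b} - S \<Longrightarrow> h \<bullet> P t = 0" "\<And>t. t \<in> {a<..<b} - S \<Longrightarrow> h \<bullet> Q t = 0"
    by blast
  obtain h0 c1 c2 \<nu> \<eta> where hc: "h = (h0, c1, c2, \<nu>, \<eta>)" by (cases h) auto
  have hP: "h0 * p t + (c1 * cos (\<alpha> t) + c2 * sin (\<alpha> t) + \<eta> * (weight t * y t)) = 0"
    and hQ: "h0 * q t + (c1 * (- sin (\<alpha> t) - (x2 b - x2 t) / l) + c2 * (cos (\<alpha> t) + (x1 b - x1 t) / l)
          + \<nu> / l + \<eta> * weight t) = 0" if "t \<in> {a<..<b} - S" for t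
    using h(2,3)[OF that] unfolding hc P_def Q_def by (simp_all add: algebra_simps)
  have "elastic_curve_on {a..b} (\<lambda>t. vec2 (x1 t) (x2 t))"
  proof (cases "h0 = 0")
    case True
    show ?thesis
    proof (rule abnormal_imp_elastic[OF unit])
      show "(c1, c2, \<nu>, \<eta>) \<noteq> 0" using h(1) True by (simp add: hc zero_prod_def)
      fix s t assume st: "a \<le> s" "s < t" "t \<le> b"
      show "curve s \<noteq> curve t"
      proof
        assume "curve s = curve t"
        then have eq: "\<gamma> s = \<gamma> t" using curve[of s] curve[of t] st by auto
        have "\<gamma> s \<in> config_space l l" using hor st unfolding horizontal_on_def by auto
        then have "horizontal_on l l 0 0 (\<lambda>_. \<gamma> s)"
          by (auto simp: horizontal_on_def piecewise_C1_differentiable_on_def)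
        then have "curve_length s t \<gamma> \<le> curve_length 0 0 (\<lambda>_. \<gamma> s)"
          using arc[of s t] st eq unfolding length_minimizing_on_def by auto
        also have "\<dots> = 0" unfolding curve_length_def by (simp add: o_def)
        finally show False using len[of s t] st by simp
      qed
    qed (use hP hQ True in auto)
  next
    case False
    have solve: "z = - w / h0" if "h0 * z + w = 0" for z w
      using that False by (simp add: field_simps eq_neg_iff_add_eq_0)
    show ?thesis
    proof (rule normal_imp_elastic[OF unit, of "- c1 / h0" "- c2 / h0" "- \<eta> / h0" "- \<nu> / h0"])
      fix t assume t: "t \<in> {a<..<b} - S"
      show "p t = - c1 / h0 * cos (\<alpha> t) + - c2 / h0 * sin (\<alpha> t) + - \<eta> / h0 * (weight t * y t)"
        using solve[OF hP[OF t]] by (simp add: add_divide_distrib diff_divide_distrib)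
      show "q t = - c1 / h0 * (- sin (\<alpha> t) - (x2 b - x2 t) / l)
        + - c2 / h0 * (cos (\<alpha> t) + (x1 b - x1 t) / l) + - \<nu> / h0 / l + - \<eta> / h0 * weight t"
        using solve[OF hQ[OF t]] by (simp add: add_divide_distrib diff_divide_distrib)
    qed auto
  qed
  then show ?thesis
  proof (rule elastic_curve_on_cong)
    fix t assume "t \<in> {a..b}"
    from curve[OF this] show "vec2 (x1 t) (x2 t) = (tip \<circ> \<gamma>) t"
      unfolding curve_def chart_def by (metis comp_apply fst_conv)
  qed
qed

theorem theorem4:
  fixes l1 l2 :: real and I :: "real set" and \<gamma> :: "real \<Rightarrow> linkage"
  assumes "l1 > 0" and "l2 > 0" and "l1 = l2"
    and "geodesic_on l1 l2 I \<gamma>"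
  shows "elastic_curve_on I (tip \<circ> \<gamma>)"
proof (cases "\<exists>s\<in>I. \<exists>t\<in>I. s \<noteq> t")
  case False
  then show ?thesis by (intro elastic_curve_on_trivial_interval) blast
next
  case True
  have geo: "geodesic_on l1 l1 I \<gamma>" using assms by simp
  then have I: "is_interval I" unfolding geodesic_on_def by blast
  show ?thesis
  proof (rule elastic_curve_on_glue[OF I True])
    fix t assume t: "t \<in> I"
    obtain d where d: "d > 0" and min: "\<And>a b. a \<in> I \<Longrightarrow> b \<in> I \<Longrightarrow> t - d < a \<Longrightarrow> a \<le> b \<Longrightarrow> b < t + d \<Longrightarrow>
        length_minimizing_on l1 l1 a b \<gamma>"
      using geo t unfolding geodesic_on_def by metis
    obtain s where "s \<in> I" "s \<noteq> t" using True by metis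
    from interval_relative_neighbourhood[OF I t d this]
    obtain a b e where ab: "a \<in> I" "b \<in> I" "a < b" "t - d < a" "b < t + d" and e: "e > 0" "I \<inter> ball t e \<subseteq> {a..b}"
      by blast
    have sub: "{a..b} \<subseteq> I" using mem_is_interval_1_I[OF I ab(1,2)] by auto
    have "elastic_curve_on {a..b} (tip \<circ> \<gamma>)"
    proof (rule minimizing_arc_elastic[OF assms(1) ab(3)])
      fix u v assume uv: "a \<le> u" "u \<le> v" "v \<le> b"
      then have "u \<in> I" "v \<in> I" using sub by auto
      then show "horizontal_on l1 l1 u v \<gamma> \<and> curve_length u v \<gamma> = ennreal (v - u) \<and> length_minimizing_on l1 l1 u v \<gamma>"
        using geo uv min[of u v] ab unfolding geodesic_on_def by auto
    qed
    with e sub show "\<exists>a b e. e > 0 \<and> {a..b} \<subseteq> I \<and> I \<inter> ball t e \<subseteq> {a..b} \<and> elastic_curve_on {a..b} (tip \<circ> \<gamma>)"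
      by blast
  qed
qed

end
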